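(* For every $\ell\in\mathbb N_+$, the quasirandom $(\ell+1)$-tournamon $\psi_{\ell+1}\in\mathrm{Hom}^+(\mathcal A[T_{(\ell+1)\text{-Tournament}}],\mathbb R)$ satisfies $\mathrm{UCouple}[\ell]$ but does not satisfy $\mathrm{Independence}[\ell]$.
   Context: All languages are finite relational; predicates $P$ have arity $k(P)\ge1$. A canonical theory over $\mathcal L$ is a universal theory containing, for each $P\in\mathcal L$, the axiom that $P(x_1,\dots,x_{k(P)})$ fails whenever two $x_i$ coincide. $T\cup T'$ is the disjoint union. $\mathcal M[T]$: isomorphism classes of finite models. $\mathrm{Hom}^+(\mathcal A[T],\mathbb R)$: functions $\phi:\mathcal M[T]\to[0,1]$, $\phi(M)=\lim_n p(M,N_n)$ for finite models $N_n$ of $T$ of strictly increasing size ($p(M,N)$ = probability a random $|M|$-subset of $V(N)$ induces a copy of $M$). $\phi(\langle K\rangle)=\frac{|\mathrm{Aut}(K)|}{|K|!}\phi([K])$. $k$-tournaments ($k\ge2$): $T_{k\text{-Tournament}}$ has one $k$-ary predicate $E$ and axioms saying that for pairwise distinct $x_1,\dots,x_k$ and $\sigma\in S_k$, $E(x_{\sigma(1)},\dots,x_{\sigma(k)})\equiv E(x_1,\dots,x_k)$ if $\sigma$ is even and $E(x_{\sigma(1)},\dots,x_{\sigma(k)})\equiv\neg E(x_1,\dots,x_k)$ if $\sigma$ is odd (each $k$-set receives one of two orientations). The quasirandom $k$-tournamon $\psi_k$ is the limit of choosing independently and uniformly at random one of the two orientations for each $k$-set; equivalently $\psi_k=\phi_{\mathcal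 N}$ for the theon $\mathcal N_E=\{x\in\mathcal E_k: x_{[k]}<1/2\iff\mathrm{sgn}(\sigma_x)=1\}$, where $\sigma_x\in S_k$ is the permutation with $x_{\{\sigma_x^{-1}(1)\}}<\dots<x_{\{\sigma_x^{-1}(k)\}}$. Theons: for an atomless complete probability space $\Omega=(X,\mathcal A,\mu)$, $\mathcal E_V(\Omega)=X^{r(V)}$, $r(V)$ the finite nonempty subsets of $V$, $\mathcal E_{V,\ell}(\Omega)=X^{\{A\in r(V):|A|\le\ell\}}$, $\mathcal E_k=\mathcal E_{[k]}([0,1])$, $\alpha^*(x)_A=x_{\alpha(A)}$. A $T$-on is a family of measurable $\mathcal N_P\subseteq\mathcal E_{k(P)}(\Omega)$ such that for random $\theta\in\mathcal E_{\mathbb N_+}(\Omega)$ the structure $\mathbf K$ on $\mathbb N_+$ with $R_P(\mathbf K)=\{\alpha\text{ injective}:\alpha^*(\theta)\in\mathcal N_P\}$ is a.s. a model of $T$; $\phi_{\mathcal N}(M)=\Pr[\mathbf K|_{[|M|]}\cong M]$; every $\phi$ is of this form. Peon $\mathcal N_P\subseteq\mathcal E_k(\Omega)$: rank $\le r$ if $\mathcal N_P=\mathcal H\times X^{\{A\subseteq[k]:|A|>r\}}$, $\mathcal H\subseteq \mathcal E_{k,r}(\Omega)$; $\ell$-independent if $\mathcal N_P=\mathcal E_{k,\ell}(\Omega)\times\mathcal H$. $\mathrm{rk}(\phi)$: minimal max-peon-rank of a representing $T$-on. $\mathrm{Independence}[\ell]$: represented by a $T$-on with all peons $\ell$-independent.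 Coupling of $\phi\in\mathrm{Hom}^+(\mathcal A[T],\mathbb R)$ and $\psi\in\mathrm{Hom}^+(\mathcal A[T'],\mathbb R)$: $\xi$ on $T\cup T'$ whose reducts to $T$ and $T'$ are $\phi$ and $\psi$; independent coupling $(\phi\otimes\psi)(\langle M\rangle)=\phi(\langle M|_T\rangle)\psi(\langle M|_{T'}\rangle)$; uniquely coupleable: the independent coupling is the only coupling. $\mathrm{UCouple}[\ell]$: uniquely coupleable with every limit object of rank $\le\ell$ of every canonical theory. *)

theory Defs
  imports
    "HOL-Probability.Probability"
    "HOL-Combinatorics.Permutations"
begin

text \<open>
  Throughout, the set written \<open>[n]\<close> on paper is \<open>{..<n}\<close>, infinite structures live on
  \<open>UNIV :: nat set\<close> instead of the positive integers, and a map \<open>\<alpha> : [k] \<rightarrow> V\<close> is the list of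
  its values (of length \<open>k\<close>).
\<close>

section \<open>Universal theories in finite relational languages\<close>

text \<open>Open (quantifier-free) formulas; the variables are indexed by natural numbers.\<close>

datatype 'p fm =
    Falsum
  | Equal nat nat
  | Rel 'p "nat list"
  | Neg "'p fm"
  | Conj "'p fm" "'p fm"
  | Disj "'p fm" "'p fm"

abbreviation Imp :: "'p fm \<Rightarrow> 'p fm \<Rightarrow> 'p fm" where
  "Imp a b \<equiv> Disj (Neg a) b"

abbreviation Iff :: "'p fm \<Rightarrow> 'p fm \<Rightarrow> 'p fm" where
  "Iff a b \<equiv> Conj (Imp a b) (Imp b a)"

text \<open>The language is given by \<open>preds\<close> and \<open>arity\<close>; each element of \<open>axioms\<close> stands for its
  universal closure.\<close>

record 'p univ_theory =
  preds :: "'p set"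
  arity :: "'p \<Rightarrow> nat"
  axioms :: "'p fm set"

fun fm_over :: "'p univ_theory \<Rightarrow> 'p fm \<Rightarrow> bool" where
  "fm_over T Falsum = True"
| "fm_over T (Equal i j) = True"
| "fm_over T (Rel P xs) = (P \<in> preds T \<and> length xs = arity T P)"
| "fm_over T (Neg a) = fm_over T a"
| "fm_over T (Conj a b) = (fm_over T a \<and> fm_over T b)"
| "fm_over T (Disj a b) = (fm_over T a \<and> fm_over T b)"

definition universal_theory :: "'p univ_theory \<Rightarrow> bool" where
  "universal_theory T \<longleftrightarrow>
     finite (preds T) \<and> (\<forall>P\<in>preds T. 1 \<le> arity T P) \<and> (\<forall>a\<in>axioms T. fm_over T a)"

text \<open>The disjunction of \<open>x\<^sub>i = x\<^sub>j\<close> over \<open>i < j < k\<close>.\<close>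

definition some_coincide :: "nat \<Rightarrow> 'p fm" where
  "some_coincide k = foldr Disj [Equal i j. j \<leftarrow> [0..<k], i \<leftarrow> [0..<j]] Falsum"

definition irreflexivity :: "'p univ_theory \<Rightarrow> 'p \<Rightarrow> 'p fm" where
  "irreflexivity T P = Imp (some_coincide (arity T P)) (Neg (Rel P [0..<arity T P]))"

definition canonical :: "'p univ_theory \<Rightarrow> bool" where
  "canonical T \<longleftrightarrow> universal_theory T \<and> (\<forall>P\<in>preds T. irreflexivity T P \<in> axioms T)"

definition union_theory :: "'p univ_theory \<Rightarrow> 'q univ_theory \<Rightarrow> ('p + 'q) univ_theory" where
  "union_theory T T' =
     \<lparr>preds = preds T <+> preds T', arity = case_sum (arity T) (arity T'),
      axioms = map_fm Inl ` axioms T \<union> map_fm Inr ` axioms T'\<rparr>"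

section \<open>Structures and models\<close>

record 'p struct =
  verts :: "nat set"
  rels :: "'p \<Rightarrow> nat list set"

text \<open>Symbols outside the language are interpreted by the empty relation, so that equality of
  structures is the intended one.\<close>

definition is_struct :: "'p univ_theory \<Rightarrow> 'p struct \<Rightarrow> bool" where
  "is_struct T M \<longleftrightarrow>
     (\<forall>P\<in>preds T. rels M P \<subseteq> {xs. set xs \<subseteq> verts M \<and> length xs = arity T P}) \<and>
     (\<forall>P. P \<notin> preds T \<longrightarrow> rels M P = {})"

fun sat :: "'p struct \<Rightarrow> (nat \<Rightarrow> nat) \<Rightarrow> 'p fm \<Rightarrow> bool" where
  "sat M v Falsum = False"
| "sat M v (Equal i j) = (v i = v j)"
| "sat M v (Rel P xs) = (map v xs \<in> rels M P)"
| "sat M v (Neg a) = (\<not> sat M v a)"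
| "sat M v (Conj a b) = (sat M v a \<and> sat M v b)"
| "sat M v (Disj a b) = (sat M v a \<or> sat M v b)"

definition model :: "'p univ_theory \<Rightarrow> 'p struct \<Rightarrow> bool" where
  "model T M \<longleftrightarrow>
     is_struct T M \<and> (\<forall>a\<in>axioms T. \<forall>v. range v \<subseteq> verts M \<longrightarrow> sat M v a)"

definition fin_models :: "'p univ_theory \<Rightarrow> 'p struct set" where
  "fin_models T = {M. model T M \<and> finite (verts M)}"

definition induced :: "'p struct \<Rightarrow> nat set \<Rightarrow> 'p struct" where
  "induced M V = \<lparr>verts = V, rels = (\<lambda>P. {xs \<in> rels M P. set xs \<subseteq> V})\<rparr>"

definition is_iso :: "(nat \<Rightarrow> nat) \<Rightarrow> 'p struct \<Rightarrow> 'p struct \<Rightarrow> bool" where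
  "is_iso f M N \<longleftrightarrow>
     bij_betw f (verts M) (verts N) \<and> (\<forall>P. rels N P = map f ` rels M P)"

definition iso_class :: "'p struct \<Rightarrow> 'p struct set" where
  "iso_class M = {N. \<exists>f. is_iso f M N}"

definition model_classes :: "'p univ_theory \<Rightarrow> 'p struct set set" where
  "model_classes T = iso_class ` fin_models T"

definition Aut :: "'p struct \<Rightarrow> (nat \<Rightarrow> nat) set" where
  "Aut M = {f. f permutes verts M \<and> is_iso f M M}"

definition reduct_left :: "('p + 'q) struct \<Rightarrow> 'p struct" where
  "reduct_left M = \<lparr>verts = verts M, rels = rels M \<circ> Inl\<rparr>"

definition reduct_right :: "('p + 'q) struct \<Rightarrow> 'q struct" where
  "reduct_right M = \<lparr>verts = verts M, rels = rels M \<circ> Inr\<rparr>"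

section \<open>Limit objects\<close>

definition induced_density :: "'p struct \<Rightarrow> 'p struct \<Rightarrow> real" where
  "induced_density M N =
     real (card {S. S \<subseteq> verts N \<and> card S = card (verts M) \<and> induced N S \<in> iso_class M}) /
     real (card (verts N) choose card (verts M))"

definition Hom_plus :: "'p univ_theory \<Rightarrow> ('p struct set \<Rightarrow> real) set" where
  "Hom_plus T =
     {\<phi> \<in> model_classes T \<rightarrow>\<^sub>E {0..1}.
        \<exists>N. (\<forall>n. N n \<in> fin_models T) \<and> strict_mono (\<lambda>n. card (verts (N n))) \<and>
            (\<forall>M\<in>fin_models T. (\<lambda>n. induced_density M (N n)) \<longlonglongrightarrow> \<phi> (iso_class M))}"

text \<open>The value on the labelled model, written \<open>\<phi>(\<langle>K\<rangle>)\<close> on paper.\<close>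

definition labelled :: "('p struct set \<Rightarrow> real) \<Rightarrow> 'p struct \<Rightarrow> real" where
  "labelled \<phi> K = real (card (Aut K)) / fact (card (verts K)) * \<phi> (iso_class K)"

text \<open>The class of the reduct of \<open>M\<close> is the image of the class of \<open>M\<close> under taking reducts; the
  reduct of a limit object is obtained by summing over all classes with a given reduct.\<close>

definition limit_reduct_left ::
  "'p univ_theory \<Rightarrow> 'q univ_theory \<Rightarrow> (('p + 'q) struct set \<Rightarrow> real) \<Rightarrow> 'p struct set \<Rightarrow> real" where
  "limit_reduct_left T T' \<xi> =
     (\<lambda>c\<in>model_classes T. \<Sum>d\<in>{d \<in> model_classes (union_theory T T'). reduct_left ` d = c}. \<xi> d)"

definition limit_reduct_right ::
  "'p univ_theory \<Rightarrow> 'q univ_theory \<Rightarrow> (('p + 'q) struct set \<Rightarrow> real) \<Rightarrow> 'q struct set \<Rightarrow> real" where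
  "limit_reduct_right T T' \<xi> =
     (\<lambda>c\<in>model_classes T'. \<Sum>d\<in>{d \<in> model_classes (union_theory T T'). reduct_right ` d = c}. \<xi> d)"

definition couplings ::
  "'p univ_theory \<Rightarrow> 'q univ_theory \<Rightarrow> ('p struct set \<Rightarrow> real) \<Rightarrow> ('q struct set \<Rightarrow> real) \<Rightarrow>
   (('p + 'q) struct set \<Rightarrow> real) set" where
  "couplings T T' \<phi> \<psi> =
     {\<xi> \<in> Hom_plus (union_theory T T').
        limit_reduct_left T T' \<xi> = \<phi> \<and> limit_reduct_right T T' \<xi> = \<psi>}"

text \<open>The function \<open>\<xi>\<close> on isomorphism classes with
  \<open>labelled \<xi> M = labelled \<phi> (reduct_left M) * labelled \<psi> (reduct_right M)\<close>; the value does not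
  depend on the chosen representative \<open>M\<close>.\<close>

definition independent_coupling ::
  "'p univ_theory \<Rightarrow> 'q univ_theory \<Rightarrow> ('p struct set \<Rightarrow> real) \<Rightarrow> ('q struct set \<Rightarrow> real) \<Rightarrow>
   ('p + 'q) struct set \<Rightarrow> real" where
  "independent_coupling T T' \<phi> \<psi> =
     (\<lambda>c\<in>model_classes (union_theory T T').
        let M = (SOME M. M \<in> c)
        in fact (card (verts M)) / real (card (Aut M)) *
           (labelled \<phi> (reduct_left M) * labelled \<psi> (reduct_right M)))"

definition uniquely_coupleable ::
  "'p univ_theory \<Rightarrow> 'q univ_theory \<Rightarrow> ('p struct set \<Rightarrow> real) \<Rightarrow> ('q struct set \<Rightarrow> real) \<Rightarrow> bool" where
  "uniquely_coupleable T T' \<phi> \<psi> \<longleftrightarrow>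
     couplings T T' \<phi> \<psi> = {independent_coupling T T' \<phi> \<psi>}"

section \<open>Theons\<close>

definition atomless :: "'a measure \<Rightarrow> bool" where
  "atomless M \<longleftrightarrow>
     (\<forall>A\<in>sets M. 0 < emeasure M A \<longrightarrow>
        (\<exists>B\<in>sets M. B \<subseteq> A \<and> 0 < emeasure M B \<and> emeasure M B < emeasure M A))"

definition atomless_complete_prob :: "'a measure \<Rightarrow> bool" where
  "atomless_complete_prob \<Omega> \<longleftrightarrow> prob_space \<Omega> \<and> complete_measure \<Omega> \<and> atomless \<Omega>"

definition fin_subsets :: "nat set \<Rightarrow> nat set set" where
  "fin_subsets V = {A. A \<subseteq> V \<and> finite A \<and> A \<noteq> {}}"

text \<open>The space of all \<open>(x\<^sub>A)\<close> with \<open>A\<close> a finite nonempty subset of \<open>V\<close>, with the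
  \<^emph>\<open>completed\<close> product measure.\<close>

definition \<E> :: "nat set \<Rightarrow> 'a measure \<Rightarrow> (nat set \<Rightarrow> 'a) measure" where
  "\<E> V \<Omega> = completion (\<Pi>\<^sub>M A\<in>fin_subsets V. \<Omega>)"

text \<open>The point \<open>\<alpha>\<^sup>*(x)\<close>, with \<open>\<alpha>\<close> the map \<open>i \<mapsto> \<alpha> ! i\<close>.\<close>

definition pull :: "nat list \<Rightarrow> (nat set \<Rightarrow> 'a) \<Rightarrow> nat set \<Rightarrow> 'a" where
  "pull \<alpha> x = (\<lambda>A\<in>fin_subsets {..<length \<alpha>}. x ((!) \<alpha> ` A))"

definition theon_struct ::
  "'p univ_theory \<Rightarrow> ('p \<Rightarrow> (nat set \<Rightarrow> 'a) set) \<Rightarrow> (nat set \<Rightarrow> 'a) \<Rightarrow> 'p struct" where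
  "theon_struct T \<N> \<theta> =
     \<lparr>verts = UNIV,
      rels = (\<lambda>P. if P \<in> preds T
                  then {\<alpha>. length \<alpha> = arity T P \<and> distinct \<alpha> \<and> pull \<alpha> \<theta> \<in> \<N> P} else {})\<rparr>"

definition is_theon ::
  "'p univ_theory \<Rightarrow> 'a measure \<Rightarrow> ('p \<Rightarrow> (nat set \<Rightarrow> 'a) set) \<Rightarrow> bool" where
  "is_theon T \<Omega> \<N> \<longleftrightarrow>
     atomless_complete_prob \<Omega> \<and>
     (\<forall>P\<in>preds T. \<N> P \<in> sets (\<E> {..<arity T P} \<Omega>)) \<and>
     (AE \<theta> in \<E> UNIV \<Omega>. model T (theon_struct T \<N> \<theta>))"

definition theon_limit ::
  "'p univ_theory \<Rightarrow> 'a measure \<Rightarrow> ('p \<Rightarrow> (nat set \<Rightarrow> 'a) set) \<Rightarrow> 'p struct set \<Rightarrow> real" where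
  "theon_limit T \<Omega> \<N> =
     (\<lambda>c\<in>model_classes T.
        let n = card (verts (SOME M. M \<in> c))
        in measure (\<E> UNIV \<Omega>)
             {\<theta> \<in> space (\<E> UNIV \<Omega>). induced (theon_struct T \<N> \<theta>) {..<n} \<in> c})"

definition peon_rank_le :: "nat \<Rightarrow> 'a measure \<Rightarrow> (nat set \<Rightarrow> 'a) set \<Rightarrow> nat \<Rightarrow> bool" where
  "peon_rank_le k \<Omega> N r \<longleftrightarrow>
     (\<exists>H. N = {x \<in> space (\<E> {..<k} \<Omega>). restrict x {A \<in> fin_subsets {..<k}. card A \<le> r} \<in> H})"

definition peon_rank :: "nat \<Rightarrow> 'a measure \<Rightarrow> (nat set \<Rightarrow> 'a) set \<Rightarrow> nat" where
  "peon_rank k \<Omega> N = (LEAST r. peon_rank_le k \<Omega> N r)"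

definition peon_independent :: "nat \<Rightarrow> 'a measure \<Rightarrow> (nat set \<Rightarrow> 'a) set \<Rightarrow> nat \<Rightarrow> bool" where
  "peon_independent k \<Omega> N l \<longleftrightarrow>
     (\<exists>H. N = {x \<in> space (\<E> {..<k} \<Omega>). restrict x {A \<in> fin_subsets {..<k}. l < card A} \<in> H})"

text \<open>
  Definitions cannot quantify over types, so the type carrying the space \<open>\<Omega>\<close> of a representing
  theon is a parameter \<open>TYPE('a)\<close> of the next three notions. All occurrences of this parameter in
  a theorem being implicitly universally quantified, it covers every \<open>\<Omega>\<close>. The rank is \<open>\<infinity>\<close> when
  no theon over a space on \<open>'a\<close> represents \<open>\<phi>\<close>.
\<close>

definition rk :: "'a itself \<Rightarrow> 'p univ_theory \<Rightarrow> ('p struct set \<Rightarrow> real) \<Rightarrow> enat" where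
  "rk _ T \<phi> =
     (INF (\<Omega>, \<N>) \<in> {(\<Omega> :: 'a measure, \<N>). is_theon T \<Omega> \<N> \<and> theon_limit T \<Omega> \<N> = \<phi>}.
        SUP P\<in>preds T. enat (peon_rank (arity T P) \<Omega> (\<N> P)))"

definition Independence :: "'a itself \<Rightarrow> nat \<Rightarrow> 'p univ_theory \<Rightarrow> ('p struct set \<Rightarrow> real) \<Rightarrow> bool" where
  "Independence _ l T \<phi> \<longleftrightarrow>
     (\<exists>(\<Omega> :: 'a measure) \<N>. is_theon T \<Omega> \<N> \<and> theon_limit T \<Omega> \<N> = \<phi> \<and>
        (\<forall>P\<in>preds T. peon_independent (arity T P) \<Omega> (\<N> P) l))"

text \<open>Finite languages may be assumed to have natural numbers as predicate symbols.\<close>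

definition UCouple :: "'a itself \<Rightarrow> nat \<Rightarrow> 'p univ_theory \<Rightarrow> ('p struct set \<Rightarrow> real) \<Rightarrow> bool" where
  "UCouple X l T \<phi> \<longleftrightarrow>
     (\<forall>(T' :: nat univ_theory) \<psi>.
        canonical T' \<longrightarrow> \<psi> \<in> Hom_plus T' \<longrightarrow> rk X T' \<psi> \<le> enat l \<longrightarrow>
        uniquely_coupleable T T' \<phi> \<psi>)"

section \<open>The quasirandom tournamon\<close>

definition tournament_axiom :: "nat \<Rightarrow> (nat \<Rightarrow> nat) \<Rightarrow> unit fm" where
  "tournament_axiom k \<sigma> =
     Imp (Neg (some_coincide k))
       (if sign \<sigma> = 1
        then Iff (Rel () (map \<sigma> [0..<k])) (Rel () [0..<k])
        else Iff (Rel () (map \<sigma> [0..<k])) (Neg (Rel () [0..<k])))"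

definition tournament_theory :: "nat \<Rightarrow> unit univ_theory" where
  "tournament_theory k =
     \<lparr>preds = {()}, arity = (\<lambda>_. k),
      axioms = insert (Imp (some_coincide k) (Neg (Rel () [0..<k])))
        (tournament_axiom k ` {\<sigma>. \<sigma> permutes {..<k}})\<rparr>"

definition unit_interval :: "real measure" where
  "unit_interval = restrict_space lebesgue {0..1}"

text \<open>\<open>sorting_perm k x \<sigma>\<close> says that \<open>\<sigma>\<close> is the permutation \<open>\<sigma>\<^sub>x\<close>. It exists iff the coordinates of
  \<open>x\<close> at singletons are pairwise distinct, i.e. almost surely; the points at which it does not
  exist are left out of the peon.\<close>

definition sorting_perm :: "nat \<Rightarrow> (nat set \<Rightarrow> real) \<Rightarrow> (nat \<Rightarrow> nat) \<Rightarrow> bool" where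
  "sorting_perm k x \<sigma> \<longleftrightarrow>
     \<sigma> permutes {..<k} \<and> (\<forall>i j. i < j \<and> j < k \<longrightarrow> x {inv \<sigma> i} < x {inv \<sigma> j})"

definition tournament_peon :: "nat \<Rightarrow> (nat set \<Rightarrow> real) set" where
  "tournament_peon k =
     {x \<in> space (\<E> {..<k} unit_interval).
        \<exists>\<sigma>. sorting_perm k x \<sigma> \<and> (x {..<k} < 1/2 \<longleftrightarrow> sign \<sigma> = 1)}"

definition quasirandom_tournamon :: "nat \<Rightarrow> unit struct set \<Rightarrow> real" where
  "quasirandom_tournamon k = theon_limit (tournament_theory k) unit_interval (\<lambda>_. tournament_peon k)"

end

theory Submission
  imports Defs "HOL-Combinatorics.Multiset_Permutations"
begin

text \<open>
  Limit objects are treated through their values on labelled models: these form a consistent,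
  permutation-invariant family of distributions.

  A coupling \<open>\<xi>\<close> of the quasirandom \<open>k\<close>-tournamon, \<open>k = l + 1\<close>, with a \<open>\<psi>\<close> of rank at most \<open>l\<close> is
  shown to be invariant under reversing the orientation of a single \<open>k\<close>-set; hence, given the model
  of the second theory, the tournament is uniformly distributed, which is independence. Sample the
  model \<open>M\<close> of the second theory on \<open>n\<close> points from coordinates \<open>\<theta>\<^sub>B\<close> with \<open>card B \<le> l\<close>, and then the
  tournament from its conditional distribution under \<open>\<xi>\<close> given \<open>M\<close>. Over the injections
  \<open>v : [m] \<rightarrow> [n]\<close> one averages the difference between the indicators of two tournaments on \<open>[m]\<close> that
  differ in the orientation of \<open>[k]\<close>, multiplied by the indicator of an event in the coordinates of
  \<open>v([m])\<close>. For an event fixing \<open>M\<close> on \<open>[m]\<close>, this bias does not depend on \<open>n\<close> and equals the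
  difference that has to vanish. For a rectangle, each \<open>B\<close> misses one of the points of \<open>[k]\<close>, so the
  bias is at most a cut norm of the signed orientation of a uniformly random tournament, which is
  small by exponential moments and a union bound. A \<open>\<lambda>\<close>-\<open>\<pi>\<close> argument extends this to all events.

  That the independent coupling is a limit object follows from a second moment computation for
  random tournaments on the vertices of a sequence converging to \<open>\<psi>\<close>. Finally, in an
  \<open>l\<close>-independent representation the orientation of an edge would depend only on the coordinate of
  its vertex set, which is unchanged under transposing two vertices.
\<close>

section \<open>Pulling back structures along injective lists\<close>

text \<open>A coupling \<xi> is known only through its values on finite labelled models; nothing
  represents it by coordinates. So, for each n, tournament and coordinates are made conditionally
  independent given M. Tournament and model then have the joint law prescribed by \<xi>, and the
  tournament alone is exactly uniform, so that a bound for random tournaments becomes a bound in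
  expectation. The coordinates can be fixed while the sum over injections is estimated.

  A k-set other than [k] misses a point of [k] just as a set of size at most l = k - 1 does, so the
  remaining orientations can be prescribed within the same cut norm. There are 2^(k n^(k-1)) choices
  of its factors, whose logarithm is smaller by the order n than the number n^k of tuples; this
  leaves a cut norm of order n^(k-1/2).

  The event that M is a given model is merely measurable, and the bound for one rectangle does not
  shrink with its measure. Hence m and the event stay fixed while n grows, and a bound of the bias
  by the measure of the event, uniform in n, controls remainders.\<close>

definition wf_struct :: "'p struct \<Rightarrow> bool" where
  "wf_struct M \<longleftrightarrow> (\<forall>P. \<forall>xs\<in>rels M P. set xs \<subseteq> verts M)"

text \<open>Models with vertex set \<open>{..<m}\<close> are the labelled models. A list \<open>v\<close> is read as the map \<open>i \<mapsto> v ! i\<close>.\<close>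

definition pb :: "nat list \<Rightarrow> 'p struct \<Rightarrow> 'p struct" where
  "pb v M = \<lparr>verts = {..<length v},
     rels = (\<lambda>P. {xs. set xs \<subseteq> {..<length v} \<and> map ((!) v) xs \<in> rels M P})\<rparr>"

definition injs :: "nat \<Rightarrow> nat set \<Rightarrow> nat list set" where
  "injs m V = {v. length v = m \<and> distinct v \<and> set v \<subseteq> V}"

definition labs :: "'p univ_theory \<Rightarrow> nat \<Rightarrow> 'p struct set" where
  "labs T m = {M. model T M \<and> verts M = {..<m}}"

text \<open>The probability that a random injection pulls N back to the labelled model M. Being the
  law of one random structure, it sums to 1 and is consistent under restriction, which
  \<open>induced_density\<close> is not.\<close>

definition inj_density :: "'p struct \<Rightarrow> 'p struct \<Rightarrow> real" where
  "inj_density M N = real (card {v \<in> injs (card (verts M)) (verts N). pb v N = M}) /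
     real (card (injs (card (verts M)) (verts N)))"

lemma wf_struct_if_is_struct: "is_struct T M \<Longrightarrow> wf_struct M"
  unfolding is_struct_def wf_struct_def by (metis (mono_tags, lifting) empty_iff mem_Collect_eq subsetD)

lemma wf_struct_if_model: "model T M \<Longrightarrow> wf_struct M"
  unfolding model_def by (blast intro: wf_struct_if_is_struct)

lemma wf_struct_induced [simp]: "wf_struct (induced M V)"
  by (simp add: wf_struct_def induced_def)

lemma wf_struct_pb [simp]: "wf_struct (pb v M)"
  by (simp add: wf_struct_def pb_def)

lemma verts_pb [simp]: "verts (pb v M) = {..<length v}"
  by (simp add: pb_def)

lemma verts_induced [simp]: "verts (induced M V) = V"
  by (simp add: induced_def)

lemma struct_eqI: "verts M = verts N \<Longrightarrow> (\<And>P xs. xs \<in> rels M P \<longleftrightarrow> xs \<in> rels N P) \<Longrightarrow> (M :: 'p struct) = N"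
  by (rule struct.equality) auto

lemma is_iso_bij: "is_iso f M N \<Longrightarrow> bij_betw f (verts M) (verts N)"
  unfolding is_iso_def by blast

text \<open>\<open>is_iso\<close> maps tuples by a total function. Only when all tuples lie in the
  vertex set are its values elsewhere immaterial; this is the purpose of
  \<open>wf_struct\<close>.\<close>

lemma is_iso_cong:
  assumes "wf_struct M" "\<And>x. x \<in> verts M \<Longrightarrow> f x = g x"
  shows "is_iso f M N = is_iso g M N"
proof -
  have "map f ` rels M P = map g ` rels M P" for P
    using assms unfolding wf_struct_def by (intro image_cong refl map_cong) auto
  moreover have "bij_betw f (verts M) (verts N) = bij_betw g (verts M) (verts N)"
    using assms(2) by (rule bij_betw_cong)
  ultimately show ?thesis by (simp add: is_iso_def)
qed

lemma is_iso_id: "is_iso id M M"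
  by (simp add: is_iso_def)

lemma is_iso_comp: "is_iso f M N \<Longrightarrow> is_iso g N K \<Longrightarrow> is_iso (g \<circ> f) M K"
  by (auto simp: is_iso_def image_image intro: bij_betw_trans)

lemma is_iso_wf: "is_iso f M N \<Longrightarrow> wf_struct M \<Longrightarrow> wf_struct N"
  unfolding is_iso_def wf_struct_def bij_betw_def
  by (metis (no_types, opaque_lifting) imageE image_mono list.set_map)

lemma is_iso_inv:
  assumes "is_iso f M N" "wf_struct M"
  shows "is_iso (inv_into (verts M) f) N M"
proof -
  have bij: "bij_betw f (verts M) (verts N)" and r: "\<And>P. rels N P = map f ` rels M P"
    using assms(1) by (auto simp: is_iso_def)
  have "map (inv_into (verts M) f) ` rels N P = rels M P" for P
  proof -
    have "map (inv_into (verts M) f) ` rels N P = map (inv_into (verts M) f \<circ> f) ` rels M P"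
      by (auto simp: r image_image)
    also have "\<dots> = id ` rels M P"
    proof (rule image_cong)
      fix xs assume "xs \<in> rels M P"
      then have "set xs \<subseteq> verts M" using assms(2) by (auto simp: wf_struct_def)
      then show "map (inv_into (verts M) f \<circ> f) xs = id xs"
        using bij by (auto simp: bij_betw_def intro!: map_idI)
    qed simp
    finally show ?thesis by simp
  qed
  then show ?thesis
    using bij by (simp add: is_iso_def bij_betw_inv_into)
qed

lemma mem_iso_class: "N \<in> iso_class M \<longleftrightarrow> (\<exists>f. is_iso f M N)"
  by (simp add: iso_class_def)

lemma self_in_iso_class [simp]: "M \<in> iso_class M"
  using is_iso_id by (auto simp: mem_iso_class)

lemma iso_class_eqI:
  assumes "is_iso f M N" "wf_struct M"
  shows "iso_class M = iso_class N"
proof -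
  have "is_iso (inv_into (verts M) f) N M" using assms by (rule is_iso_inv)
  then show ?thesis
    using assms(1) unfolding iso_class_def by (blast intro: is_iso_comp)
qed

lemma iso_class_eq_iff:
  assumes "wf_struct M"
  shows "iso_class M = iso_class N \<longleftrightarrow> N \<in> iso_class M"
  using assms iso_class_eqI by (metis mem_iso_class self_in_iso_class)

lemma card_verts_iso: "is_iso f M N \<Longrightarrow> card (verts M) = card (verts N)"
  by (auto simp: is_iso_def bij_betw_same_card)

text \<open>Turns isomorphisms onto induced substructures into equations between structures on an
  initial segment, which can be counted and summed over.\<close>

lemma is_iso_nth_iff:
  assumes "distinct v" "wf_struct M" "set v \<subseteq> verts N" "verts M = {..<length v}"
  shows "is_iso ((!) v) M (induced N (set v)) \<longleftrightarrow> pb v N = M"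
proof
  have inj: "inj_on ((!) v) {..<length v}"
    using assms(1) by (auto simp: inj_on_def nth_eq_iff_index_eq)
  {
    assume iso: "is_iso ((!) v) M (induced N (set v))"
    show "pb v N = M"
    proof (rule struct_eqI)
      fix P xs
      have r: "{xs \<in> rels N P. set xs \<subseteq> set v} = map ((!) v) ` rels M P"
        using iso by (simp add: is_iso_def induced_def)
      show "xs \<in> rels (pb v N) P \<longleftrightarrow> xs \<in> rels M P"
      proof
        assume "xs \<in> rels (pb v N) P"
        then have xs: "set xs \<subseteq> {..<length v}" "map ((!) v) xs \<in> rels N P"
          unfolding pb_def by simp_all
        moreover have "set (map ((!) v) xs) \<subseteq> set v" using xs(1) by auto
        ultimately have "map ((!) v) xs \<in> map ((!) v) ` rels M P" using r by blast
        then obtain ys where ys: "ys \<in> rels M P" "map ((!) v) xs = map ((!) v) ys" by auto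
        moreover have "set ys \<subseteq> {..<length v}"
          using ys(1) assms(2,4) by (auto simp: wf_struct_def)
        ultimately have "xs = ys"
          using xs(1) by (intro map_inj_on[OF ys(2)] inj_on_subset[OF inj]) auto
        then show "xs \<in> rels M P" using ys by simp
      next
        assume xs: "xs \<in> rels M P"
        then have "set xs \<subseteq> {..<length v}" using assms(2,4) by (auto simp: wf_struct_def)
        moreover have "map ((!) v) xs \<in> rels N P" using r xs by blast
        ultimately show "xs \<in> rels (pb v N) P" by (simp add: pb_def)
      qed
    qed (simp add: assms)
  }
  {
    assume M: "pb v N = M"
    have "bij_betw ((!) v) {..<length v} (set v)"
      using assms(1) by (rule bij_betw_nth) auto
    moreover have "{xs \<in> rels N P. set xs \<subseteq> set v} = map ((!) v) ` rels M P" for P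
    proof safe
      fix xs assume xs: "xs \<in> rels N P" "set xs \<subseteq> set v"
      define ys where "ys = map (inv_into {..<length v} ((!) v)) xs"
      have img: "set v = (!) v ` {..<length v}"
        by (auto simp: set_conv_nth)
      have ys: "map ((!) v) ys = xs"
        unfolding ys_def map_map
      proof (rule map_idI)
        fix x assume "x \<in> set xs"
        then have "x \<in> (!) v ` {..<length v}" using xs(2) img by blast
        then show "((!) v \<circ> inv_into {..<length v} ((!) v)) x = x"
          unfolding comp_apply by (rule f_inv_into_f)
      qed
      have "inv_into {..<length v} ((!) v) x \<in> {..<length v}" if "x \<in> set xs" for x
        by (rule inv_into_into) (use that xs(2) img in blast)
      then have "set ys \<subseteq> {..<length v}" unfolding ys_def by auto
      then have "ys \<in> rels (pb v N) P" using xs(1) ys unfolding pb_def by simp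
      then show "xs \<in> map ((!) v) ` rels M P" using ys M by blast
    next
      fix xs assume "xs \<in> rels M P"
      then have "xs \<in> rels (pb v N) P" using M by simp
      then have xs: "set xs \<subseteq> {..<length v}" "map ((!) v) xs \<in> rels N P"
        unfolding pb_def by simp_all
      then show "map ((!) v) xs \<in> rels N P" by simp
      show "\<And>x. x \<in> set (map ((!) v) xs) \<Longrightarrow> x \<in> set v" using xs(1) by auto
    qed
    ultimately show "is_iso ((!) v) M (induced N (set v))"
      by (simp add: is_iso_def induced_def assms)
  }
qed

lemma pb_pb:
  assumes "set v \<subseteq> {..<length w}"
  shows "pb v (pb w M) = pb (map ((!) w) v) M"
proof (rule struct_eqI)
  fix P xs
  show "xs \<in> rels (pb v (pb w M)) P \<longleftrightarrow> xs \<in> rels (pb (map ((!) w) v) M) P"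
  proof (cases "set xs \<subseteq> {..<length v}")
    case True
    then have "(!) v ` set xs \<subseteq> {..<length w}"
      using assms by (auto simp: subset_iff)
    moreover have "map ((!) (map ((!) w) v)) xs = map ((!) w) (map ((!) v) xs)"
      using True by auto
    ultimately show ?thesis unfolding pb_def struct.simps length_map mem_Collect_eq by (metis True set_map)
  qed (simp add: pb_def)
qed simp

lemma finite_injs [simp]: "finite V \<Longrightarrow> finite (injs m V)"
  unfolding injs_def by (rule finite_subset[OF _ finite_lists_length_eq[of V m]]) auto

lemma injs_set_eq: "card S = m \<Longrightarrow> {v \<in> injs m V. set v = S} = (if S \<subseteq> V then permutations_of_set S else {})"
  by (auto simp: injs_def permutations_of_set_def distinct_card)

lemma card_injs_split:
  assumes "finite V"
  shows "card {v \<in> injs m V. Q v} = (\<Sum>S\<in>{S. S \<subseteq> V \<and> card S = m}. card {v \<in> injs m V. Q v \<and> set v = S})"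
proof -
  have "{v \<in> injs m V. Q v} = (\<Union>S\<in>{S. S \<subseteq> V \<and> card S = m}. {v \<in> injs m V. Q v \<and> set v = S})"
    by (auto simp: injs_def distinct_card)
  then show ?thesis
    using assms by (subst card_UN_disjoint[symmetric]) auto
qed

lemma card_injs:
  assumes "finite V"
  shows "card (injs m V) = fact m * (card V choose m)"
proof -
  have "card (injs m V) = (\<Sum>S\<in>{S. S \<subseteq> V \<and> card S = m}. card {v \<in> injs m V. set v = S})"
    using card_injs_split[OF assms, of m "\<lambda>_. True"] by simp
  also have "\<dots> = (\<Sum>S\<in>{S. S \<subseteq> V \<and> card S = m}. fact m)"
  proof (rule sum.cong)
    fix S assume S: "S \<in> {S. S \<subseteq> V \<and> card S = m}"
    then have "finite S" using assms finite_subset by blast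
    then show "card {v \<in> injs m V. set v = S} = fact m"
      using S by (simp add: injs_set_eq)
  qed simp
  also have "\<dots> = fact m * (card V choose m)"
    using n_subsets[OF assms, of m] by simp
  finally show ?thesis .
qed

section \<open>Automorphisms and labelled copies\<close>

lemma finite_Aut: "finite (verts M) \<Longrightarrow> finite (Aut M)"
  unfolding Aut_def by (rule finite_subset[OF _ finite_permutations]) auto

lemma card_Aut_pos: "finite (verts M) \<Longrightarrow> 0 < card (Aut M)"
  using finite_Aut[of M] is_iso_id[of M] by (auto simp: card_gt_0_iff Aut_def intro: permutes_id)

lemma card_Aut_le:
  assumes "is_iso f M N" "wf_struct M" "finite (verts M)"
  shows "card (Aut M) \<le> card (Aut N)"
proof -
  define f' where "f' = inv_into (verts M) f"
  have bij: "bij_betw f (verts M) (verts N)" using assms(1) by (simp add: is_iso_def)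
  have iso': "is_iso f' N M" unfolding f'_def using assms by (intro is_iso_inv)
  have wfN: "wf_struct N" using assms is_iso_wf by blast
  have finN: "finite (verts N)" using bij assms(3) bij_betw_finite by blast
  \<comment> \<open>Conjugation by f, completed by the identity because members of
    \<open>Aut\<close> fix all points off the vertex set.\<close>
  define c where "c g = (\<lambda>x. if x \<in> verts N then f (g (f' x)) else x)" for g
  have f'f: "f' (f x) = x" if "x \<in> verts M" for x
    using bij that by (auto simp: f'_def bij_betw_def)
  have "c ` Aut M \<subseteq> Aut N"
  proof safe
    fix g assume g: "g \<in> Aut M"
    have "is_iso (f \<circ> (g \<circ> f')) N N"
    proof (rule is_iso_comp[OF is_iso_comp[OF iso'] assms(1)])
      show "is_iso g M M" using g unfolding Aut_def by blast
    qed
    then have iso: "is_iso (c g) N N"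
      using is_iso_cong[OF wfN, of "c g" "f \<circ> (g \<circ> f')"] by (simp add: c_def)
    moreover have "c g permutes verts N"
      using is_iso_bij[OF iso] by (intro bij_imp_permutes) (auto simp: c_def)
    ultimately show "c g \<in> Aut N" by (simp add: Aut_def)
  qed
  moreover have "inj_on c (Aut M)"
  proof (rule inj_onI)
    fix g h assume gh: "g \<in> Aut M" "h \<in> Aut M" "c g = c h"
    show "g = h"
    proof (rule ext)
      fix x
      show "g x = h x"
      proof (cases "x \<in> verts M")
        case True
        then have "f x \<in> verts N" using bij by (auto simp: bij_betw_def)
        then have "f (g x) = f (h x)"
          using fun_cong[OF gh(3), of "f x"] True by (simp add: c_def f'f)
        moreover have "g x \<in> verts M" "h x \<in> verts M"
          using gh(1,2) True by (simp_all add: Aut_def permutes_in_image)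
        ultimately show ?thesis using bij by (metis bij_betw_def inj_onD)
      next
        case False
        then show ?thesis using gh(1,2) unfolding Aut_def by (metis (no_types, lifting) mem_Collect_eq permutes_not_in)
      qed
    qed
  qed
  ultimately show ?thesis using finite_Aut[OF finN] card_inj_on_le by blast
qed

lemma card_Aut_iso:
  assumes "is_iso f M N" "wf_struct M" "finite (verts M)"
  shows "card (Aut M) = card (Aut N)"
proof -
  have "finite (verts N)"
    using assms by (auto simp: is_iso_def dest: bij_betw_finite)
  then show ?thesis
    using card_Aut_le[OF assms] card_Aut_le[OF is_iso_inv[OF assms(1,2)] is_iso_wf[OF assms(1,2)]]
    by linarith
qed

text \<open>If f is one isomorphism of M onto \<open>induced N S\<close>, the others are f composed
  with the automorphisms of M, and the lists v are the value tables of these maps.\<close>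

lemma card_pb_eq_with_image:
  assumes wf: "wf_struct M" and M: "verts M = {..<m}" and S: "S \<subseteq> verts N" "card S = m" "finite S"
  shows "card {v \<in> injs m (verts N). pb v N = M \<and> set v = S} =
    (if induced N S \<in> iso_class M then card (Aut M) else 0)"
proof -
  define X where "X = {v \<in> injs m (verts N). pb v N = M \<and> set v = S}"
  have X: "v \<in> X \<longleftrightarrow> is_iso ((!) v) M (induced N S)" if v: "length v = m" "distinct v" "set v = S" for v
  proof -
    have "set v \<subseteq> verts N" "verts M = {..<length v}" using v S(1) M by simp_all
    then have "is_iso ((!) v) M (induced N S) \<longleftrightarrow> pb v N = M"
      using is_iso_nth_iff[OF v(2) wf] v(3) by blast
    then show ?thesis using v S(1) by (simp add: X_def injs_def)
  qed
  have XD: "length v = m" "distinct v" "set v = S" if "v \<in> X" for v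
    using that by (auto simp: X_def injs_def)
  show ?thesis
  proof (cases "induced N S \<in> iso_class M")
    case False
    then have "v \<notin> X" for v
      using X[of v] XD[of v] unfolding mem_iso_class by blast
    then have "X = {}" by blast
    then show ?thesis using False unfolding X_def[symmetric] by simp
  next
    case True
    then obtain f where f: "is_iso f M (induced N S)" by (auto simp: mem_iso_class)
    then have bij: "bij_betw f {..<m} S" using is_iso_bij[OF f] by (simp add: M)
    define F where "F g = map (f \<circ> g) [0..<m]" for g :: "nat \<Rightarrow> nat"
    have nF: "F g ! i = f (g i)" if "i < m" for g i using that by (simp add: F_def)
    have "F g \<in> X" if g: "g \<in> Aut M" for g
    proof -
      have gp: "g permutes {..<m}" using g by (simp add: Aut_def M)
      have b: "bij_betw (f \<circ> g) {..<m} S"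
        using permutes_imp_bij[OF gp] bij by (rule bij_betw_trans)
      have "length (F g) = m" by (simp add: F_def)
      moreover have "distinct (F g)"
        using bij_betw_imp_inj_on[OF b] unfolding F_def distinct_map set_upt atLeast0LessThan by simp
      moreover have "set (F g) = S"
        using bij_betw_imp_surj_on[OF b] unfolding F_def set_map set_upt atLeast0LessThan .
      moreover have "is_iso (f \<circ> g) M (induced N S)"
      proof (rule is_iso_comp[OF _ f])
        show "is_iso g M M" using g unfolding Aut_def by blast
      qed
      then have "is_iso ((!) (F g)) M (induced N S)"
        using is_iso_cong[OF wf, of "(!) (F g)" "f \<circ> g"] nF unfolding M by simp
      ultimately show "F g \<in> X" by (intro iffD2[OF X])
    qed
    moreover have "v \<in> F ` Aut M" if vX: "v \<in> X" for v
    proof -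
      have v: "length v = m" "distinct v" "set v = S" "is_iso ((!) v) M (induced N S)"
        using XD[OF vX] iffD1[OF X[OF XD[OF vX]] vX] by simp_all
      define g where "g x = (if x < m then inv_into {..<m} f (v ! x) else x)" for x
      have "is_iso (inv_into {..<m} f \<circ> (!) v) M M"
        using v(4) is_iso_inv[OF f wf] unfolding M by (rule is_iso_comp)
      then have "is_iso g M M"
        using is_iso_cong[OF wf, of g "inv_into {..<m} f \<circ> (!) v"] g_def unfolding M by simp
      moreover have "g permutes {..<m}"
        using is_iso_bij[OF calculation] by (intro bij_imp_permutes) (auto simp: M g_def)
      ultimately have "g \<in> Aut M" unfolding Aut_def M by blast
      moreover have "v = F g"
      proof (rule nth_equalityI)
        fix i assume i: "i < length v"
        then have "v ! i \<in> f ` {..<m}" using v bij by (auto simp: bij_betw_def)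
        then show "v ! i = F g ! i" using i v(1) by (auto simp: nF g_def intro!: f_inv_into_f[symmetric])
      qed (simp add: F_def v)
      ultimately show "v \<in> F ` Aut M" by blast
    qed
    ultimately have FX: "F ` Aut M = X" by blast
    have inj: "inj_on F (Aut M)"
    proof (rule inj_onI, rule ext)
      fix g h x assume gh: "g \<in> Aut M" "h \<in> Aut M" "F g = F h"
      show "g x = h x"
      proof (cases "x < m")
        case True
        then have "f (g x) = f (h x)" using gh(3) nF by metis
        moreover have "g x < m" "h x < m"
          using gh(1,2) True permutes_in_image[of g "{..<m}" x] permutes_in_image[of h "{..<m}" x]
          by (simp_all add: Aut_def M)
        ultimately show ?thesis using bij by (metis bij_betw_def inj_onD lessThan_iff)
      next
        case False
        then have "x \<notin> verts M" by (simp add: M)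
        then show ?thesis using gh(1,2) unfolding Aut_def by (metis (no_types, lifting) mem_Collect_eq permutes_not_in)
      qed
    qed
    show ?thesis using True card_image[OF inj] by (simp add: FX X_def[symmetric])
  qed
qed

lemma card_pb_eq:
  assumes "wf_struct M" "verts M = {..<m}" "finite (verts N)"
  shows "card {v \<in> injs m (verts N). pb v N = M} =
    card (Aut M) * card {S. S \<subseteq> verts N \<and> card S = m \<and> induced N S \<in> iso_class M}"
proof -
  have "card {v \<in> injs m (verts N). pb v N = M} =
    (\<Sum>S\<in>{S. S \<subseteq> verts N \<and> card S = m}. if induced N S \<in> iso_class M then card (Aut M) else 0)"
  proof (rule trans[OF card_injs_split[OF assms(3)] sum.cong])
    fix S assume "S \<in> {S. S \<subseteq> verts N \<and> card S = m}"
    then show "card {v \<in> injs m (verts N). pb v N = M \<and> set v = S} =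
        (if induced N S \<in> iso_class M then card (Aut M) else 0)"
      using assms by (intro card_pb_eq_with_image) (auto intro: finite_subset)
  qed simp
  also have "\<dots> = card (Aut M) * card {S \<in> {S. S \<subseteq> verts N \<and> card S = m}. induced N S \<in> iso_class M}"
    using assms(3) by (subst sum.inter_filter[symmetric]) (auto simp: mult.commute)
  finally show ?thesis by (simp add: conj_assoc)
qed

lemma inj_density_eq:
  assumes "wf_struct M" "verts M = {..<m}" "finite (verts N)"
  shows "inj_density M N = real (card (Aut M)) / fact m * induced_density M N"
  using assms by (simp add: inj_density_def induced_density_def card_pb_eq card_injs)

text \<open>Double counting of the injections of [m] into itself: each pulls M back to a copy on the
  same vertices, and each copy arises from as many injections as M has automorphisms.\<close>

lemma iso_class_card_labs:
  assumes "wf_struct M" "verts M = {..<m}"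
  shows "card {N \<in> iso_class M. verts N = {..<m}} * card (Aut M) = fact m"
proof -
  let ?C = "{N \<in> iso_class M. verts N = {..<m}}"
  have pbC: "pb v M \<in> ?C" if "v \<in> injs m {..<m}" for v
  proof -
    have v: "length v = m" "distinct v" "set v \<subseteq> {..<m}" using that by (auto simp: injs_def)
    then have sv: "set v = {..<m}" by (intro card_subset_eq) (auto simp: distinct_card)
    then have "is_iso ((!) v) (pb v M) (induced M (set v))"
      using v assms by (subst is_iso_nth_iff) auto
    moreover have "induced M (set v) = M"
      using assms sv by (intro struct_eqI) (auto simp: induced_def wf_struct_def)
    ultimately have "iso_class (pb v M) = iso_class M" by (intro iso_class_eqI) auto
    then show ?thesis using v(1) by (metis (mono_tags, lifting) mem_Collect_eq self_in_iso_class verts_pb)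
  qed
  have C: "card {v \<in> injs m {..<m}. pb v M = N} = card (Aut M)" if N: "N \<in> ?C" for N
  proof -
    from N obtain f where f: "is_iso f M N" by (auto simp: mem_iso_class)
    then have wf: "wf_struct N" using assms is_iso_wf by blast
    have c: "iso_class N = iso_class M" using f assms by (metis iso_class_eqI)
    have "induced M {..<m} = M"
      using assms by (intro struct_eqI) (auto simp: induced_def wf_struct_def)
    then have "{S. S \<subseteq> verts M \<and> card S = m \<and> induced M S \<in> iso_class N} = {{..<m}}"
      using assms(2) card_subset_eq[of "{..<m}"] by (auto simp: c)
    then have "card {v \<in> injs m {..<m}. pb v M = N} = card (Aut N)"
      using card_pb_eq[OF wf, of m M] N assms(2) by simp
    then show ?thesis using card_Aut_iso[OF f] assms by simp
  qed
  have fin: "finite ?C"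
  proof (rule finite_subset)
    show "?C \<subseteq> (\<lambda>v. pb v M) ` injs m {..<m}"
    proof
      fix N assume "N \<in> ?C"
      then have "card {v \<in> injs m {..<m}. pb v M = N} \<noteq> 0"
        using C card_Aut_pos[of M] assms(2) by auto
      then have "{v \<in> injs m {..<m}. pb v M = N} \<noteq> {}" by (metis card.empty)
      then show "N \<in> (\<lambda>v. pb v M) ` injs m {..<m}" by auto
    qed
  qed simp
  have "card (injs m {..<m}) = (\<Sum>N\<in>?C. card {v \<in> injs m {..<m}. pb v M = N})"
    using pbC fin by (subst card_UN_disjoint[symmetric]) (auto intro!: arg_cong[where f = card])
  also have "\<dots> = card ?C * card (Aut M)" using C by simp
  finally show ?thesis by (simp add: card_injs)
qed

section \<open>Labelled densities of limit objects\<close>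

lemma sat_pb:
  assumes "distinct v" "\<And>i. f i < length v"
  shows "sat (pb v M) f a \<longleftrightarrow> sat M ((!) v \<circ> f) a"
proof (induction a)
  case (Equal i j)
  then show ?case using assms by (simp add: nth_eq_iff_index_eq)
next
  case (Rel P xs)
  then show ?case using assms by (auto simp: pb_def image_subset_iff comp_def)
qed simp_all

text \<open>This rests on the axioms being universal closures: an assignment of vertices of the
  pullback, composed with v, is an assignment in M, and injectivity of v preserves the equality
  atoms.\<close>

lemma model_pb:
  assumes "model T M" "distinct v" "set v \<subseteq> verts M"
  shows "model T (pb v M)"
proof -
  have "is_struct T (pb v M)"
    unfolding is_struct_def
  proof (intro conjI ballI allI impI subsetI)
    fix P xs assume P: "P \<in> preds T" and xs: "xs \<in> rels (pb v M) P"
    then have "map ((!) v) xs \<in> rels M P" "set xs \<subseteq> {..<length v}" by (simp_all add: pb_def)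
    moreover have "length ys = arity T P" if "ys \<in> rels M P" for ys
      using assms(1) P that unfolding model_def is_struct_def by blast
    ultimately show "xs \<in> {xs. set xs \<subseteq> verts (pb v M) \<and> length xs = arity T P}"
      by (metis (mono_tags, lifting) length_map mem_Collect_eq verts_pb)
  next
    fix P assume "P \<notin> preds T"
    then show "rels (pb v M) P = {}"
      using assms(1) unfolding model_def is_struct_def pb_def by simp
  qed
  moreover have "sat (pb v M) f a" if "a \<in> axioms T" "range f \<subseteq> {..<length v}" for a f
  proof -
    have "f i < length v" for i using that(2) by auto
    moreover have "range ((!) v \<circ> f) \<subseteq> verts M"
      using calculation assms(3) by (auto simp: subset_iff)
    ultimately show ?thesis using assms(1,2) that(1) by (simp add: sat_pb model_def)
  qed
  ultimately show ?thesis unfolding model_def verts_pb by blast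
qed

lemma pb_in_labs:
  assumes "model T M" "v \<in> injs m (verts M)"
  shows "pb v M \<in> labs T m"
  using assms model_pb[of T M v] by (auto simp: labs_def injs_def)

lemma labs_fin_models: "M \<in> labs T m \<Longrightarrow> M \<in> fin_models T"
  by (simp add: labs_def fin_models_def)

lemma labs_wf: "M \<in> labs T m \<Longrightarrow> wf_struct M"
  unfolding labs_def using wf_struct_if_model by blast

lemma labs_verts: "M \<in> labs T m \<Longrightarrow> verts M = {..<m}"
  by (simp add: labs_def)

lemma finite_labs:
  assumes "finite (preds T)"
  shows "finite (labs T m)"
proof -
  let ?L = "\<lambda>P. Pow {xs. set xs \<subseteq> {..<m} \<and> length xs = arity T P}"
  let ?F = "\<lambda>M. restrict (rels M) (preds T)"
  have "?F ` labs T m \<subseteq> (\<Pi>\<^sub>E P\<in>preds T. ?L P)"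
  proof (intro image_subsetI PiE_I)
    fix M P assume M: "M \<in> labs T m" and P: "P \<in> preds T"
    then have "rels M P \<subseteq> {xs. set xs \<subseteq> {..<m} \<and> length xs = arity T P}"
      unfolding labs_def model_def is_struct_def by blast
    then show "restrict (rels M) (preds T) P \<in> ?L P" using P by simp
  qed simp
  moreover have "finite (\<Pi>\<^sub>E P\<in>preds T. ?L P)"
    using assms by (intro finite_PiE) (auto intro: finite_lists_length_eq)
  ultimately have "finite (?F ` labs T m)" by (rule finite_subset)
  moreover have "inj_on ?F (labs T m)"
  proof (rule inj_onI)
    fix M N assume M: "M \<in> labs T m" and N: "N \<in> labs T m" and eq: "?F M = ?F N"
    have "rels M P = rels N P" for P
    proof (cases "P \<in> preds T")
      case True
      then show ?thesis using fun_cong[OF eq, of P] by simp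
    next
      case False
      then show ?thesis using M N by (simp add: labs_def model_def is_struct_def)
    qed
    then show "M = N" using labs_verts[OF M] labs_verts[OF N] by (intro struct_eqI) auto
  qed
  ultimately show ?thesis by (rule finite_imageD)
qed

lemma card_fibres:
  assumes "finite S" "finite T" "g ` S \<subseteq> T"
  shows "card S = (\<Sum>y\<in>T. card {x \<in> S. g x = y})"
  using sum.group[OF assms, of "\<lambda>_. 1::nat"] by simp

section \<open>Restrictions of a random injection\<close>

lemma comp_injs:
  assumes "w \<in> injs r V" "v \<in> injs m {..<r}"
  shows "map ((!) w) v \<in> injs m V"
proof -
  have v: "length v = m" "distinct v" "set v \<subseteq> {..<r}" and w: "length w = r" "distinct w" "set w \<subseteq> V"
    using assms by (auto simp: injs_def)
  have "inj_on ((!) w) {..<r}"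
    using w(1,2) by (auto simp: inj_on_def nth_eq_iff_index_eq)
  then have "distinct (map ((!) w) v)"
    using v by (simp add: distinct_map inj_on_subset)
  moreover have "(!) w ` set v \<subseteq> V"
    using v(3) w(1,3) by (auto simp: subset_iff)
  ultimately show ?thesis using v(1) by (simp add: injs_def)
qed

lemma ex_bij_map:
  assumes "finite V" "u \<in> injs m V" "u' \<in> injs m V"
  shows "\<exists>\<pi>. bij_betw \<pi> V V \<and> map \<pi> u = u'"
proof -
  have u: "length u = m" "distinct u" "set u \<subseteq> V" and u': "length u' = m" "distinct u'" "set u' \<subseteq> V"
    using assms by (auto simp: injs_def)
  have bu: "bij_betw ((!) u) {..<m} (set u)" "bij_betw ((!) u') {..<m} (set u')"
    using u u' by (auto intro!: bij_betw_nth)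
  define g where "g = (!) u' \<circ> inv_into {..<m} ((!) u)"
  have g: "bij_betw g (set u) (set u')"
    unfolding g_def using bij_betw_inv_into[OF bu(1)] bu(2) by (rule bij_betw_trans)
  have "card (V - set u) = card (V - set u')"
    using u u' by (simp add: card_Diff_subset distinct_card)
  then obtain h where h: "bij_betw h (V - set u) (V - set u')"
    using assms(1) finite_same_card_bij[of "V - set u" "V - set u'"] by auto
  define \<pi> where "\<pi> = (\<lambda>x. if x \<in> set u then g x else h x)"
  have "bij_betw \<pi> (set u \<union> (V - set u)) (set u' \<union> (V - set u'))"
    unfolding \<pi>_def using g h by (rule bij_betw_disjoint_Un) auto
  moreover have "set u \<union> (V - set u) = V" "set u' \<union> (V - set u') = V" using u u' by auto
  ultimately have "bij_betw \<pi> V V" by simp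
  moreover have "map \<pi> u = u'"
  proof (rule nth_equalityI)
    fix i assume "i < length (map \<pi> u)"
    then have i: "i < m" using u by simp
    have "inv_into {..<m} ((!) u) (u ! i) = i"
      using bu(1) i by (auto simp: bij_betw_def)
    then show "map \<pi> u ! i = u' ! i" using i u by (simp add: \<pi>_def g_def)
  qed (simp add: u u')
  ultimately show ?thesis by blast
qed

text \<open>A permutation of V carrying u to u' carries extensions of u to extensions of u'.\<close>

lemma card_extensions_le:
  assumes "finite V" "v \<in> injs m {..<r}" "u \<in> injs m V" "u' \<in> injs m V"
  shows "card {w \<in> injs r V. map ((!) w) v = u} \<le> card {w \<in> injs r V. map ((!) w) v = u'}"
proof -
  obtain \<pi> where \<pi>: "bij_betw \<pi> V V" "map \<pi> u = u'" using ex_bij_map assms by metis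
  have inj: "inj_on \<pi> V" and im: "\<pi> ` V = V" using \<pi>(1) by (auto simp: bij_betw_def)
  show ?thesis
  proof (rule card_inj_on_le)
    show "inj_on (map \<pi>) {w \<in> injs r V. map ((!) w) v = u}"
      by (rule inj_on_subset[OF inj_on_mapI[of \<pi> "injs r V"]])
        (auto simp: injs_def intro: inj_on_subset[OF inj])
    show "map \<pi> ` {w \<in> injs r V. map ((!) w) v = u} \<subseteq> {w \<in> injs r V. map ((!) w) v = u'}"
    proof safe
      fix w assume w: "w \<in> injs r V" "u = map ((!) w) v"
      have "set v \<subseteq> {..<length w}" using assms(2) w by (auto simp: injs_def)
      then have "map ((!) (map \<pi> w)) v = map \<pi> (map ((!) w) v)" by auto
      then show "map ((!) (map \<pi> w)) v = u'" by (simp only: w(2)[symmetric] \<pi>(2))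
      show "map \<pi> w \<in> injs r V"
        using w(1) inj im by (auto simp: injs_def distinct_map intro: inj_on_subset)
    qed
  qed (use assms(1) in simp)
qed

text \<open>Restricting a uniformly random injection of [r] along v gives a uniformly random
  injection of [m], since all u have equally many extensions. Multiplied out, the equation also
  covers the case that there are no injections.\<close>

lemma card_restriction:
  assumes "finite V" "v \<in> injs m {..<r}"
  shows "card {w \<in> injs r V. Q (map ((!) w) v)} * card (injs m V) =
    card (injs r V) * card {u \<in> injs m V. Q u}"
proof (cases "injs m V = {}")
  case True
  then have "injs r V = {}" using comp_injs[OF _ assms(2)] by blast
  then show ?thesis using True by simp
next
  case False
  then obtain u0 where u0: "u0 \<in> injs m V" by blast
  define c where "c = card {w \<in> injs r V. map ((!) w) v = u0}"
  have c: "card {w \<in> injs r V. map ((!) w) v = u} = c" if "u \<in> injs m V" for u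
    unfolding c_def
    using card_extensions_le[OF assms that u0] card_extensions_le[OF assms u0 that] by (rule le_antisym)
  have count: "card {w \<in> injs r V. R (map ((!) w) v)} = c * card {u \<in> injs m V. R u}" for R
  proof -
    have "card {w \<in> injs r V. R (map ((!) w) v)} =
      (\<Sum>u\<in>{u \<in> injs m V. R u}. card {w \<in> {w \<in> injs r V. R (map ((!) w) v)}. map ((!) w) v = u})"
    proof (rule card_fibres)
      show "(\<lambda>w. map ((!) w) v) ` {w \<in> injs r V. R (map ((!) w) v)} \<subseteq> {u \<in> injs m V. R u}"
        using comp_injs[OF _ assms(2)] by blast
    qed (use assms(1) in simp_all)
    also have "\<dots> = (\<Sum>u\<in>{u \<in> injs m V. R u}. c)"
    proof (rule sum.cong)
      fix u assume u: "u \<in> {u \<in> injs m V. R u}"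
      then have "{w \<in> {w \<in> injs r V. R (map ((!) w) v)}. map ((!) w) v = u} = {w \<in> injs r V. map ((!) w) v = u}"
        by blast
      then show "card {w \<in> {w \<in> injs r V. R (map ((!) w) v)}. map ((!) w) v = u} = c"
        using c u by simp
    qed simp
    finally show ?thesis by simp
  qed
  have "card (injs r V) = c * card (injs m V)" using count[of "\<lambda>_. True"] by simp
  then show ?thesis by (simp add: count)
qed

lemma card_injs_pos: "finite V \<Longrightarrow> r \<le> card V \<Longrightarrow> 0 < card (injs r V)"
  by (simp add: card_injs)

lemma inj_density_labs:
  "M \<in> labs T m \<Longrightarrow> inj_density M G = real (card {v \<in> injs m (verts G). pb v G = M}) / real (card (injs m (verts G)))"
  by (simp add: inj_density_def labs_verts)

lemma inj_density_nonneg: "0 \<le> inj_density M G"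
  by (simp add: inj_density_def)

text \<open>A random injection of [r] composed with v is a random injection of [m]; grouping by the
  model found on [r] gives the sum. The bound on r ensures that injections of [r] exist; without
  any, all densities on the right would be 0.\<close>

lemma inj_density_consistent:
  assumes T: "universal_theory T" and G: "G \<in> fin_models T" and r: "r \<le> card (verts G)"
    and M0: "M0 \<in> labs T m" and v: "v \<in> injs m {..<r}"
  shows "inj_density M0 G = (\<Sum>M\<in>{M \<in> labs T r. pb v M = M0}. inj_density M G)"
proof -
  have fin: "finite (verts G)" and mod: "model T G" using G by (auto simp: fin_models_def)
  have m: "m \<le> r"
    using v card_mono[of "{..<r}" "set v"] distinct_card[of v] unfolding injs_def by simp
  have pos: "0 < card (injs r (verts G))" "0 < card (injs m (verts G))"
    using card_injs_pos[OF fin] r m by auto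
  have eq: "pb (map ((!) w) v) G = pb v (pb w G)" if "w \<in> injs r (verts G)" for w
    using that v unfolding injs_def by (intro pb_pb[symmetric]) simp
  then have "{w \<in> injs r (verts G). pb (map ((!) w) v) G = M0} = {w \<in> injs r (verts G). pb v (pb w G) = M0}"
    by (intro Collect_cong conj_cong refl) simp
  then have "card {w \<in> injs r (verts G). pb v (pb w G) = M0} * card (injs m (verts G)) =
      card (injs r (verts G)) * card {u \<in> injs m (verts G). pb u G = M0}"
    using card_restriction[OF fin v, of "\<lambda>u. pb u G = M0"] by (simp only:)
  then have "real (card {w \<in> injs r (verts G). pb v (pb w G) = M0}) * real (card (injs m (verts G))) =
      real (card (injs r (verts G))) * real (card {u \<in> injs m (verts G). pb u G = M0})"
    by (simp only: of_nat_mult[symmetric])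
  then have 1: "inj_density M0 G =
      real (card {w \<in> injs r (verts G). pb v (pb w G) = M0}) / real (card (injs r (verts G)))"
    unfolding inj_density_labs[OF M0] using pos by (simp only: frac_eq_eq of_nat_eq_0_iff) (simp only: mult.commute)
  have "card {w \<in> injs r (verts G). pb v (pb w G) = M0} =
     (\<Sum>M\<in>{M \<in> labs T r. pb v M = M0}. card {w \<in> {w \<in> injs r (verts G). pb v (pb w G) = M0}. pb w G = M})"
  proof (rule card_fibres)
    show "finite {M \<in> labs T r. pb v M = M0}"
      using T finite_labs[of T r] unfolding universal_theory_def by simp
    show "(\<lambda>w. pb w G) ` {w \<in> injs r (verts G). pb v (pb w G) = M0} \<subseteq> {M \<in> labs T r. pb v M = M0}"
      using pb_in_labs[OF mod] by blast
  qed (use fin in simp)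
  also have "\<dots> = (\<Sum>M\<in>{M \<in> labs T r. pb v M = M0}. card {w \<in> injs r (verts G). pb w G = M})"
    by (intro sum.cong refl arg_cong[where f = card]) auto
  finally have "inj_density M0 G = (\<Sum>M\<in>{M \<in> labs T r. pb v M = M0}.
      real (card {w \<in> injs r (verts G). pb w G = M}) / real (card (injs r (verts G))))"
    unfolding 1 by (simp only: of_nat_sum sum_divide_distrib)
  also have "\<dots> = (\<Sum>M\<in>{M \<in> labs T r. pb v M = M0}. inj_density M G)"
  proof (intro sum.cong refl)
    fix M assume "M \<in> {M \<in> labs T r. pb v M = M0}"
    then have "M \<in> labs T r" by blast
    then show "real (card {w \<in> injs r (verts G). pb w G = M}) / real (card (injs r (verts G))) = inj_density M G"
      by (rule inj_density_labs[symmetric])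
  qed
  finally show ?thesis .
qed

lemma sum_inj_density:
  assumes T: "universal_theory T" and G: "G \<in> fin_models T" and r: "r \<le> card (verts G)"
  shows "(\<Sum>M\<in>labs T r. inj_density M G) = 1"
proof -
  have fin: "finite (verts G)" and mod: "model T G" using G by (auto simp: fin_models_def)
  have "card (injs r (verts G)) = (\<Sum>M\<in>labs T r. card {w \<in> injs r (verts G). pb w G = M})"
  proof (rule card_fibres)
    show "finite (labs T r)"
      using T finite_labs[of T r] unfolding universal_theory_def by simp
    show "(\<lambda>w. pb w G) ` injs r (verts G) \<subseteq> labs T r"
      using pb_in_labs[OF mod] by blast
  qed (use fin in simp)
  moreover have "(\<Sum>M\<in>labs T r. inj_density M G) =
      (\<Sum>M\<in>labs T r. real (card {w \<in> injs r (verts G). pb w G = M}) / real (card (injs r (verts G))))"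
    by (intro sum.cong inj_density_labs) auto
  ultimately show ?thesis
    using card_injs_pos[OF fin r] by (simp add: sum_divide_distrib[symmetric] flip: of_nat_sum)
qed

lemma ex_lab_rep:
  assumes "M \<in> fin_models T"
  shows "\<exists>M0\<in>labs T (card (verts M)). iso_class M0 = iso_class M"
proof -
  have M: "model T M" "finite (verts M)" using assms by (auto simp: fin_models_def)
  define v where "v = sorted_list_of_set (verts M)"
  have v: "distinct v" "set v = verts M" "length v = card (verts M)" using M(2) by (auto simp: v_def)
  have "induced M (set v) = M"
    using wf_struct_if_model[OF M(1)] v(2) by (intro struct_eqI) (auto simp: induced_def wf_struct_def)
  moreover have "is_iso ((!) v) (pb v M) (induced M (set v))"
    using v by (subst is_iso_nth_iff) auto
  ultimately have "iso_class (pb v M) = iso_class M" by (intro iso_class_eqI) auto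
  moreover have "pb v M \<in> labs T (card (verts M))"
    using v M(1) by (intro pb_in_labs) (auto simp: injs_def)
  ultimately show ?thesis by blast
qed

lemma labelled_iso:
  assumes "is_iso f M N" "wf_struct M" "finite (verts M)"
  shows "labelled \<phi> M = labelled \<phi> N"
  using card_Aut_iso[OF assms] iso_class_eqI[OF assms(1,2)] card_verts_iso[OF assms(1)]
  by (simp add: labelled_def)

definition conv_seq :: "'p univ_theory \<Rightarrow> ('p struct set \<Rightarrow> real) \<Rightarrow> (nat \<Rightarrow> 'p struct) \<Rightarrow> bool" where
  "conv_seq T \<phi> N \<longleftrightarrow> (\<forall>n. N n \<in> fin_models T) \<and> strict_mono (\<lambda>n. card (verts (N n))) \<and>
    (\<forall>m. \<forall>M\<in>labs T m. (\<lambda>n. inj_density M (N n)) \<longlonglongrightarrow> labelled \<phi> M)"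

text \<open>The two densities of a labelled model differ by the nonzero factor
  \<open>card (Aut M)\<close> / m!, and every finite model has a labelled representative. The range
  [0, 1] is recovered from the densities, whose limits lie in it.\<close>

lemma Hom_plus_iff:
  "\<phi> \<in> Hom_plus T \<longleftrightarrow> \<phi> \<in> extensional (model_classes T) \<and> (\<exists>N. conv_seq T \<phi> N)"
proof -
  have eq: "(\<lambda>n. inj_density M (N n)) \<longlonglongrightarrow> labelled \<phi> M \<longleftrightarrow>
      (\<lambda>n. induced_density M (N n)) \<longlonglongrightarrow> \<phi> (iso_class M)"
    if "M \<in> labs T m" "\<forall>n. N n \<in> fin_models T" for m M N
  proof -
    define c where "c = real (card (Aut M)) / fact m"
    have "c \<noteq> 0" using card_Aut_pos[of M] that(1) by (simp add: c_def labs_verts)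
    moreover have "inj_density M (N n) = c * induced_density M (N n)" for n
      unfolding c_def using that by (intro inj_density_eq) (auto simp: labs_wf labs_verts fin_models_def)
    moreover have "labelled \<phi> M = c * \<phi> (iso_class M)"
      using that(1) by (simp add: labelled_def c_def labs_verts)
    ultimately show ?thesis by (simp add: tendsto_mult_left_iff)
  qed
  have dens: "induced_density M G = induced_density M0 G"
    if "iso_class M0 = iso_class M" "card (verts M0) = card (verts M)" for M M0 G :: "'a struct"
    using that by (simp add: induced_density_def)
  show ?thesis
  proof
    assume \<phi>: "\<phi> \<in> Hom_plus T"
    then obtain N where N: "\<forall>n. N n \<in> fin_models T" "strict_mono (\<lambda>n. card (verts (N n)))"
      "\<forall>M\<in>fin_models T. (\<lambda>n. induced_density M (N n)) \<longlonglongrightarrow> \<phi> (iso_class M)"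
      unfolding Hom_plus_def by blast
    have "conv_seq T \<phi> N"
      unfolding conv_seq_def
    proof (intro conjI N(1,2) allI ballI)
      fix m M assume M: "M \<in> labs T m"
      show "(\<lambda>n. inj_density M (N n)) \<longlonglongrightarrow> labelled \<phi> M"
        unfolding eq[OF M N(1)] using N(3) labs_fin_models[OF M] by (rule bspec)
    qed
    moreover have "\<phi> \<in> extensional (model_classes T)" using \<phi> by (auto simp: Hom_plus_def PiE_def)
    ultimately show "\<phi> \<in> extensional (model_classes T) \<and> (\<exists>N. conv_seq T \<phi> N)" by blast
  next
    assume "\<phi> \<in> extensional (model_classes T) \<and> (\<exists>N. conv_seq T \<phi> N)"
    then obtain N where ext: "\<phi> \<in> extensional (model_classes T)" and N: "conv_seq T \<phi> N" by blast
    have lim: "(\<lambda>n. induced_density M (N n)) \<longlonglongrightarrow> \<phi> (iso_class M)" if M: "M \<in> fin_models T" for M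
    proof -
      obtain M0 where M0: "M0 \<in> labs T (card (verts M))" "iso_class M0 = iso_class M"
        using ex_lab_rep[OF M] by blast
      have "\<forall>n. N n \<in> fin_models T" "(\<lambda>n. inj_density M0 (N n)) \<longlonglongrightarrow> labelled \<phi> M0"
        using N M0(1) unfolding conv_seq_def by (blast, blast)
      then have "(\<lambda>n. induced_density M0 (N n)) \<longlonglongrightarrow> \<phi> (iso_class M0)"
        using eq[OF M0(1)] by simp
      moreover have "induced_density M0 (N n) = induced_density M (N n)" for n
        using M0 by (intro dens) (auto simp: labs_verts)
      ultimately show ?thesis using M0(2) by simp
    qed
    have "\<phi> c \<in> {0..1}" if c: "c \<in> model_classes T" for c
    proof -
      obtain M where M: "M \<in> fin_models T" "c = iso_class M"
        using c unfolding model_classes_def by blast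
      have "induced_density M (N n) \<in> {0..1}" for n
      proof -
        have fin: "finite (verts (N n))" using N by (simp add: conv_seq_def fin_models_def)
        have "card {S. S \<subseteq> verts (N n) \<and> card S = card (verts M) \<and> induced (N n) S \<in> iso_class M}
          \<le> card {S. S \<subseteq> verts (N n) \<and> card S = card (verts M)}"
          using fin by (intro card_mono) auto
        then show ?thesis using n_subsets[OF fin] by (auto simp: induced_density_def divide_le_eq_1)
      qed
      then have "\<phi> (iso_class M) \<in> {0..1}"
        by (intro closed_sequentially[OF closed_atLeastAtMost _ lim[OF M(1)]])
      then show ?thesis by (simp only: M(2))
    qed
    then have "\<phi> \<in> model_classes T \<rightarrow>\<^sub>E {0..1}" using ext by (simp only: PiE_def Pi_def) blast
    moreover have "\<forall>n. N n \<in> fin_models T" "strict_mono (\<lambda>n. card (verts (N n)))"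
      using N unfolding conv_seq_def by (blast, blast)
    ultimately show "\<phi> \<in> Hom_plus T"
      unfolding Hom_plus_def using lim by blast
  qed
qed

lemma conv_seq_card:
  assumes "conv_seq T \<phi> N"
  shows "n \<le> card (verts (N n))"
  using assms strict_mono_imp_increasing[of "\<lambda>n. card (verts (N n))" n] by (simp add: conv_seq_def)

lemma labelled_nonneg:
  assumes "\<phi> \<in> Hom_plus T" "M \<in> labs T m"
  shows "0 \<le> labelled \<phi> M"
proof -
  obtain N where "conv_seq T \<phi> N" using assms(1) by (auto simp: Hom_plus_iff)
  then have "(\<lambda>n. inj_density M (N n)) \<longlonglongrightarrow> labelled \<phi> M" using assms(2) unfolding conv_seq_def by blast
  then show ?thesis by (rule LIMSEQ_le_const) (use inj_density_nonneg in blast)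
qed

lemma sum_labelled:
  assumes T: "universal_theory T" and "\<phi> \<in> Hom_plus T"
  shows "(\<Sum>M\<in>labs T m. labelled \<phi> M) = 1"
proof -
  obtain N where N: "conv_seq T \<phi> N" using assms(2) by (auto simp: Hom_plus_iff)
  have "(\<lambda>n. \<Sum>M\<in>labs T m. inj_density M (N n)) \<longlonglongrightarrow> (\<Sum>M\<in>labs T m. labelled \<phi> M)"
    using N by (intro tendsto_sum) (auto simp: conv_seq_def)
  moreover have "\<forall>\<^sub>F n in sequentially. (\<Sum>M\<in>labs T m. inj_density M (N n)) = 1"
    using eventually_ge_at_top[of m]
  proof eventually_elim
    case (elim n)
    then show ?case
      using N conv_seq_card[OF N, of n] by (intro sum_inj_density[OF T]) (auto simp: conv_seq_def)
  qed
  ultimately show ?thesis by (intro LIMSEQ_unique[OF _ tendsto_eventually])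
qed

text \<open>The limit of \<open>inj_density_consistent\<close>, which applies as soon as the graph
  of the sequence has r vertices; the sizes grow strictly, so this holds eventually.\<close>

lemma labelled_consistent:
  assumes T: "universal_theory T" and "\<phi> \<in> Hom_plus T" and M0: "M0 \<in> labs T m" and v: "v \<in> injs m {..<r}"
  shows "labelled \<phi> M0 = (\<Sum>M\<in>{M \<in> labs T r. pb v M = M0}. labelled \<phi> M)"
proof -
  obtain N where N: "conv_seq T \<phi> N" using assms(2) by (auto simp: Hom_plus_iff)
  have 1: "(\<lambda>n. \<Sum>M\<in>{M \<in> labs T r. pb v M = M0}. inj_density M (N n)) \<longlonglongrightarrow>
      (\<Sum>M\<in>{M \<in> labs T r. pb v M = M0}. labelled \<phi> M)"
    using N by (intro tendsto_sum) (auto simp: conv_seq_def)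
  have 2: "(\<lambda>n. inj_density M0 (N n)) \<longlonglongrightarrow> labelled \<phi> M0"
    using N M0 unfolding conv_seq_def by blast
  have 3: "\<forall>\<^sub>F n in sequentially.
      inj_density M0 (N n) = (\<Sum>M\<in>{M \<in> labs T r. pb v M = M0}. inj_density M (N n))"
    using eventually_ge_at_top[of r]
  proof eventually_elim
    case (elim n)
    then show ?case
      using N conv_seq_card[OF N, of n] M0 v by (intro inj_density_consistent[OF T]) (auto simp: conv_seq_def)
  qed
  show ?thesis by (rule LIMSEQ_unique[OF Lim_transform_eventually[OF 2 3] 1])
qed

text \<open>Labelled values determine a limit object, because \<open>Aut\<close> always contains the
  identity and the factor relating the two values can be cancelled.\<close>

lemma limit_eqI:
  assumes "\<phi> \<in> extensional (model_classes T)" "\<phi>' \<in> extensional (model_classes T)"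
    and eq: "\<And>m M. M \<in> labs T m \<Longrightarrow> labelled \<phi> M = labelled \<phi>' M"
  shows "\<phi> = \<phi>'"
proof (rule extensionalityI[OF assms(1,2)])
  fix c assume "c \<in> model_classes T"
  then obtain M where M: "M \<in> fin_models T" "c = iso_class M" by (auto simp: model_classes_def)
  obtain M0 where M0: "M0 \<in> labs T (card (verts M))" "iso_class M0 = iso_class M"
    using ex_lab_rep[OF M(1)] by blast
  have "0 < card (Aut M0)" using M0(1) by (intro card_Aut_pos) (simp add: labs_verts)
  then show "\<phi> c = \<phi>' c" using eq[OF M0(1)] M0(2) M(2) by (simp add: labelled_def)
qed

section \<open>Reducts and couplings\<close>

text \<open>A reduct along a renaming of symbols, so that facts needed for both \<open>Inl\<close>
  and \<open>Inr\<close> are proved once.\<close>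

definition red :: "('p \<Rightarrow> 'r) \<Rightarrow> 'r struct \<Rightarrow> 'p struct" where
  "red \<iota> M = \<lparr>verts = verts M, rels = rels M \<circ> \<iota>\<rparr>"

lemma reduct_left_eq: "reduct_left = red Inl" and reduct_right_eq: "reduct_right = red Inr"
  by (simp_all add: fun_eq_iff reduct_left_def reduct_right_def red_def)

lemma verts_red [simp]: "verts (red \<iota> M) = verts M"
  by (simp add: red_def)

lemma rels_red [simp]: "rels (red \<iota> M) P = rels M (\<iota> P)"
  by (simp add: red_def)

lemma pb_red: "pb v (red \<iota> M) = red \<iota> (pb v M)"
  by (rule struct_eqI) (simp_all add: pb_def)

lemma induced_red: "induced (red \<iota> M) S = red \<iota> (induced M S)"
  by (rule struct_eqI) (simp_all add: induced_def)

lemma wf_struct_red: "wf_struct M \<Longrightarrow> wf_struct (red \<iota> M)"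
  by (simp add: wf_struct_def)

lemma is_iso_red: "is_iso f M N \<Longrightarrow> is_iso f (red \<iota> M) (red \<iota> N)"
  unfolding is_iso_def verts_red rels_red by blast

lemma red_iso_class:
  assumes "inj \<iota>"
  shows "red \<iota> ` iso_class M = iso_class (red \<iota> M)"
proof (intro equalityI subsetI)
  fix N assume "N \<in> red \<iota> ` iso_class M"
  then obtain N0 f where "N = red \<iota> N0" "is_iso f M N0" unfolding iso_class_def by blast
  then show "N \<in> iso_class (red \<iota> M)" unfolding iso_class_def using is_iso_red by blast
next
  fix N assume "N \<in> iso_class (red \<iota> M)"
  then obtain f where f: "bij_betw f (verts M) (verts N)" "\<And>P. rels N P = map f ` rels M (\<iota> P)"
    unfolding iso_class_def is_iso_def verts_red rels_red by blast
  define N' where "N' = \<lparr>verts = verts N, rels = (\<lambda>r. map f ` rels M r)\<rparr>"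
  have "is_iso f M N'" using f(1) by (simp add: is_iso_def N'_def)
  moreover have "N = red \<iota> N'" using f(2) by (intro struct_eqI) (simp_all add: N'_def)
  ultimately show "N \<in> red \<iota> ` iso_class M" unfolding iso_class_def by blast
qed

lemma tendsto_induced_density:
  assumes "conv_seq T \<phi> N" "M \<in> labs T m"
  shows "(\<lambda>n. induced_density M (N n)) \<longlonglongrightarrow> \<phi> (iso_class M)"
proof -
  define c where "c = real (card (Aut M)) / fact m"
  have "c \<noteq> 0" using card_Aut_pos[of M] assms(2) by (simp add: c_def labs_verts)
  have "inj_density M (N n) = c * induced_density M (N n)" for n
  proof -
    have "N n \<in> fin_models T" using assms(1) unfolding conv_seq_def by blast
    then have "finite (verts (N n))" by (simp add: fin_models_def)
    then show ?thesis unfolding c_def by (rule inj_density_eq[OF labs_wf[OF assms(2)] labs_verts[OF assms(2)]])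
  qed
  moreover have "labelled \<phi> M = c * \<phi> (iso_class M)"
    using assms(2) by (simp add: labelled_def c_def labs_verts)
  moreover have "(\<lambda>n. inj_density M (N n)) \<longlonglongrightarrow> labelled \<phi> M"
    using assms unfolding conv_seq_def by blast
  ultimately show ?thesis using \<open>c \<noteq> 0\<close> by (simp add: tendsto_mult_left_iff)
qed

definition limit_red :: "('p \<Rightarrow> 'r) \<Rightarrow> 'p univ_theory \<Rightarrow> 'r univ_theory \<Rightarrow> ('r struct set \<Rightarrow> real) \<Rightarrow> 'p struct set \<Rightarrow> real" where
  "limit_red \<iota> T U \<xi> = (\<lambda>c\<in>model_classes T. \<Sum>d\<in>{d \<in> model_classes U. red \<iota> ` d = c}. \<xi> d)"

text \<open>The density of A in the reducts of a convergent sequence is computed twice: over vertex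
  sets, grouped by isomorphism classes as in the definition of the reduct, and over injections,
  grouped by labelled expansions of A. Both computations pass to the limit.\<close>

lemma labelled_limit_red:
  assumes inj: "inj \<iota>" and U: "universal_theory U"
    and mod: "\<And>M. model U M \<Longrightarrow> model T (red \<iota> M)"
    and \<xi>: "\<xi> \<in> Hom_plus U" and A: "A \<in> labs T m"
  shows "labelled (limit_red \<iota> T U \<xi>) A = (\<Sum>M\<in>{M \<in> labs U m. red \<iota> M = A}. labelled \<xi> M)"
proof -
  obtain N where N: "conv_seq U \<xi> N" using \<xi> unfolding Hom_plus_iff by blast
  then have Nf: "N n \<in> fin_models U" for n unfolding conv_seq_def by blast
  have fin: "finite (verts (N n))" and modN: "model U (N n)" for n using Nf[of n] by (simp_all add: fin_models_def)
  have finU: "finite (labs U m)" using U finite_labs unfolding universal_theory_def by blast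
  \<comment> \<open>Its finiteness is essential, since a sum over an infinite set is 0. Each member
    has a labelled representative on m vertices, and there are finitely many of these.\<close>
  define D where "D = {d \<in> model_classes U. red \<iota> ` d = iso_class A}"
  have rep: "\<exists>M\<in>labs U m. d = iso_class M" if "d \<in> D" for d
  proof -
    obtain M where M: "M \<in> fin_models U" "d = iso_class M"
      using \<open>d \<in> D\<close> unfolding D_def model_classes_def by blast
    then have "red \<iota> M \<in> iso_class A"
      using \<open>d \<in> D\<close> unfolding D_def by auto
    then have "card (verts A) = card (verts (red \<iota> M))"
      unfolding mem_iso_class using card_verts_iso by blast
    then have "card (verts M) = m" using labs_verts[OF A] by simp
    then obtain M0 where "M0 \<in> labs U m" "iso_class M0 = iso_class M" using ex_lab_rep[OF M(1)] by blast
    then show ?thesis using M(2) by blast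
  qed
  then have "D \<subseteq> iso_class ` labs U m" by blast
  then have finD: "finite D" using finU finite_subset by blast
  have dens: "induced_density A (red \<iota> (N n)) = (\<Sum>d\<in>D.
      real (card {S. S \<subseteq> verts (N n) \<and> card S = m \<and> induced (N n) S \<in> d}) / real (card (verts (N n)) choose m))" for n
  proof -
    let ?S = "{S. S \<subseteq> verts (N n) \<and> card S = m \<and> red \<iota> (induced (N n) S) \<in> iso_class A}"
    have mem: "iso_class (induced (N n) S) \<in> D" if "S \<in> ?S" for S
    proof -
      have S: "S \<subseteq> verts (N n)" "red \<iota> (induced (N n) S) \<in> iso_class A" using that by auto
      define v where "v = sorted_list_of_set S"
      have finS: "finite S" using S(1) fin[of n] by (rule finite_subset)
      have v: "distinct v" "set v = S" using finS by (auto simp: v_def)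
      have "is_iso ((!) v) (pb v (N n)) (induced (N n) S)"
        using is_iso_nth_iff[of v "pb v (N n)" "N n"] v S(1) by simp
      then have "iso_class (pb v (N n)) = iso_class (induced (N n) S)" by (rule iso_class_eqI) simp
      moreover have "pb v (N n) \<in> fin_models U"
        using model_pb[OF modN v(1)] v(2) S(1) by (simp add: fin_models_def)
      ultimately have "iso_class (induced (N n) S) \<in> model_classes U"
        unfolding model_classes_def by (metis imageI)
      moreover have "iso_class A = iso_class (red \<iota> (induced (N n) S))"
        using S(2) iso_class_eq_iff[OF labs_wf[OF A]] by blast
      ultimately show ?thesis by (simp add: D_def red_iso_class[OF inj])
    qed
    have eq: "{S \<in> ?S. iso_class (induced (N n) S) = d} =
        {S. S \<subseteq> verts (N n) \<and> card S = m \<and> induced (N n) S \<in> d}" if d: "d \<in> D" for d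
    proof -
      obtain M where M: "M \<in> labs U m" "d = iso_class M" using rep[OF d] by blast
      have iff: "iso_class (induced (N n) S) = d \<longleftrightarrow> induced (N n) S \<in> d" for S
        using iso_class_eq_iff[OF labs_wf[OF M(1)], of "induced (N n) S"] M(2) by auto
      have "red \<iota> (induced (N n) S) \<in> iso_class A" if "induced (N n) S \<in> d" for S
        using that d unfolding D_def by blast
      then show ?thesis unfolding iff by blast
    qed
    have "card ?S = (\<Sum>d\<in>D. card {S \<in> ?S. iso_class (induced (N n) S) = d})"
    proof (rule card_fibres)
      show "finite ?S" using fin[of n] by simp
      show "(\<lambda>S. iso_class (induced (N n) S)) ` ?S \<subseteq> D" using mem by (rule image_subsetI)
    qed (rule finD)
    also have "\<dots> = (\<Sum>d\<in>D. card {S. S \<subseteq> verts (N n) \<and> card S = m \<and> induced (N n) S \<in> d})"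
      by (intro sum.cong refl arg_cong[where f = card] eq)
    finally show ?thesis
      unfolding induced_density_def induced_red verts_red labs_verts[OF A] card_lessThan
      by (simp only: of_nat_sum sum_divide_distrib)
  qed
  have lim1: "(\<lambda>n. induced_density A (red \<iota> (N n))) \<longlonglongrightarrow> (\<Sum>d\<in>D. \<xi> d)"
    unfolding dens
  proof (rule tendsto_sum)
    fix d assume "d \<in> D"
    then obtain M where M: "M \<in> labs U m" "d = iso_class M" using rep by blast
    show "(\<lambda>n. real (card {S. S \<subseteq> verts (N n) \<and> card S = m \<and> induced (N n) S \<in> d}) / real (card (verts (N n)) choose m)) \<longlonglongrightarrow> \<xi> d"
      using tendsto_induced_density[OF N M(1)] labs_verts[OF M(1)] M(2)
      unfolding induced_density_def by simp
  qed
  have inj_dens: "inj_density A (red \<iota> (N n)) = (\<Sum>M\<in>{M \<in> labs U m. red \<iota> M = A}. inj_density M (N n))" for n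
  proof -
    have "card {v \<in> injs m (verts (N n)). red \<iota> (pb v (N n)) = A} =
      (\<Sum>M\<in>{M \<in> labs U m. red \<iota> M = A}. card {v \<in> {v \<in> injs m (verts (N n)). red \<iota> (pb v (N n)) = A}. pb v (N n) = M})"
    proof (rule card_fibres)
      show "(\<lambda>v. pb v (N n)) ` {v \<in> injs m (verts (N n)). red \<iota> (pb v (N n)) = A} \<subseteq> {M \<in> labs U m. red \<iota> M = A}"
        using pb_in_labs[OF modN[of n]] by blast
    qed (use fin[of n] finU in simp_all)
    also have "\<dots> = (\<Sum>M\<in>{M \<in> labs U m. red \<iota> M = A}. card {v \<in> injs m (verts (N n)). pb v (N n) = M})"
    proof (intro sum.cong refl arg_cong[where f = card])
      fix M assume "M \<in> {M \<in> labs U m. red \<iota> M = A}"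
      then show "{v \<in> {v \<in> injs m (verts (N n)). red \<iota> (pb v (N n)) = A}. pb v (N n) = M} =
        {v \<in> injs m (verts (N n)). pb v (N n) = M}" by blast
    qed
    finally have "inj_density A (red \<iota> (N n)) = (\<Sum>M\<in>{M \<in> labs U m. red \<iota> M = A}.
        real (card {v \<in> injs m (verts (N n)). pb v (N n) = M}) / real (card (injs m (verts (N n)))))"
      unfolding inj_density_labs[OF A] pb_red verts_red by (simp only: of_nat_sum sum_divide_distrib)
    also have "\<dots> = (\<Sum>M\<in>{M \<in> labs U m. red \<iota> M = A}. inj_density M (N n))"
    proof (intro sum.cong refl)
      fix M assume "M \<in> {M \<in> labs U m. red \<iota> M = A}"
      then have "M \<in> labs U m" by blast
      then show "real (card {v \<in> injs m (verts (N n)). pb v (N n) = M}) / real (card (injs m (verts (N n)))) =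
        inj_density M (N n)" by (rule inj_density_labs[symmetric])
    qed
    finally show ?thesis .
  qed
  have lim2: "(\<lambda>n. inj_density A (red \<iota> (N n))) \<longlonglongrightarrow> (\<Sum>M\<in>{M \<in> labs U m. red \<iota> M = A}. labelled \<xi> M)"
    unfolding inj_dens
  proof (rule tendsto_sum)
    fix M assume "M \<in> {M \<in> labs U m. red \<iota> M = A}"
    then show "(\<lambda>n. inj_density M (N n)) \<longlonglongrightarrow> labelled \<xi> M" using N unfolding conv_seq_def by blast
  qed
  have "inj_density A (red \<iota> (N n)) = real (card (Aut A)) / fact m * induced_density A (red \<iota> (N n))" for n
    using fin[of n] by (intro inj_density_eq labs_wf[OF A] labs_verts[OF A]) simp
  then have "(\<lambda>n. inj_density A (red \<iota> (N n))) \<longlonglongrightarrow> real (card (Aut A)) / fact m * (\<Sum>d\<in>D. \<xi> d)"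
    using tendsto_mult[OF tendsto_const lim1, of "real (card (Aut A)) / fact m"] by (simp only:)
  moreover have "iso_class A \<in> model_classes T"
    using labs_fin_models[OF A] unfolding model_classes_def by blast
  then have "limit_red \<iota> T U \<xi> (iso_class A) = (\<Sum>d\<in>D. \<xi> d)"
    unfolding limit_red_def D_def by simp
  ultimately have "(\<lambda>n. inj_density A (red \<iota> (N n))) \<longlonglongrightarrow> labelled (limit_red \<iota> T U \<xi>) A"
    by (simp add: labelled_def labs_verts[OF A])
  then show ?thesis using lim2 by (rule LIMSEQ_unique)
qed

section \<open>Models of a disjoint union of theories\<close>

lemma sat_map_fm: "sat M v (map_fm \<iota> a) \<longleftrightarrow> sat (red \<iota> M) v a"
  by (induction a) simp_all

lemma fm_over_map_fm:
  "fm_over T a \<Longrightarrow> fm_over (union_theory T T') (map_fm Inl a)"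
  "fm_over T' b \<Longrightarrow> fm_over (union_theory T T') (map_fm Inr b)"
proof -
  show "fm_over T a \<Longrightarrow> fm_over (union_theory T T') (map_fm Inl a)"
    by (induction a) (auto simp: union_theory_def)
  show "fm_over T' b \<Longrightarrow> fm_over (union_theory T T') (map_fm Inr b)"
    by (induction b) (auto simp: union_theory_def)
qed

lemma universal_union:
  assumes "universal_theory T" "universal_theory T'"
  shows "universal_theory (union_theory T T')"
proof -
  have "fm_over (union_theory T T') a" if "a \<in> axioms (union_theory T T')" for a
  proof -
    have "a \<in> map_fm Inl ` axioms T \<union> map_fm Inr ` axioms T'"
      using that by (simp add: union_theory_def)
    then show ?thesis
      using assms fm_over_map_fm[of T _ T'] fm_over_map_fm(2)[of T' _ T]
      unfolding universal_theory_def by blast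
  qed
  then show ?thesis
    using assms unfolding universal_theory_def by (auto simp: union_theory_def)
qed

lemma is_struct_union:
  "is_struct (union_theory T T') M \<longleftrightarrow> is_struct T (red Inl M) \<and> is_struct T' (red Inr M)"
proof -
  have l: "is_struct (union_theory T T') M \<longleftrightarrow>
    (\<forall>P\<in>preds T <+> preds T'. rels M P \<subseteq> {xs. set xs \<subseteq> verts M \<and> length xs = case_sum (arity T) (arity T') P}) \<and>
    (\<forall>P. P \<notin> preds T <+> preds T' \<longrightarrow> rels M P = {})"
    by (simp add: is_struct_def union_theory_def)
  have mem: "Inl p \<in> preds T <+> preds T' \<longleftrightarrow> p \<in> preds T" "Inr q \<in> preds T <+> preds T' \<longleftrightarrow> q \<in> preds T'" for p q
    by (auto simp: Plus_def)
  have all: "(\<forall>P. P \<notin> preds T <+> preds T' \<longrightarrow> rels M P = {}) \<longleftrightarrow>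
      (\<forall>P. P \<notin> preds T \<longrightarrow> rels M (Inl P) = {}) \<and> (\<forall>P. P \<notin> preds T' \<longrightarrow> rels M (Inr P) = {})"
  proof (rule iffI)
    assume h: "\<forall>P. P \<notin> preds T <+> preds T' \<longrightarrow> rels M P = {}"
    show "(\<forall>P. P \<notin> preds T \<longrightarrow> rels M (Inl P) = {}) \<and> (\<forall>P. P \<notin> preds T' \<longrightarrow> rels M (Inr P) = {})"
      using h[rule_format, of "Inl _"] h[rule_format, of "Inr _"] by (simp add: mem)
  next
    assume h: "(\<forall>P. P \<notin> preds T \<longrightarrow> rels M (Inl P) = {}) \<and> (\<forall>P. P \<notin> preds T' \<longrightarrow> rels M (Inr P) = {})"
    have "rels M P = {}" if P: "P \<notin> preds T <+> preds T'" for P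
      using h P by (cases P) (simp_all add: mem)
    then show "\<forall>P. P \<notin> preds T <+> preds T' \<longrightarrow> rels M P = {}" by blast
  qed
  have ball: "(\<forall>P\<in>preds T <+> preds T'. Q P) \<longleftrightarrow> (\<forall>P\<in>preds T. Q (Inl P)) \<and> (\<forall>P\<in>preds T'. Q (Inr P))" for Q
    by (auto simp: Plus_def)
  show ?thesis
    unfolding l all ball unfolding is_struct_def verts_red rels_red by (simp add: conj_ac)
qed

lemma model_union:
  "model (union_theory T T') M \<longleftrightarrow> model T (red Inl M) \<and> model T' (red Inr M)"
proof -
  have ax: "axioms (union_theory T T') = map_fm Inl ` axioms T \<union> map_fm Inr ` axioms T'"
    by (simp add: union_theory_def)
  show ?thesis
    unfolding model_def is_struct_union ax by (simp add: ball_Un sat_map_fm conj_ac)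
qed

text \<open>A structure for the union is the pair of its reducts. The vertex set is taken from A, so
  B is recovered only if it has the same one.\<close>

definition join :: "'p struct \<Rightarrow> 'q struct \<Rightarrow> ('p + 'q) struct" where
  "join A B = \<lparr>verts = verts A, rels = case_sum (rels A) (rels B)\<rparr>"

lemma verts_join [simp]: "verts (join A B) = verts A"
  by (simp add: join_def)

lemma red_join [simp]: "red Inl (join A B) = A" "verts A = verts B \<Longrightarrow> red Inr (join A B) = B"
  by (rule struct_eqI; simp add: join_def)+

lemma join_red [simp]: "join (red Inl M) (red Inr M) = M"
proof (rule struct_eqI)
  fix P xs
  show "xs \<in> rels (join (red Inl M) (red Inr M)) P \<longleftrightarrow> xs \<in> rels M P"
    by (cases P) (simp_all add: join_def)
qed simp

lemma pb_join:
  assumes "verts A = verts B"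
  shows "pb v (join A B) = join (pb v A) (pb v B)"
proof -
  have "join (red Inl (pb v (join A B))) (red Inr (pb v (join A B))) = join (pb v A) (pb v B)"
    using assms by (simp only: pb_red[symmetric] red_join)
  then show ?thesis by simp
qed

lemma join_in_labs:
  "A \<in> labs T m \<Longrightarrow> B \<in> labs T' m \<Longrightarrow> join A B \<in> labs (union_theory T T') m"
  by (simp add: labs_def model_union)

lemma red_in_labs:
  "M \<in> labs (union_theory T T') m \<Longrightarrow> red Inl M \<in> labs T m"
  "M \<in> labs (union_theory T T') m \<Longrightarrow> red Inr M \<in> labs T' m"
  by (simp_all add: labs_def model_union)

lemma join_eq_iff:
  assumes "verts A = verts B" "verts C = verts D"
  shows "join A B = join C D \<longleftrightarrow> A = C \<and> B = D"
proof
  assume eq: "join A B = join C D"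
  have "A = C" using arg_cong[OF eq, of "red Inl"] by simp
  moreover have "B = D" using arg_cong[OF eq, of "red Inr"] assms by simp
  ultimately show "A = C \<and> B = D" by blast
qed simp

lemma labelled_limit_reduct_left:
  assumes "universal_theory T" "universal_theory T'" "\<xi> \<in> Hom_plus (union_theory T T')" "A \<in> labs T m"
  shows "labelled (limit_reduct_left T T' \<xi>) A = (\<Sum>B\<in>labs T' m. labelled \<xi> (join A B))"
proof -
  have "limit_reduct_left T T' \<xi> = limit_red Inl T (union_theory T T') \<xi>"
    by (simp add: limit_reduct_left_def limit_red_def reduct_left_eq)
  moreover have "labelled (limit_red Inl T (union_theory T T') \<xi>) A =
      (\<Sum>M\<in>{M \<in> labs (union_theory T T') m. red Inl M = A}. labelled \<xi> M)"
    by (rule labelled_limit_red[OF inj_Inl universal_union[OF assms(1,2)] _ assms(3,4)]) (simp add: model_union)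
  ultimately have "labelled (limit_reduct_left T T' \<xi>) A =
      (\<Sum>M\<in>{M \<in> labs (union_theory T T') m. red Inl M = A}. labelled \<xi> M)"
    by (simp only:)
  also have "\<dots> = (\<Sum>B\<in>labs T' m. labelled \<xi> (join A B))"
  proof (rule sum.reindex_bij_witness[where i = "\<lambda>B. join A B" and j = "red Inr"])
    fix M assume M: "M \<in> {M \<in> labs (union_theory T T') m. red Inl M = A}"
    then show "join A (red Inr M) = M" using join_red[of M] by blast
    then show "labelled \<xi> (join A (red Inr M)) = labelled \<xi> M" by simp
    show "red Inr M \<in> labs T' m" using M red_in_labs(2) by blast
  next
    fix B assume B: "B \<in> labs T' m"
    then show "red Inr (join A B) = B" using assms(4) by (simp add: labs_verts)
    show "join A B \<in> {M \<in> labs (union_theory T T') m. red Inl M = A}"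
      using join_in_labs[OF assms(4) B] by simp
  qed
  finally show ?thesis .
qed

lemma labelled_limit_reduct_right:
  assumes "universal_theory T" "universal_theory T'" "\<xi> \<in> Hom_plus (union_theory T T')" "B \<in> labs T' m"
  shows "labelled (limit_reduct_right T T' \<xi>) B = (\<Sum>A\<in>labs T m. labelled \<xi> (join A B))"
proof -
  have "limit_reduct_right T T' \<xi> = limit_red Inr T' (union_theory T T') \<xi>"
    by (simp add: limit_reduct_right_def limit_red_def reduct_right_eq)
  moreover have "labelled (limit_red Inr T' (union_theory T T') \<xi>) B =
      (\<Sum>M\<in>{M \<in> labs (union_theory T T') m. red Inr M = B}. labelled \<xi> M)"
    by (rule labelled_limit_red[OF inj_Inr universal_union[OF assms(1,2)] _ assms(3,4)]) (simp add: model_union)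
  ultimately have "labelled (limit_reduct_right T T' \<xi>) B =
      (\<Sum>M\<in>{M \<in> labs (union_theory T T') m. red Inr M = B}. labelled \<xi> M)"
    by (simp only:)
  also have "\<dots> = (\<Sum>A\<in>labs T m. labelled \<xi> (join A B))"
  proof (rule sum.reindex_bij_witness[where i = "\<lambda>A. join A B" and j = "red Inl"])
    fix M assume M: "M \<in> {M \<in> labs (union_theory T T') m. red Inr M = B}"
    then show "join (red Inl M) B = M" using join_red[of M] by blast
    then show "labelled \<xi> (join (red Inl M) B) = labelled \<xi> M" by simp
    show "red Inl M \<in> labs T m" using M red_in_labs(1) by blast
  next
    fix A assume A: "A \<in> labs T m"
    show "red Inl (join A B) = A" by simp
    show "join A B \<in> {M \<in> labs (union_theory T T') m. red Inr M = B}"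
      using join_in_labs[OF A assms(4)] A assms(4) by (simp add: labs_verts)
  qed
  finally show ?thesis .
qed

text \<open>The representative chosen by \<open>SOME\<close> is isomorphic to M, an isomorphism is
  also one between the reducts, and all quantities involved are isomorphism invariant.\<close>

lemma labelled_independent_coupling:
  assumes "M \<in> labs (union_theory T T') m"
  shows "labelled (independent_coupling T T' \<phi> \<psi>) M = labelled \<phi> (red Inl M) * labelled \<psi> (red Inr M)"
proof -
  define M' where "M' = (SOME M'. M' \<in> iso_class M)"
  have "M' \<in> iso_class M" unfolding M'_def by (rule someI[of _ M]) simp
  then obtain f where f: "is_iso f M M'" unfolding mem_iso_class by blast
  have wf: "wf_struct M" and fin: "finite (verts M)"
    using labs_wf[OF assms] labs_verts[OF assms] by simp_all
  have "iso_class M \<in> model_classes (union_theory T T')"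
    using labs_fin_models[OF assms] unfolding model_classes_def by blast
  then have "independent_coupling T T' \<phi> \<psi> (iso_class M) = fact (card (verts M')) / real (card (Aut M')) *
      (labelled \<phi> (red Inl M') * labelled \<psi> (red Inr M'))"
    unfolding independent_coupling_def by (simp add: M'_def Let_def reduct_left_eq reduct_right_eq)
  also have "\<dots> = fact (card (verts M)) / real (card (Aut M)) * (labelled \<phi> (red Inl M) * labelled \<psi> (red Inr M))"
    using labelled_iso[OF is_iso_red[OF f, of Inl] wf_struct_red[OF wf], of \<phi>]
      labelled_iso[OF is_iso_red[OF f, of Inr] wf_struct_red[OF wf], of \<psi>] fin
    by (simp only: card_Aut_iso[OF f wf fin] card_verts_iso[OF f] verts_red)
  finally show ?thesis using card_Aut_pos[OF fin] by (simp add: labelled_def)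
qed

text \<open>The reducts of the independent coupling are right because the labelled values of each
  factor sum to 1. What has to be supplied is that it is a limit object and that every coupling has
  product values.\<close>

lemma uniquely_coupleableI:
  assumes T: "universal_theory T" and T': "universal_theory T'"
    and \<phi>: "\<phi> \<in> Hom_plus T" and \<psi>: "\<psi> \<in> Hom_plus T'"
    and ind: "independent_coupling T T' \<phi> \<psi> \<in> Hom_plus (union_theory T T')"
    and uniq: "\<And>\<xi> m A B. \<xi> \<in> couplings T T' \<phi> \<psi> \<Longrightarrow> A \<in> labs T m \<Longrightarrow> B \<in> labs T' m \<Longrightarrow>
      labelled \<xi> (join A B) = labelled \<phi> A * labelled \<psi> B"
  shows "uniquely_coupleable T T' \<phi> \<psi>"
proof -
  let ?I = "independent_coupling T T' \<phi> \<psi>"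
  have I: "labelled ?I (join A B) = labelled \<phi> A * labelled \<psi> B" if "A \<in> labs T m" "B \<in> labs T' m" for A B m
    using labelled_independent_coupling[OF join_in_labs[OF that]] that by (simp add: labs_verts)
  have "limit_reduct_left T T' ?I = \<phi>"
  proof (rule limit_eqI)
    show "limit_reduct_left T T' ?I \<in> extensional (model_classes T)" by (simp add: limit_reduct_left_def)
    show "\<phi> \<in> extensional (model_classes T)" using \<phi> unfolding Hom_plus_iff by blast
    fix m A assume A: "A \<in> labs T m"
    show "labelled (limit_reduct_left T T' ?I) A = labelled \<phi> A"
    proof -
      have "labelled (limit_reduct_left T T' ?I) A = (\<Sum>B\<in>labs T' m. labelled \<phi> A * labelled \<psi> B)"
        unfolding labelled_limit_reduct_left[OF T T' ind A] by (intro sum.cong refl I[OF A])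
      then show ?thesis using sum_labelled[OF T' \<psi>, of m] by (simp only: sum_distrib_left[symmetric] mult_1_right)
    qed
  qed
  moreover have "limit_reduct_right T T' ?I = \<psi>"
  proof (rule limit_eqI)
    show "limit_reduct_right T T' ?I \<in> extensional (model_classes T')" by (simp add: limit_reduct_right_def)
    show "\<psi> \<in> extensional (model_classes T')" using \<psi> unfolding Hom_plus_iff by blast
    fix m B assume B: "B \<in> labs T' m"
    show "labelled (limit_reduct_right T T' ?I) B = labelled \<psi> B"
    proof -
      have "labelled (limit_reduct_right T T' ?I) B = (\<Sum>A\<in>labs T m. labelled \<phi> A * labelled \<psi> B)"
        unfolding labelled_limit_reduct_right[OF T T' ind B] by (intro sum.cong refl I[OF _ B])
      then show ?thesis using sum_labelled[OF T \<phi>, of m] by (simp only: sum_distrib_right[symmetric] mult_1_left)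
    qed
  qed
  ultimately have "?I \<in> couplings T T' \<phi> \<psi>" using ind by (simp add: couplings_def)
  moreover have "\<xi> = ?I" if \<xi>: "\<xi> \<in> couplings T T' \<phi> \<psi>" for \<xi>
  proof (rule limit_eqI)
    show "\<xi> \<in> extensional (model_classes (union_theory T T'))"
      using \<xi> unfolding couplings_def Hom_plus_iff by blast
    show "?I \<in> extensional (model_classes (union_theory T T'))"
      using ind unfolding Hom_plus_iff by blast
    fix m M assume M: "M \<in> labs (union_theory T T') m"
    show "labelled \<xi> M = labelled ?I M"
      using uniq[OF \<xi> red_in_labs[OF M]] I[OF red_in_labs[OF M]] by simp
  qed
  ultimately show ?thesis unfolding uniquely_coupleable_def by blast
qed

section \<open>Tournaments as sets of positively oriented sets\<close>

text \<open>\<open>osgn z \<alpha>\<close> is the sign of the permutation sorting the tuple \<open>\<alpha>\<close> by the values of \<open>z\<close>. It is a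
  junk value unless \<open>z\<close> is injective on the distinct list \<open>\<alpha>\<close>.\<close>

definition srt :: "nat \<Rightarrow> (nat \<Rightarrow> real) \<Rightarrow> (nat \<Rightarrow> nat) \<Rightarrow> bool" where
  "srt k y \<sigma> \<longleftrightarrow> \<sigma> permutes {..<k} \<and> (\<forall>i j. i < j \<and> j < k \<longrightarrow> y (inv \<sigma> i) < y (inv \<sigma> j))"

definition osgn :: "(nat \<Rightarrow> real) \<Rightarrow> nat list \<Rightarrow> int" where
  "osgn z \<alpha> = sign (THE \<sigma>. srt (length \<alpha>) (\<lambda>i. z (\<alpha> ! i)) \<sigma>)"

lemma osgn_cases: "osgn z \<alpha> = 1 \<or> osgn z \<alpha> = -1"
  by (simp add: osgn_def sign_def)

lemma srt_inj_on:
  assumes "srt k y \<sigma>"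
  shows "inj_on (\<lambda>i. y (inv \<sigma> i)) {..<k}"
proof (rule inj_onI)
  fix i j assume "i \<in> {..<k}" "j \<in> {..<k}" "y (inv \<sigma> i) = y (inv \<sigma> j)"
  then show "i = j"
    using assms unfolding srt_def by (cases i j rule: linorder_cases) force+
qed

lemma srt_inj_on':
  assumes "srt k y \<sigma>"
  shows "inj_on y {..<k}"
proof (rule inj_onI)
  fix i j assume ij: "i \<in> {..<k}" "j \<in> {..<k}" "y i = y j"
  have \<sigma>: "\<sigma> permutes {..<k}" using assms by (simp add: srt_def)
  have "\<sigma> i \<in> {..<k}" "\<sigma> j \<in> {..<k}" using ij \<sigma> by (simp_all only: permutes_in_image)
  moreover have "y (inv \<sigma> (\<sigma> i)) = y (inv \<sigma> (\<sigma> j))" using ij(3) by (simp add: permutes_inverses[OF \<sigma>])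
  ultimately have "\<sigma> i = \<sigma> j" by (intro inj_onD[OF srt_inj_on[OF assms]])
  then show "i = j" using permutes_inj[OF \<sigma>] by (simp add: inj_eq)
qed

lemma srt_cong:
  assumes "\<And>i. i < k \<Longrightarrow> y i = y' i"
  shows "srt k y \<sigma> \<longleftrightarrow> srt k y' \<sigma>"
proof -
  have "srt k y' \<sigma>" if "srt k y \<sigma>" "\<And>i. i < k \<Longrightarrow> y i = y' i" for y y'
  proof -
    have \<sigma>: "\<sigma> permutes {..<k}" using that by (simp add: srt_def)
    have "inv \<sigma> i < k" if "i < k" for i
      using that permutes_in_image[OF permutes_inv[OF \<sigma>], of i] by simp
    then have eq: "y (inv \<sigma> i) = y' (inv \<sigma> i)" if "i < k" for i
      using that \<open>\<And>i. i < k \<Longrightarrow> y i = y' i\<close> by simp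
    show ?thesis unfolding srt_def
    proof (intro conjI allI impI \<sigma>)
      fix i j assume ij: "i < j \<and> j < k"
      then have "y (inv \<sigma> i) < y (inv \<sigma> j)" using \<open>srt k y \<sigma>\<close> unfolding srt_def by blast
      then show "y' (inv \<sigma> i) < y' (inv \<sigma> j)" using eq[of i] eq[of j] ij by simp
    qed
  qed
  from this[of y y'] this[of y' y] show ?thesis using assms by auto
qed

text \<open>Read in the order given by either permutation, the values of y form the strictly sorted
  list of the same set. Such a list is unique, and y is injective on the indices.\<close>

lemma srt_unique:
  assumes "srt k y \<sigma>" "srt k y \<tau>"
  shows "\<sigma> = \<tau>"
proof -
  have \<sigma>: "\<sigma> permutes {..<k}" and \<tau>: "\<tau> permutes {..<k}" using assms by (simp_all add: srt_def)
  let ?L = "\<lambda>\<sigma>. map (\<lambda>i. y (inv \<sigma> i)) [0..<k]"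
  have sw: "sorted_wrt (<) (?L \<sigma>)" "sorted_wrt (<) (?L \<tau>)"
    using assms by (simp_all add: srt_def sorted_wrt_iff_nth_less)
  have im: "set (?L \<rho>) = y ` {..<k}" if "\<rho> permutes {..<k}" for \<rho>
  proof -
    have "y ` {..<k} = y ` inv \<rho> ` {..<k}" using permutes_image[OF permutes_inv[OF that]] by (simp only:)
    then show ?thesis by (simp add: image_image atLeast0LessThan)
  qed
  have "set (?L \<sigma>) = set (?L \<tau>)" by (simp only: im[OF \<sigma>] im[OF \<tau>])
  with sw have "?L \<sigma> = ?L \<tau>"
    by (intro strict_sorted_equal)
  then have eq: "y (inv \<sigma> i) = y (inv \<tau> i)" if "i < k" for i
    using that by simp
  have "inv \<sigma> = inv \<tau>"
  proof (rule ext)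
    fix i
    show "inv \<sigma> i = inv \<tau> i"
    proof (cases "i < k")
      case True
      then have "inv \<sigma> i \<in> {..<k}" "inv \<tau> i \<in> {..<k}"
        using permutes_in_image[OF permutes_inv[OF \<sigma>], of i] permutes_in_image[OF permutes_inv[OF \<tau>], of i]
        by simp_all
      then show ?thesis using eq[OF True] by (intro inj_onD[OF srt_inj_on'[OF assms(1)]])
    next
      case False
      then show ?thesis
        using permutes_not_in[OF permutes_inv[OF \<sigma>], of i] permutes_not_in[OF permutes_inv[OF \<tau>], of i] by simp
    qed
  qed
  then have "inv (inv \<sigma>) = inv (inv \<tau>)" by (rule arg_cong)
  then show ?thesis by (simp only: permutes_inv_inv[OF \<sigma>] permutes_inv_inv[OF \<tau>])
qed

lemma srt_exists:
  assumes "inj_on y {..<k}"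
  shows "\<exists>\<sigma>. srt k y \<sigma>"
proof -
  define L where "L = sorted_list_of_set (y ` {..<k})"
  have L: "set L = y ` {..<k}" "sorted_wrt (<) L" "length L = k" "distinct L"
    using card_image[OF assms] by (simp_all add: L_def)
  define g where "g = (\<lambda>i. if i < k then inv_into {..<k} y (L ! i) else i)"
  have yg: "y (g i) = L ! i" "g i < k" if "i < k" for i
  proof -
    have "L ! i \<in> y ` {..<k}" using that L by (metis nth_mem)
    then show "y (g i) = L ! i" "g i < k"
      using f_inv_into_f[of "L ! i" y "{..<k}"] inv_into_into[of "L ! i" y "{..<k}"] that
      by (simp_all add: g_def)
  qed
  have "inj_on g {..<k}"
  proof (rule inj_onI)
    fix i j assume ij: "i \<in> {..<k}" "j \<in> {..<k}" "g i = g j"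
    then have "L ! i = L ! j" using yg(1)[of i] yg(1)[of j] by simp
    then show "i = j" using ij L by (simp add: nth_eq_iff_index_eq)
  qed
  then have g: "g permutes {..<k}"
    using yg(2) by (intro inj_imp_permutes) (simp_all add: g_def)
  have "srt k y (inv g)"
    unfolding srt_def permutes_inv_inv[OF g]
  proof (intro conjI allI impI permutes_inv[OF g])
    fix i j assume "i < j \<and> j < k"
    then show "y (g i) < y (g j)"
      using yg(1)[of i] yg(1)[of j] sorted_wrt_nth_less[OF L(2), of i j] L(3) by simp
  qed
  then show ?thesis by blast
qed

lemma srt_comp:
  assumes "srt k y \<sigma>" "\<tau> permutes {..<k}"
  shows "srt k (\<lambda>i. y (\<tau> i)) (\<sigma> \<circ> \<tau>)"
proof -
  have \<sigma>: "\<sigma> permutes {..<k}" using assms by (simp add: srt_def)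
  have "inv (\<sigma> \<circ> \<tau>) = inv \<tau> \<circ> inv \<sigma>"
    using permutes_bij[OF \<sigma>] permutes_bij[OF assms(2)] by (rule o_inv_distrib)
  then have "\<tau> (inv (\<sigma> \<circ> \<tau>) i) = inv \<sigma> i" for i
    by (simp add: permutes_inverses[OF assms(2)])
  then show ?thesis
    using assms(1) permutes_compose[OF assms(2) \<sigma>] unfolding srt_def by simp
qed

lemma osgn_eq:
  assumes "srt (length \<alpha>) (\<lambda>i. z (\<alpha> ! i)) \<sigma>"
  shows "osgn z \<alpha> = sign \<sigma>"
proof -
  have "(THE \<sigma>. srt (length \<alpha>) (\<lambda>i. z (\<alpha> ! i)) \<sigma>) = \<sigma>"
    using assms srt_unique[OF _ assms] by (rule the_equality)
  then show ?thesis by (simp only: osgn_def)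
qed

lemma inj_on_nth_comp:
  assumes "distinct \<alpha>" "inj_on z (set \<alpha>)"
  shows "inj_on (\<lambda>i. z (\<alpha> ! i)) {..<length \<alpha>}"
proof (rule inj_onI)
  fix i j assume "i \<in> {..<length \<alpha>}" "j \<in> {..<length \<alpha>}" "z (\<alpha> ! i) = z (\<alpha> ! j)"
  then show "i = j" using assms by (simp add: inj_on_eq_iff nth_eq_iff_index_eq)
qed

text \<open>Permuting the positions of the tuple by \<tau> composes its sorting permutation with
  \<tau>.\<close>

lemma osgn_permute:
  assumes "distinct \<alpha>" "inj_on z (set \<alpha>)" "\<tau> permutes {..<length \<alpha>}"
  shows "osgn z (permute_list \<tau> \<alpha>) = osgn z \<alpha> * sign \<tau>"
proof -
  obtain \<sigma> where \<sigma>: "srt (length \<alpha>) (\<lambda>i. z (\<alpha> ! i)) \<sigma>"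
    using srt_exists[OF inj_on_nth_comp[OF assms(1,2)]] by blast
  have "srt (length \<alpha>) (\<lambda>i. z (permute_list \<tau> \<alpha> ! i)) (\<sigma> \<circ> \<tau>)"
    using srt_comp[OF \<sigma> assms(3)]
    by (rule iffD1[OF srt_cong, rotated]) (simp add: permute_list_nth[OF assms(3)])
  then have "osgn z (permute_list \<tau> \<alpha>) = sign (\<sigma> \<circ> \<tau>)" by (intro osgn_eq) simp
  moreover have "permutation \<sigma>" "permutation \<tau>"
    using \<sigma> assms(3) permutes_imp_permutation unfolding srt_def by blast+
  ultimately show ?thesis by (simp add: osgn_eq[OF \<sigma>] sign_compose)
qed

lemma osgn_map: "osgn z (map g \<alpha>) = osgn (z \<circ> g) \<alpha>"
proof -
  have "srt (length \<alpha>) (\<lambda>i. z (map g \<alpha> ! i)) = srt (length \<alpha>) (\<lambda>i. (z \<circ> g) (\<alpha> ! i))"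
    by (intro ext srt_cong) simp
  then show ?thesis by (simp add: osgn_def)
qed

abbreviation sl :: "nat set \<Rightarrow> nat list" where "sl \<equiv> sorted_list_of_set"

abbreviation lsgn :: "nat list \<Rightarrow> int" where "lsgn \<equiv> osgn real"

lemma lsgn_sl: "finite A \<Longrightarrow> lsgn (sl A) = 1"
proof -
  assume "finite A"
  then have "sorted_wrt (<) (sl A)" by simp
  then have "srt (length (sl A)) (\<lambda>i. real (sl A ! i)) id"
    by (simp add: srt_def permutes_id sorted_wrt_iff_nth_less)
  then show ?thesis using osgn_eq by fastforce
qed

lemma ex_permute_sl:
  assumes "distinct \<alpha>"
  shows "\<exists>\<tau>. \<tau> permutes {..<length \<alpha>} \<and> \<alpha> = permute_list \<tau> (sl (set \<alpha>)) \<and> lsgn \<alpha> = sign \<tau>"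
proof -
  have d: "distinct (sl (set \<alpha>))" "length (sl (set \<alpha>)) = length \<alpha>" "set (sl (set \<alpha>)) = set \<alpha>"
    using assms by (simp_all add: distinct_card)
  have "mset \<alpha> = mset (sl (set \<alpha>))"
    by (rule iffD1[OF set_eq_iff_mset_eq_distinct[OF assms d(1)] d(3)[symmetric]])
  then obtain \<tau> where \<tau>: "\<tau> permutes {..<length (sl (set \<alpha>))}" "permute_list \<tau> (sl (set \<alpha>)) = \<alpha>"
    by (rule mset_eq_permutation)
  have "lsgn (permute_list \<tau> (sl (set \<alpha>))) = lsgn (sl (set \<alpha>)) * sign \<tau>"
    using d(1) \<tau>(1) by (intro osgn_permute) simp_all
  then have "lsgn \<alpha> = sign \<tau>" using \<tau>(2) lsgn_sl[of "set \<alpha>"] by simp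
  moreover have "\<tau> permutes {..<length \<alpha>}" using \<tau>(1) d(2) by simp
  ultimately show ?thesis using \<tau>(2)[symmetric] by blast
qed

text \<open>Two alternating signs on the orderings of one set differ by a constant, read off at the
  increasing ordering. So the sign with respect to z splits into a factor depending on the set and
  one not involving z.\<close>

lemma osgn_sl:
  assumes "distinct \<alpha>" "inj_on z (set \<alpha>)"
  shows "osgn z \<alpha> = osgn z (sl (set \<alpha>)) * lsgn \<alpha>"
proof -
  obtain \<tau> where \<tau>: "\<tau> permutes {..<length \<alpha>}" "\<alpha> = permute_list \<tau> (sl (set \<alpha>))" "lsgn \<alpha> = sign \<tau>"
    using ex_permute_sl[OF assms(1)] by blast
  have "length (sl (set \<alpha>)) = length \<alpha>" using assms(1) by (simp add: distinct_card)
  then have "osgn z (permute_list \<tau> (sl (set \<alpha>))) = osgn z (sl (set \<alpha>)) * sign \<tau>"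
    using assms(2) \<tau>(1) by (intro osgn_permute) simp_all
  then show ?thesis using \<tau>(2,3) by simp
qed

definition ksets :: "nat \<Rightarrow> nat set \<Rightarrow> nat set set" where
  "ksets k V = {A. A \<subseteq> V \<and> card A = k}"

text \<open>A \<open>k\<close>-tournament on \<open>V\<close> is encoded by the collection \<open>U\<close> of the \<open>k\<close>-sets whose increasing
  enumeration is an edge.\<close>

definition tour :: "nat \<Rightarrow> nat set \<Rightarrow> nat set set \<Rightarrow> unit struct" where
  "tour k V U = \<lparr>verts = V,
     rels = (\<lambda>_. {\<alpha>. length \<alpha> = k \<and> distinct \<alpha> \<and> set \<alpha> \<subseteq> V \<and> (set \<alpha> \<in> U \<longleftrightarrow> lsgn \<alpha> = 1)})\<rparr>"

lemma verts_tour [simp]: "verts (tour k V U) = V"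
  by (simp add: tour_def)

lemma mem_rels_tour: "\<alpha> \<in> rels (tour k V U) P \<longleftrightarrow>
    length \<alpha> = k \<and> distinct \<alpha> \<and> set \<alpha> \<subseteq> V \<and> (set \<alpha> \<in> U \<longleftrightarrow> lsgn \<alpha> = 1)"
  by (simp add: tour_def)

section \<open>The tournament axioms and the encoding by sets\<close>

lemma sat_foldr_Disj: "sat M v (foldr Disj as Falsum) \<longleftrightarrow> (\<exists>a\<in>set as. sat M v a)"
  by (induction as) auto

lemma sat_some_coincide: "sat M v (some_coincide k) \<longleftrightarrow> \<not> distinct (map v [0..<k])"
proof -
  have "sat M v (some_coincide k) \<longleftrightarrow> (\<exists>j<k. \<exists>i<j. v i = v j)"
    unfolding some_coincide_def sat_foldr_Disj
  proof
    assume "\<exists>a\<in>set [Equal i j. j \<leftarrow> [0..<k], i \<leftarrow> [0..<j]]. sat M v a"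
    then obtain a where a: "a \<in> set [Equal i j. j \<leftarrow> [0..<k], i \<leftarrow> [0..<j]]" "sat M v a" by blast
    from a(1) obtain i j where "j < k" "i < j" "a = Equal i j" by auto
    then show "\<exists>j<k. \<exists>i<j. v i = v j" using a(2) by fastforce
  next
    assume "\<exists>j<k. \<exists>i<j. v i = v j"
    then obtain i j where ij: "j < k" "i < j" "v i = v j" by blast
    then have "(Equal i j :: 'a fm) \<in> set [Equal i j. j \<leftarrow> [0..<k], i \<leftarrow> [0..<j]]"
      by (force simp: image_iff)
    moreover have "sat M v (Equal i j)" using ij by simp
    ultimately show "\<exists>a\<in>set [Equal i j. j \<leftarrow> [0..<k], i \<leftarrow> [0..<j]]. sat M v a" by (rule bexI[rotated])
  qed
  also have "\<dots> \<longleftrightarrow> \<not> distinct (map v [0..<k])"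
  proof -
    have "distinct (map v [0..<k]) \<longleftrightarrow> (\<forall>j<k. \<forall>i<j. v i \<noteq> v j)"
    proof
      assume "distinct (map v [0..<k])"
      then have "inj_on v {0..<k}" by (simp add: distinct_map)
      then show "\<forall>j<k. \<forall>i<j. v i \<noteq> v j" by (auto dest: inj_onD)
    next
      assume h: "\<forall>j<k. \<forall>i<j. v i \<noteq> v j"
      have "inj_on v {0..<k}"
      proof (rule inj_onI)
        fix i j assume "i \<in> {0..<k}" "j \<in> {0..<k}" "v i = v j"
        then show "i = j" using h by (cases i j rule: linorder_cases) force+
      qed
      then show "distinct (map v [0..<k])" by (simp add: distinct_map)
    qed
    then show ?thesis by blast
  qed
  finally show ?thesis .
qed

lemma preds_tournament_theory [simp]: "preds (tournament_theory k) = {()}"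
  and arity_tournament_theory [simp]: "arity (tournament_theory k) P = k"
  by (simp_all add: tournament_theory_def)

lemma fm_over_some_coincide: "fm_over T (some_coincide k)"
proof -
  have h: "fm_over T (foldr Disj as Falsum)" if "\<forall>a\<in>set as. fm_over T a" for as
    using that by (induction as) auto
  show ?thesis unfolding some_coincide_def by (rule h) auto
qed

lemma universal_tournament: "1 \<le> k \<Longrightarrow> universal_theory (tournament_theory k)"
  unfolding universal_theory_def
  by (auto simp: tournament_theory_def tournament_axiom_def fm_over_some_coincide)

lemma map_upt_permute:
  assumes "\<sigma> permutes {..<k}"
  shows "map v (map \<sigma> [0..<k]) = permute_list \<sigma> (map v [0..<k])"
proof (rule nth_equalityI)
  fix i assume "i < length (map v (map \<sigma> [0..<k]))"
  then have i: "i < k" by simp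
  then have "\<sigma> i < k" using permutes_in_image[OF assms, of i] by simp
  then show "map v (map \<sigma> [0..<k]) ! i = permute_list \<sigma> (map v [0..<k]) ! i"
    using i assms by (simp add: permute_list_nth)
qed simp

lemma model_tournament_iff:
  "model (tournament_theory k) M \<longleftrightarrow>
     (\<forall>\<alpha>\<in>rels M (). set \<alpha> \<subseteq> verts M \<and> length \<alpha> = k) \<and>
     (\<forall>v. range v \<subseteq> verts M \<longrightarrow> map v [0..<k] \<in> rels M () \<longrightarrow> distinct (map v [0..<k])) \<and>
     (\<forall>v \<sigma>. range v \<subseteq> verts M \<longrightarrow> \<sigma> permutes {..<k} \<longrightarrow> distinct (map v [0..<k]) \<longrightarrow>
        (permute_list \<sigma> (map v [0..<k]) \<in> rels M () \<longleftrightarrow> (map v [0..<k] \<in> rels M () \<longleftrightarrow> sign \<sigma> = 1)))"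
proof -
  have 1: "is_struct (tournament_theory k) M \<longleftrightarrow> (\<forall>\<alpha>\<in>rels M (). set \<alpha> \<subseteq> verts M \<and> length \<alpha> = k)"
    unfolding is_struct_def by auto
  have 2: "sat M v (Imp (some_coincide k) (Neg (Rel () [0..<k]))) \<longleftrightarrow>
      (map v [0..<k] \<in> rels M () \<longrightarrow> distinct (map v [0..<k]))" for v
    by (auto simp: sat_some_coincide)
  have 3: "sat M v (tournament_axiom k \<sigma>) \<longleftrightarrow> (distinct (map v [0..<k]) \<longrightarrow>
      (permute_list \<sigma> (map v [0..<k]) \<in> rels M () \<longleftrightarrow> (map v [0..<k] \<in> rels M () \<longleftrightarrow> sign \<sigma> = 1)))"
    if "\<sigma> permutes {..<k}" for v \<sigma>
    unfolding map_upt_permute[OF that, symmetric] tournament_axiom_def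
    by (simp add: sat_some_coincide del: map_map) blast
  have "model (tournament_theory k) M \<longleftrightarrow> is_struct (tournament_theory k) M \<and>
     (\<forall>v. range v \<subseteq> verts M \<longrightarrow> sat M v (Imp (some_coincide k) (Neg (Rel () [0..<k])))) \<and>
     (\<forall>v \<sigma>. range v \<subseteq> verts M \<longrightarrow> \<sigma> permutes {..<k} \<longrightarrow> sat M v (tournament_axiom k \<sigma>))"
    unfolding model_def by (auto simp: tournament_theory_def)
  then show ?thesis unfolding 1 2 using 3 by (simp cong: imp_cong)
qed

lemma model_tour:
  assumes "1 \<le> k"
  shows "model (tournament_theory k) (tour k V U)"
  unfolding model_tournament_iff
proof (intro conjI allI impI ballI)
  fix v \<sigma>
  assume v: "range v \<subseteq> verts (tour k V U)" and \<sigma>: "\<sigma> permutes {..<k}" and d: "distinct (map v [0..<k])"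
  let ?a = "map v [0..<k]"
  have s: "set (permute_list \<sigma> ?a) = set ?a" using \<sigma> by (simp add: set_permute_list del: set_map)
  have "lsgn (permute_list \<sigma> ?a) = lsgn ?a * sign \<sigma>"
    using d \<sigma> by (intro osgn_permute) simp_all
  then have "lsgn (permute_list \<sigma> ?a) = 1 \<longleftrightarrow> (lsgn ?a = 1 \<longleftrightarrow> sign \<sigma> = 1)"
    using osgn_cases[of real ?a] by (auto simp: sign_def)
  moreover have "set ?a \<subseteq> V" using v by auto
  moreover have "distinct (permute_list \<sigma> ?a)" using d \<sigma> by simp
  ultimately show "permute_list \<sigma> ?a \<in> rels (tour k V U) () \<longleftrightarrow> (?a \<in> rels (tour k V U) () \<longleftrightarrow> sign \<sigma> = 1)"
    unfolding mem_rels_tour s using d by (simp del: set_map) blast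
qed (simp_all add: mem_rels_tour)

text \<open>The axioms determine all orderings of a k-set from its increasing one, with the sign
  rule that defines \<open>tour\<close>.\<close>

lemma model_tournament_eq_tour:
  assumes k: "1 \<le> k" and M: "model (tournament_theory k) M"
  shows "M = tour k (verts M) {A \<in> ksets k (verts M). sl A \<in> rels M ()}"
proof (rule struct_eqI)
  let ?U = "{A \<in> ksets k (verts M). sl A \<in> rels M ()}"
  have M1: "set \<alpha> \<subseteq> verts M" "length \<alpha> = k" if "\<alpha> \<in> rels M ()" for \<alpha>
    using M that unfolding model_tournament_iff by blast+
  have ext: "\<exists>v. range v \<subseteq> verts M \<and> map v [0..<k] = \<alpha>" if "set \<alpha> \<subseteq> verts M" "length \<alpha> = k" for \<alpha>
  proof -
    \<comment> \<open>An assignment also has to send the variables beyond k to vertices; \<alpha>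
      has an entry to use because k \<ge> 1.\<close>
    define v where "v = (\<lambda>i. if i < k then \<alpha> ! i else \<alpha> ! 0)"
    have "v i \<in> set \<alpha>" for i using that(2) k by (simp add: v_def)
    then have "range v \<subseteq> verts M" using that(1) by auto
    moreover have "map v [0..<k] = \<alpha>" using that(2) by (intro nth_equalityI) (simp_all add: v_def)
    ultimately show ?thesis by blast
  qed
  have M2: "distinct \<alpha>" if "\<alpha> \<in> rels M ()" for \<alpha>
  proof -
    obtain v where v: "range v \<subseteq> verts M" "map v [0..<k] = \<alpha>" using ext[OF M1[OF \<open>\<alpha> \<in> rels M ()\<close>]] by blast
    have "range v \<subseteq> verts M \<longrightarrow> map v [0..<k] \<in> rels M () \<longrightarrow> distinct (map v [0..<k])"
      using M unfolding model_tournament_iff by blast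
    then show ?thesis using v that by simp
  qed
  have M3: "permute_list \<sigma> \<alpha> \<in> rels M () \<longleftrightarrow> (\<alpha> \<in> rels M () \<longleftrightarrow> sign \<sigma> = 1)"
    if \<alpha>: "set \<alpha> \<subseteq> verts M" "length \<alpha> = k" "distinct \<alpha>" and \<sigma>: "\<sigma> permutes {..<k}" for \<alpha> \<sigma>
  proof -
    obtain v where v: "range v \<subseteq> verts M" "map v [0..<k] = \<alpha>" using ext[OF \<alpha>(1,2)] by blast
    have "range v \<subseteq> verts M \<longrightarrow> \<sigma> permutes {..<k} \<longrightarrow> distinct (map v [0..<k]) \<longrightarrow>
        (permute_list \<sigma> (map v [0..<k]) \<in> rels M () \<longleftrightarrow> (map v [0..<k] \<in> rels M () \<longleftrightarrow> sign \<sigma> = 1))"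
      using M unfolding model_tournament_iff by blast
    then show ?thesis using v \<sigma> \<alpha>(3) by simp
  qed
  fix P :: unit and \<alpha>
  show "\<alpha> \<in> rels M P \<longleftrightarrow> \<alpha> \<in> rels (tour k (verts M) ?U) P"
  proof (cases "length \<alpha> = k \<and> distinct \<alpha> \<and> set \<alpha> \<subseteq> verts M")
    case True
    then obtain \<tau> where \<tau>: "\<tau> permutes {..<k}" "\<alpha> = permute_list \<tau> (sl (set \<alpha>))" "lsgn \<alpha> = sign \<tau>"
      using ex_permute_sl[of \<alpha>] by blast
    have sl: "set (sl (set \<alpha>)) \<subseteq> verts M" "length (sl (set \<alpha>)) = k" "distinct (sl (set \<alpha>))"
      using True by (simp_all add: distinct_card)
    have "\<alpha> \<in> rels M () \<longleftrightarrow> (sl (set \<alpha>) \<in> rels M () \<longleftrightarrow> lsgn \<alpha> = 1)"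
      using M3[OF sl \<tau>(1)] \<tau>(2,3) by simp
    moreover have "set \<alpha> \<in> ksets k (verts M)" using True by (simp add: ksets_def distinct_card)
    ultimately show ?thesis using True unfolding mem_rels_tour by simp
  next
    case False
    then show ?thesis using M1[of \<alpha>] M2[of \<alpha>] unfolding mem_rels_tour by auto
  qed
qed simp

lemma tour_inj:
  assumes "tour k V U = tour k V U'" "U \<subseteq> ksets k V" "U' \<subseteq> ksets k V" "1 \<le> k"
  shows "U = U'"
proof -
  have "A \<in> W \<longleftrightarrow> sl A \<in> rels (tour k V W) ()" if "A \<in> ksets k V" for A W
  proof -
    have A: "A \<subseteq> V" "card A = k" using that by (simp_all add: ksets_def)
    then have "finite A" using assms(4) by (intro card_ge_0_finite) simp
    then show ?thesis using A by (simp add: mem_rels_tour lsgn_sl)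
  qed
  note iff = this
  show ?thesis
  proof (rule set_eqI)
    fix A
    show "A \<in> U \<longleftrightarrow> A \<in> U'"
    proof (cases "A \<in> ksets k V")
      case True
      then show ?thesis using iff[OF True, of U] iff[OF True, of U'] assms(1) by simp
    next
      case False
      then show ?thesis using assms(2,3) by blast
    qed
  qed
qed

lemma labs_tournament:
  assumes "1 \<le> k"
  shows "labs (tournament_theory k) m = tour k {..<m} ` Pow (ksets k {..<m})"
proof (intro equalityI subsetI)
  fix M assume M: "M \<in> labs (tournament_theory k) m"
  then have "M = tour k {..<m} {A \<in> ksets k {..<m}. sl A \<in> rels M ()}"
    using model_tournament_eq_tour[OF assms, of M] by (simp add: labs_def)
  moreover have "{A \<in> ksets k {..<m}. sl A \<in> rels M ()} \<in> Pow (ksets k {..<m})" by blast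
  ultimately show "M \<in> tour k {..<m} ` Pow (ksets k {..<m})" by (rule image_eqI)
next
  fix M assume "M \<in> tour k {..<m} ` Pow (ksets k {..<m})"
  then obtain U where "M = tour k {..<m} U" by blast
  then show "M \<in> labs (tournament_theory k) m" using model_tour[OF assms] by (simp add: labs_def)
qed

text \<open>The image of the increasing enumeration of A under v need not be increasing; its sign
  records the correction.\<close>

definition pbU :: "nat \<Rightarrow> nat list \<Rightarrow> nat set set \<Rightarrow> nat set set" where
  "pbU k v U = {A \<in> ksets k {..<length v}. (!) v ` A \<in> U \<longleftrightarrow> lsgn (map ((!) v) (sl A)) = 1}"

lemma pbU_subset: "v \<in> injs m V \<Longrightarrow> pbU k v U \<subseteq> ksets k {..<m}"
  by (auto simp: pbU_def injs_def)

lemma pb_tour: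
  assumes "v \<in> injs m V"
  shows "pb v (tour k V U) = tour k {..<m} (pbU k v U)"
proof (rule struct_eqI)
  have v: "length v = m" "distinct v" "set v \<subseteq> V" using assms by (simp_all add: injs_def)
  fix P :: unit and \<alpha>
  show "\<alpha> \<in> rels (pb v (tour k V U)) P \<longleftrightarrow> \<alpha> \<in> rels (tour k {..<m} (pbU k v U)) P"
  proof (cases "set \<alpha> \<subseteq> {..<m} \<and> length \<alpha> = k \<and> distinct \<alpha>")
    case True
    then have \<alpha>: "set \<alpha> \<subseteq> {..<m}" "length \<alpha> = k" "distinct \<alpha>" by simp_all
    have inj: "inj_on ((!) v) (set \<alpha>)"
      using v \<alpha>(1) by (intro inj_on_nth) auto
    then have d: "distinct (map ((!) v) \<alpha>)" using \<alpha>(3) by (simp add: distinct_map)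
    have sub: "set (map ((!) v) \<alpha>) \<subseteq> V" using \<alpha>(1) v(1,3) by (auto simp: subset_iff)
    have "osgn (real \<circ> (!) v) \<alpha> = osgn (real \<circ> (!) v) (sl (set \<alpha>)) * lsgn \<alpha>"
      using \<alpha>(3) inj by (intro osgn_sl comp_inj_on) simp_all
    then have "lsgn (map ((!) v) \<alpha>) = lsgn (map ((!) v) (sl (set \<alpha>))) * lsgn \<alpha>"
      by (simp only: osgn_map)
    then have s: "lsgn (map ((!) v) \<alpha>) = 1 \<longleftrightarrow> (lsgn (map ((!) v) (sl (set \<alpha>))) = 1 \<longleftrightarrow> lsgn \<alpha> = 1)"
      using osgn_cases[of real \<alpha>] osgn_cases[of real "map ((!) v) (sl (set \<alpha>))"] by auto
    have "set \<alpha> \<in> ksets k {..<m}" using \<alpha> by (simp add: ksets_def distinct_card)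
    then have "set \<alpha> \<in> pbU k v U \<longleftrightarrow> (set (map ((!) v) \<alpha>) \<in> U \<longleftrightarrow> lsgn (map ((!) v) (sl (set \<alpha>))) = 1)"
      using v(1) by (simp add: pbU_def)
    moreover have "\<alpha> \<in> rels (pb v (tour k V U)) P \<longleftrightarrow> map ((!) v) \<alpha> \<in> rels (tour k V U) P"
      using \<alpha>(1) v(1) by (simp add: pb_def)
    ultimately show ?thesis using s d sub \<alpha> unfolding mem_rels_tour by (simp del: set_map) blast
  next
    case False
    then show ?thesis
      using v(1) by (auto simp: pb_def mem_rels_tour distinct_map)
  qed
qed (use assms in \<open>simp add: injs_def\<close>)

section \<open>Random tournaments by the second moment method\<close>

lemma card_Pow_inter_eq:
  assumes "finite Q" "J \<subseteq> Q" "J0 \<subseteq> J"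
  shows "card {U \<in> Pow Q. U \<inter> J = J0} * 2 ^ card J = 2 ^ card Q"
proof -
  have "bij_betw (\<lambda>W. W \<union> J0) (Pow (Q - J)) {U \<in> Pow Q. U \<inter> J = J0}"
  proof (rule bij_betwI[where g = "\<lambda>U. U - J"])
    show "(\<lambda>W. W \<union> J0) \<in> Pow (Q - J) \<rightarrow> {U \<in> Pow Q. U \<inter> J = J0}" using assms(2,3) by auto
    show "(\<lambda>U. U - J) \<in> {U \<in> Pow Q. U \<inter> J = J0} \<rightarrow> Pow (Q - J)" by auto
    show "\<And>W. W \<in> Pow (Q - J) \<Longrightarrow> W \<union> J0 - J = W" using assms(3) by auto
    show "\<And>U. U \<in> {U \<in> Pow Q. U \<inter> J = J0} \<Longrightarrow> U - J \<union> J0 = U" by auto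
  qed
  then have "card {U \<in> Pow Q. U \<inter> J = J0} = 2 ^ card (Q - J)"
    using assms(1) by (simp add: bij_betw_same_card[symmetric] card_Pow)
  moreover have "card Q = card (Q - J) + card J"
    using assms(1,2) by (metis card_Diff_subset card_mono finite_subset le_add_diff_inverse2)
  ultimately show ?thesis by (simp add: power_add)
qed

lemma finite_ksets: "finite V \<Longrightarrow> finite (ksets k V)"
  by (simp add: ksets_def)

text \<open>Prescribing \<open>pbU k v U\<close> amounts to prescribing \<open>U\<close> on these sets.\<close>

definition constrained :: "nat \<Rightarrow> nat list \<Rightarrow> nat set set" where
  "constrained k v = (`) ((!) v) ` ksets k {..<length v}"

lemma inj_on_image_ksets:
  assumes "distinct v"
  shows "inj_on ((`) ((!) v)) (ksets k {..<length v})"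
proof -
  have "inj_on ((!) v) {..<length v}" using assms by (intro inj_on_nth) auto
  then have "inj_on ((`) ((!) v)) (Pow {..<length v})" by (rule inj_on_image_Pow)
  then show ?thesis by (rule inj_on_subset) (auto simp: ksets_def)
qed

lemma constrained_props:
  assumes "v \<in> injs m V"
  shows "constrained k v \<subseteq> ksets k V" "constrained k v \<subseteq> Pow (set v)"
    "card (constrained k v) = card (ksets k {..<m})"
proof -
  have v: "length v = m" "distinct v" "set v \<subseteq> V" using assms by (simp_all add: injs_def)
  have inj: "inj_on ((!) v) {..<length v}" using v(2) by (intro inj_on_nth) auto
  have "(!) v ` A \<subseteq> set v \<and> card ((!) v ` A) = k" if "A \<in> ksets k {..<length v}" for A
  proof -
    have A: "A \<subseteq> {..<length v}" "card A = k" using that by (simp_all add: ksets_def)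
    then have "card ((!) v ` A) = k" using inj by (simp add: card_image inj_on_subset)
    moreover have "(!) v ` A \<subseteq> set v" using A(1) by (intro image_subsetI nth_mem) auto
    ultimately show ?thesis by blast
  qed
  then show "constrained k v \<subseteq> ksets k V" "constrained k v \<subseteq> Pow (set v)"
    using v(3) unfolding constrained_def ksets_def[of k V] by (blast, blast)
  show "card (constrained k v) = card (ksets k {..<m})"
    unfolding constrained_def using card_image[OF inj_on_image_ksets[OF v(2)]] v(1) by simp
qed

text \<open>\<open>pbU\<close> reindexes U along v and complements it at the sets whose order v
  changes by an odd permutation. This correction does not depend on U, so prescribing
  \<open>pbU\<close> prescribes a trace of U.\<close>

lemma pbU_eq_iff:
  assumes "distinct v" "U0 \<subseteq> ksets k {..<length v}"
  shows "\<exists>J0 \<subseteq> constrained k v. \<forall>U. pbU k v U = U0 \<longleftrightarrow> U \<inter> constrained k v = J0"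
proof -
  let ?s = "\<lambda>A. lsgn (map ((!) v) (sl A)) = 1"
  let ?K = "ksets k {..<length v}"
  define J0 where "J0 = (`) ((!) v) ` {A \<in> ?K. A \<in> U0 \<longleftrightarrow> ?s A}"
  have mem: "(!) v ` A \<in> J0 \<longleftrightarrow> (A \<in> U0 \<longleftrightarrow> ?s A)" if "A \<in> ?K" for A
  proof -
    have "(!) v ` A \<in> J0 \<longleftrightarrow> A \<in> {A \<in> ?K. A \<in> U0 \<longleftrightarrow> ?s A}"
      unfolding J0_def by (rule inj_on_image_mem_iff[OF inj_on_image_ksets[OF assms(1)] that]) blast
    then show ?thesis using that by simp
  qed
  have "pbU k v U = U0 \<longleftrightarrow> U \<inter> constrained k v = J0" for U
  proof -
    have "pbU k v U = U0 \<longleftrightarrow> (\<forall>A\<in>?K. A \<in> pbU k v U \<longleftrightarrow> A \<in> U0)"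
      using assms(2) unfolding pbU_def by blast
    also have "\<dots> \<longleftrightarrow> (\<forall>A\<in>?K. (!) v ` A \<in> U \<longleftrightarrow> (!) v ` A \<in> J0)"
    proof (rule ball_cong[OF refl])
      fix A assume A: "A \<in> ?K"
      have "A \<in> pbU k v U \<longleftrightarrow> ((!) v ` A \<in> U \<longleftrightarrow> ?s A)" using A by (simp add: pbU_def)
      then show "(A \<in> pbU k v U \<longleftrightarrow> A \<in> U0) \<longleftrightarrow> ((!) v ` A \<in> U \<longleftrightarrow> (!) v ` A \<in> J0)"
        using mem[OF A] by argo
    qed
    also have "\<dots> \<longleftrightarrow> (\<forall>B\<in>constrained k v. B \<in> U \<longleftrightarrow> B \<in> J0)"
      unfolding constrained_def by blast
    also have "\<dots> \<longleftrightarrow> U \<inter> constrained k v = J0"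
    proof -
      have "J0 \<subseteq> constrained k v" unfolding J0_def constrained_def by blast
      then show ?thesis by blast
    qed
    finally show ?thesis .
  qed
  moreover have "J0 \<subseteq> constrained k v" unfolding J0_def constrained_def by blast
  ultimately show ?thesis by blast
qed

lemma card_pbU_eq:
  assumes "finite V" "v \<in> injs m V" "U0 \<subseteq> ksets k {..<m}"
  shows "card {U \<in> Pow (ksets k V). pbU k v U = U0} * 2 ^ card (ksets k {..<m}) = 2 ^ card (ksets k V)"
proof -
  have v: "length v = m" "distinct v" using assms by (simp_all add: injs_def)
  obtain J0 where J0: "J0 \<subseteq> constrained k v" "\<And>U. pbU k v U = U0 \<longleftrightarrow> U \<inter> constrained k v = J0"
    using pbU_eq_iff[OF v(2), of U0 k] assms(3) v(1) by blast
  have "card {U \<in> Pow (ksets k V). U \<inter> constrained k v = J0} * 2 ^ card (constrained k v) = 2 ^ card (ksets k V)"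
    by (rule card_Pow_inter_eq[OF finite_ksets[OF assms(1)] constrained_props(1)[OF assms(2)] J0(1)])
  then show ?thesis by (simp only: J0(2) constrained_props(3)[OF assms(2)])
qed

text \<open>Injections with disjoint images constrain disjoint families of k-sets, so the two events
  are independent. The bound k \<ge> 1 excludes the empty set, which would belong to both
  families.\<close>

lemma card_pbU_eq2:
  assumes "finite V" "v \<in> injs m V" "w \<in> injs m V" "set v \<inter> set w = {}" "U0 \<subseteq> ksets k {..<m}" "1 \<le> k"
  shows "card {U \<in> Pow (ksets k V). pbU k v U = U0 \<and> pbU k w U = U0} * (2 ^ card (ksets k {..<m}))\<^sup>2 =
    2 ^ card (ksets k V)"
proof -
  have v: "length v = m" "distinct v" and w: "length w = m" "distinct w" using assms by (simp_all add: injs_def)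
  obtain J where J: "J \<subseteq> constrained k v" "\<And>U. pbU k v U = U0 \<longleftrightarrow> U \<inter> constrained k v = J"
    using pbU_eq_iff[OF v(2), of U0 k] assms(5) v(1) by blast
  obtain J' where J': "J' \<subseteq> constrained k w" "\<And>U. pbU k w U = U0 \<longleftrightarrow> U \<inter> constrained k w = J'"
    using pbU_eq_iff[OF w(2), of U0 k] assms(5) w(1) by blast
  have disj: "constrained k v \<inter> constrained k w = {}"
  proof -
    have "A = {}" if "A \<in> constrained k v" "A \<in> constrained k w" for A
      using that constrained_props(2)[OF assms(2), of k] constrained_props(2)[OF assms(3), of k] assms(4) by blast
    moreover have "A \<noteq> {}" if "A \<in> constrained k v" for A
      using that constrained_props(1)[OF assms(2), of k] assms(6) by (auto simp: ksets_def)
    ultimately show ?thesis by blast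
  qed
  have iff: "pbU k v U = U0 \<and> pbU k w U = U0 \<longleftrightarrow> U \<inter> (constrained k v \<union> constrained k w) = J \<union> J'" for U
    unfolding J(2) J'(2) using J(1) J'(1) disj by blast
  have fin: "finite (constrained k v)" "finite (constrained k w)"
    using constrained_props(1)[OF assms(2), of k] constrained_props(1)[OF assms(3), of k]
      finite_ksets[OF assms(1)] finite_subset by blast+
  have "card {U \<in> Pow (ksets k V). U \<inter> (constrained k v \<union> constrained k w) = J \<union> J'} *
      2 ^ card (constrained k v \<union> constrained k w) = 2 ^ card (ksets k V)"
    using constrained_props(1)[OF assms(2), of k] constrained_props(1)[OF assms(3), of k] J(1) J'(1)
    by (intro card_Pow_inter_eq finite_ksets assms(1)) blast+
  moreover have "card (constrained k v \<union> constrained k w) = card (ksets k {..<m}) + card (ksets k {..<m})"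
    using card_Un_disjoint[OF fin disj] constrained_props(3)[OF assms(2)] constrained_props(3)[OF assms(3)] by simp
  ultimately show ?thesis unfolding iff by (simp add: power_add power2_eq_square)
qed

lemma card_injs_nth:
  assumes "finite V" "j < m" "x \<in> V"
  shows "card V * card {w \<in> injs m V. w ! j = x} = card (injs m V)"
proof -
  have "[j] \<in> injs 1 {..<m}" using assms(2) by (simp add: injs_def)
  then have "card {w \<in> injs m V. map ((!) w) [j] = [x]} * card (injs 1 V) =
      card (injs m V) * card {u \<in> injs 1 V. u = [x]}"
    by (rule card_restriction[OF assms(1)])
  moreover have "{u \<in> injs 1 V. u = [x]} = {[x]}" using assms(3) by (auto simp: injs_def)
  moreover have "card (injs 1 V) = card V" by (simp add: card_injs[OF assms(1)])
  ultimately show ?thesis by (simp add: mult.commute)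
qed

text \<open>Union bound over the pairs (i, j) of positions at which v and w may coincide: given v,
  the entry of w at j is uniform on V.\<close>

lemma card_meeting_pairs:
  assumes "finite V"
  shows "card V * card {(v, w) \<in> injs m V \<times> injs m V. set v \<inter> set w \<noteq> {}} \<le> m\<^sup>2 * (card (injs m V))\<^sup>2"
proof -
  let ?I = "injs m V"
  have fin: "finite ?I" using assms by simp
  have "{(v, w) \<in> ?I \<times> ?I. set v \<inter> set w \<noteq> {}} \<subseteq>
      (\<Union>(i, j) \<in> {..<m} \<times> {..<m}. Sigma ?I (\<lambda>v. {w \<in> ?I. w ! j = v ! i}))"
  proof safe
    fix v w x assume vw: "v \<in> ?I" "w \<in> ?I" "x \<in> set v" "x \<in> set w"
      and "(v, w) \<notin> (\<Union>(i, j) \<in> {..<m} \<times> {..<m}. Sigma ?I (\<lambda>v. {w \<in> ?I. w ! j = v ! i}))"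
    moreover obtain i j where "i < m" "j < m" "v ! i = x" "w ! j = x"
      using vw by (auto simp: injs_def in_set_conv_nth)
    ultimately show "x \<in> {}" using vw by blast
  qed
  then have "card {(v, w) \<in> ?I \<times> ?I. set v \<inter> set w \<noteq> {}} \<le>
      card (\<Union>(i, j) \<in> {..<m} \<times> {..<m}. Sigma ?I (\<lambda>v. {w \<in> ?I. w ! j = v ! i}))"
    using fin by (intro card_mono finite_UN_I) (auto simp: case_prod_beta)
  also have "\<dots> \<le> (\<Sum>(i, j) \<in> {..<m} \<times> {..<m}. card (Sigma ?I (\<lambda>v. {w \<in> ?I. w ! j = v ! i})))"
    unfolding case_prod_beta by (intro card_UN_le) simp
  finally have "card V * card {(v, w) \<in> ?I \<times> ?I. set v \<inter> set w \<noteq> {}} \<le>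
      card V * (\<Sum>(i, j) \<in> {..<m} \<times> {..<m}. card (Sigma ?I (\<lambda>v. {w \<in> ?I. w ! j = v ! i})))"
    by (rule mult_le_mono2)
  also have "\<dots> = (\<Sum>(i, j) \<in> {..<m} \<times> {..<m}. card V * card (Sigma ?I (\<lambda>v. {w \<in> ?I. w ! j = v ! i})))"
    unfolding case_prod_beta by (rule sum_distrib_left)
  also have "\<dots> = (\<Sum>(i, j) \<in> {..<m} \<times> {..<m}. (card ?I)\<^sup>2)"
  proof (rule sum.cong[OF refl])
    fix x assume "x \<in> {..<m} \<times> {..<m}"
    then obtain i j where x: "x = (i, j)" and ij: "i \<in> {..<m}" "j \<in> {..<m}" by blast
    have "card V * card (Sigma ?I (\<lambda>v. {w \<in> ?I. w ! j = v ! i})) =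
        (\<Sum>v\<in>?I. card V * card {w \<in> ?I. w ! j = v ! i})"
      using fin by (simp add: card_SigmaI sum_distrib_left)
    also have "\<dots> = (\<Sum>v\<in>?I. card ?I)"
    proof (rule sum.cong[OF refl])
      fix v assume "v \<in> ?I"
      then have "v ! i \<in> V" using ij by (auto simp: injs_def)
      then show "card V * card {w \<in> ?I. w ! j = v ! i} = card ?I"
        using card_injs_nth[OF assms] ij by simp
    qed
    finally show "(case x of (i, j) \<Rightarrow> card V * card (Sigma ?I (\<lambda>v. {w \<in> ?I. w ! j = v ! i}))) =
        (case x of (i, j) \<Rightarrow> (card ?I)\<^sup>2)"
      by (simp add: power2_eq_square x)
  qed
  also have "\<dots> = m\<^sup>2 * (card ?I)\<^sup>2" by (simp add: power2_eq_square)
  finally show ?thesis .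
qed

text \<open>A variance bound. Errors at injections with disjoint images are uncorrelated, and the
  other pairs are few by \<open>card_meeting_pairs\<close>. In the application W consists of the
  injections along which a given structure pulls back to a fixed model.\<close>

lemma second_moment:
  assumes V: "finite V" "V \<noteq> {}" and k: "1 \<le> k" and U0: "U0 \<subseteq> ksets k {..<m}" and W: "W \<subseteq> injs m V"
  shows "(\<Sum>U\<in>Pow (ksets k V). (real (card {v \<in> W. pbU k v U = U0}) / real (card (injs m V)) -
      real (card W) / real (card (injs m V)) / 2 ^ card (ksets k {..<m}))\<^sup>2)
    \<le> 2 ^ card (ksets k V) * (real m)\<^sup>2 / real (card V)"
proof -
  let ?Q = "Pow (ksets k V)" and ?I = "real (card (injs m V))"
  define p :: real where "p = 1 / 2 ^ card (ksets k {..<m})"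
  define e where "e v U = of_bool (pbU k v U = U0) - p" for v U
  define D where "D = {(v, w) \<in> injs m V \<times> injs m V. set v \<inter> set w \<noteq> {}}"
  have finQ: "finite ?Q" using finite_ksets[OF V(1)] by simp
  have finI: "finite (injs m V)" using V by simp
  have finW: "finite W" using W finI finite_subset by blast
  have cQ: "real (card ?Q) = 2 ^ card (ksets k V)" using finite_ksets[OF V(1)] by (simp add: card_Pow)
  have p: "0 \<le> p" "p \<le> 1" by (simp_all add: p_def)
  have e1: "\<bar>e v U\<bar> \<le> 1" for v U using p by (simp add: e_def)
  have sumE: "(\<Sum>v\<in>W. e v U) = real (card {v \<in> W. pbU k v U = U0}) - real (card W) * p" for U
  proof -
    have "(\<Sum>v\<in>W. of_bool (pbU k v U = U0)) = real (card {v \<in> W. pbU k v U = U0})"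
      using finW by (simp add: of_bool_def sum.If_cases Int_def)
    then show ?thesis by (simp add: e_def sum_subtractf)
  qed
  have cov0: "(\<Sum>U\<in>?Q. e v U * e w U) = 0" if vw: "v \<in> W" "w \<in> W" "set v \<inter> set w = {}" for v w
  proof -
    have vI: "v \<in> injs m V" "w \<in> injs m V" using vw W by blast+
    let ?q = "2 ^ card (ksets k V) :: real"
    have one: "(\<Sum>U\<in>?Q. of_bool (pbU k v U = U0)) = ?q * p" if "v \<in> injs m V" for v
    proof -
      have "(\<Sum>U\<in>?Q. of_bool (pbU k v U = U0)) = real (card {U \<in> ?Q. pbU k v U = U0})"
        using finQ by (simp add: of_bool_def sum.If_cases Int_def)
      moreover have "real (card {U \<in> ?Q. pbU k v U = U0}) * 2 ^ card (ksets k {..<m}) = ?q"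
        using arg_cong[OF card_pbU_eq[OF V(1) that U0], of real] by simp
      ultimately show ?thesis by (simp add: p_def field_simps)
    qed
    have two: "(\<Sum>U\<in>?Q. of_bool (pbU k v U = U0) * of_bool (pbU k w U = U0)) = ?q * p\<^sup>2"
    proof -
      have "(\<Sum>U\<in>?Q. of_bool (pbU k v U = U0) * of_bool (pbU k w U = U0)) =
          real (card {U \<in> ?Q. pbU k v U = U0 \<and> pbU k w U = U0})"
        unfolding of_bool_conj[symmetric] using finQ by (simp add: of_bool_def sum.If_cases Int_def)
      moreover have "real (card {U \<in> ?Q. pbU k v U = U0 \<and> pbU k w U = U0}) * (2 ^ card (ksets k {..<m}))\<^sup>2 = ?q"
        using arg_cong[OF card_pbU_eq2[OF V(1) vI vw(3) U0 k], of real] by simp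
      ultimately show ?thesis by (simp add: p_def field_simps)
    qed
    have "(\<Sum>U\<in>?Q. e v U * e w U) =
        (\<Sum>U\<in>?Q. of_bool (pbU k v U = U0) * of_bool (pbU k w U = U0) - p * of_bool (pbU k v U = U0)
           - p * of_bool (pbU k w U = U0) + p\<^sup>2)"
      by (intro sum.cong refl) (simp add: e_def algebra_simps power2_eq_square)
    also have "\<dots> = ?q * p\<^sup>2 - p * (?q * p) - p * (?q * p) + ?q * p\<^sup>2"
      unfolding sum.distrib sum_subtractf sum_distrib_left[symmetric] two one[OF vI(1)] one[OF vI(2)]
      by (simp add: cQ[symmetric])
    finally show ?thesis by (simp add: power2_eq_square algebra_simps)
  qed
  have cov1: "(\<Sum>U\<in>?Q. e v U * e w U) \<le> 2 ^ card (ksets k V)" for v w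
  proof -
    have "(\<Sum>U\<in>?Q. e v U * e w U) \<le> (\<Sum>U\<in>?Q. 1)"
    proof (rule sum_mono)
      fix U show "e v U * e w U \<le> 1"
        using mult_mono[OF e1[of v U] e1[of w U]] abs_mult[of "e v U" "e w U"] by simp
    qed
    then show ?thesis by (simp add: cQ)
  qed
  have "(\<Sum>U\<in>?Q. (\<Sum>v\<in>W. e v U)\<^sup>2) = (\<Sum>U\<in>?Q. \<Sum>(v, w)\<in>W \<times> W. e v U * e w U)"
    by (simp add: power2_eq_square sum_product sum.cartesian_product)
  also have "\<dots> = (\<Sum>(v, w)\<in>W \<times> W. \<Sum>U\<in>?Q. e v U * e w U)"
    unfolding case_prod_beta by (rule sum.swap)
  also have "\<dots> \<le> (\<Sum>(v, w)\<in>W \<times> W. if (v, w) \<in> D then 2 ^ card (ksets k V) else 0)"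
  proof (rule sum_mono, clarify)
    fix v w assume vw: "v \<in> W" "w \<in> W"
    show "(\<Sum>U\<in>?Q. e v U * e w U) \<le> (if (v, w) \<in> D then 2 ^ card (ksets k V) else 0)"
    proof (cases "set v \<inter> set w = {}")
      case True
      then show ?thesis using cov0[OF vw True] by simp
    next
      case False
      then have "(v, w) \<in> D" using vw W by (auto simp: D_def)
      then show ?thesis using cov1[of v w] by simp
    qed
  qed
  also have "\<dots> = real (card (W \<times> W \<inter> D)) * 2 ^ card (ksets k V)"
  proof -
    have "(\<Sum>(v, w)\<in>W \<times> W. if (v, w) \<in> D then 2 ^ card (ksets k V) else 0 :: real) =
        (\<Sum>x\<in>W \<times> W. if x \<in> D then 2 ^ card (ksets k V) else 0)"
      by (intro sum.cong refl) (simp add: case_prod_beta)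
    also have "\<dots> = (\<Sum>x\<in>W \<times> W \<inter> D. 2 ^ card (ksets k V))"
      using finW by (subst sum.inter_restrict) simp_all
    finally show ?thesis by simp
  qed
  also have "\<dots> \<le> real (card D) * 2 ^ card (ksets k V)"
  proof -
    have "D \<subseteq> injs m V \<times> injs m V" by (auto simp: D_def)
    then have "finite D" using finI finite_subset by blast
    then show ?thesis by (intro mult_right_mono of_nat_mono card_mono) auto
  qed
  finally have main: "(\<Sum>U\<in>?Q. (\<Sum>v\<in>W. e v U)\<^sup>2) \<le> real (card D) * 2 ^ card (ksets k V)" .
  have n: "0 < real (card V)" using V by (simp add: card_gt_0_iff)
  have "real (card V * card D) \<le> real (m\<^sup>2 * (card (injs m V))\<^sup>2)"
    unfolding D_def by (rule of_nat_mono[OF card_meeting_pairs[OF V(1)]])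
  then have D: "real (card V) * real (card D) \<le> (real m)\<^sup>2 * ?I\<^sup>2" by simp
  have "(\<Sum>U\<in>?Q. (real (card {v \<in> W. pbU k v U = U0}) / ?I - real (card W) / ?I / 2 ^ card (ksets k {..<m}))\<^sup>2)
      = (\<Sum>U\<in>?Q. (\<Sum>v\<in>W. e v U)\<^sup>2) / ?I\<^sup>2"
  proof -
    have eq: "real (card {v \<in> W. pbU k v U = U0}) / ?I - real (card W) / ?I / 2 ^ card (ksets k {..<m})
        = (\<Sum>v\<in>W. e v U) / ?I" for U
      unfolding sumE by (simp add: p_def diff_divide_distrib)
    show ?thesis unfolding eq power_divide by (rule sum_divide_distrib[symmetric])
  qed
  also have "\<dots> \<le> 2 ^ card (ksets k V) * (real m)\<^sup>2 / real (card V)"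
  proof (cases "?I = 0")
    \<comment> \<open>Without injections the quotient on the left is a division by 0, hence
      0.\<close>
    case True
    then show ?thesis by simp
  next
    case False
    have "(\<Sum>U\<in>?Q. (\<Sum>v\<in>W. e v U)\<^sup>2) * real (card V) \<le> (real (card V) * real (card D)) * 2 ^ card (ksets k V)"
      using mult_right_mono[OF main, of "real (card V)"] by (simp add: mult_ac)
    also have "\<dots> \<le> ((real m)\<^sup>2 * ?I\<^sup>2) * 2 ^ card (ksets k V)"
      by (rule mult_right_mono[OF D]) simp
    finally have "(\<Sum>U\<in>?Q. (\<Sum>v\<in>W. e v U)\<^sup>2) * real (card V) \<le> (2 ^ card (ksets k V) * (real m)\<^sup>2) * ?I\<^sup>2"
      by (simp only: mult_ac)
    moreover have "0 < ?I\<^sup>2" using False by simp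
    ultimately show ?thesis using n by (simp add: pos_divide_le_eq pos_le_divide_eq)
  qed
  finally show ?thesis .
qed

lemma inj_density_join_tour:
  assumes U0: "U0 \<subseteq> ksets k {..<m}" and k: "1 \<le> k" and B: "verts B = {..<m}"
  shows "inj_density (join (tour k {..<m} U0) B) (join (tour k (verts N) U) N) =
    real (card {v \<in> {v \<in> injs m (verts N). pb v N = B}. pbU k v U = U0}) / real (card (injs m (verts N)))"
proof -
  have "pb v (join (tour k (verts N) U) N) = join (tour k {..<m} U0) B \<longleftrightarrow> pb v N = B \<and> pbU k v U = U0"
    if v: "v \<in> injs m (verts N)" for v
  proof -
    have len: "length v = m" using v by (simp add: injs_def)
    have "pb v (join (tour k (verts N) U) N) = join (tour k {..<m} (pbU k v U)) (pb v N)"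
      by (simp add: pb_join pb_tour[OF v])
    also have "\<dots> = join (tour k {..<m} U0) B \<longleftrightarrow> tour k {..<m} (pbU k v U) = tour k {..<m} U0 \<and> pb v N = B"
      using len B by (intro join_eq_iff) simp_all
    also have "\<dots> \<longleftrightarrow> pb v N = B \<and> pbU k v U = U0"
      using tour_inj[OF _ pbU_subset[OF v] U0 k] by blast
    finally show ?thesis .
  qed
  then have "{v \<in> injs m (verts N). pb v (join (tour k (verts N) U) N) = join (tour k {..<m} U0) B} =
      {v \<in> {v \<in> injs m (verts N). pb v N = B}. pbU k v U = U0}"
    by (simp add: conj_assoc cong: conj_cong)
  then show ?thesis by (simp add: inj_density_def)
qed

lemma ex_le_average:
  fixes f :: "'a \<Rightarrow> real"
  assumes "finite A" "A \<noteq> {}" "(\<Sum>x\<in>A. f x) \<le> c * real (card A)"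
  shows "\<exists>x\<in>A. f x \<le> c"
proof (rule ccontr)
  assume "\<not> ?thesis"
  then have "(\<Sum>x\<in>A. c) < (\<Sum>x\<in>A. f x)" using assms(1,2) by (intro sum_strict_mono) auto
  then show False using assms(3) by (simp add: mult.commute)
qed

text \<open>One tournament has to serve all m \<le> n at once. By \<open>second_moment\<close> each
  squared error has mean at most m^2 / n. Weighting the errors of size m by 1 / (2^m a(m)) makes the
  mean of the total at most 2 / n, and a tournament not above the mean satisfies every single
  bound.\<close>

lemma ex_random_tournament:
  assumes k: "1 \<le> k" and T: "universal_theory T" and N: "N \<in> fin_models T" and n: "1 \<le> n" "n \<le> card (verts N)"
  shows "\<exists>U\<subseteq>ksets k (verts N). \<forall>m\<le>n. \<forall>U0\<in>Pow (ksets k {..<m}). \<forall>B\<in>labs T m.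
    (inj_density (join (tour k {..<m} U0) B) (join (tour k (verts N) U) N) -
      inj_density B N / 2 ^ card (ksets k {..<m}))\<^sup>2
    \<le> 2 * 2 ^ m * (real (card (Pow (ksets k {..<m}) \<times> labs T m)) * (real m)\<^sup>2 + 1) / real n"
proof -
  let ?V = "verts N"
  let ?P = "\<lambda>m. Pow (ksets k {..<m}) \<times> labs T m"
  \<comment> \<open>The number of pairs times m^2 bounds the mean total error of size m, up to the
    factor 1 / n. The summand 1 keeps the divisor positive.\<close>
  define a where "a m = real (card (?P m)) * (real m)\<^sup>2 + 1" for m
  define F where "F m x U = (inj_density (join (tour k {..<m} (fst x)) (snd x)) (join (tour k ?V U) N) -
      inj_density (snd x) N / 2 ^ card (ksets k {..<m}))\<^sup>2" for m x U
  have V: "finite ?V" "?V \<noteq> {}" using N n by (auto simp: fin_models_def)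
  have finP: "finite (?P m)" for m
    using T finite_labs[of T m] finite_ksets[of "{..<m}" k] by (simp add: universal_theory_def)
  have finQ: "finite (Pow (ksets k ?V))" using finite_ksets[OF V(1)] by simp
  have cQ: "real (card (Pow (ksets k ?V))) = 2 ^ card (ksets k ?V)" using finite_ksets[OF V(1)] by (simp add: card_Pow)
  have apos: "0 < a m" for m by (simp add: a_def add_nonneg_pos)
  have F0: "0 \<le> F m x U" for m x U by (simp add: F_def)
  have sumF: "(\<Sum>U\<in>Pow (ksets k ?V). F m x U) \<le> 2 ^ card (ksets k ?V) * (real m)\<^sup>2 / real n"
    if x: "x \<in> ?P m" for m x
  proof -
    obtain U0 B where xe: "x = (U0, B)" "U0 \<subseteq> ksets k {..<m}" "B \<in> labs T m" using x by blast
    have B: "verts B = {..<m}" using xe(3) by (rule labs_verts)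
    have "(\<Sum>U\<in>Pow (ksets k ?V). F m x U) = (\<Sum>U\<in>Pow (ksets k ?V).
        (real (card {v \<in> {v \<in> injs m ?V. pb v N = B}. pbU k v U = U0}) / real (card (injs m ?V)) -
         real (card {v \<in> injs m ?V. pb v N = B}) / real (card (injs m ?V)) / 2 ^ card (ksets k {..<m}))\<^sup>2)"
      unfolding F_def xe(1) fst_conv snd_conv inj_density_join_tour[OF xe(2) k B] inj_density_labs[OF xe(3)] ..
    also have "\<dots> \<le> 2 ^ card (ksets k ?V) * (real m)\<^sup>2 / real (card ?V)"
      by (rule second_moment[OF V k xe(2)]) blast
    also have "\<dots> \<le> 2 ^ card (ksets k ?V) * (real m)\<^sup>2 / real n"
      using n by (intro divide_left_mono mult_nonneg_nonneg mult_pos_pos) auto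
    finally show ?thesis .
  qed
  define G where "G U = (\<Sum>m\<le>n. (\<Sum>x\<in>?P m. F m x U) / (2 ^ m * a m))" for U
  have "(\<Sum>U\<in>Pow (ksets k ?V). G U) = (\<Sum>m\<le>n. \<Sum>U\<in>Pow (ksets k ?V). (\<Sum>x\<in>?P m. F m x U) / (2 ^ m * a m))"
    unfolding G_def by (rule sum.swap)
  also have "\<dots> \<le> (\<Sum>m\<le>n. (1/2) ^ m * (2 ^ card (ksets k ?V) / real n))"
  proof (rule sum_mono)
    fix m
    have "(\<Sum>U\<in>Pow (ksets k ?V). \<Sum>x\<in>?P m. F m x U) = (\<Sum>x\<in>?P m. \<Sum>U\<in>Pow (ksets k ?V). F m x U)"
      by (rule sum.swap)
    also have "\<dots> \<le> (\<Sum>x\<in>?P m. 2 ^ card (ksets k ?V) * (real m)\<^sup>2 / real n)"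
      by (rule sum_mono) (rule sumF)
    also have "\<dots> = (2 ^ card (ksets k ?V) / real n) * (real (card (?P m)) * (real m)\<^sup>2)"
      by simp
    also have "\<dots> \<le> (2 ^ card (ksets k ?V) / real n) * a m"
      by (rule mult_left_mono) (simp_all add: a_def)
    finally have "(\<Sum>U\<in>Pow (ksets k ?V). \<Sum>x\<in>?P m. F m x U) / (2 ^ m * a m) \<le>
        (2 ^ card (ksets k ?V) / real n) * a m / (2 ^ m * a m)"
      using apos[of m] by (intro divide_right_mono) simp_all
    also have "\<dots> = (1/2) ^ m * (2 ^ card (ksets k ?V) / real n)"
      using apos[of m] by (simp add: power_one_over)
    finally show "(\<Sum>U\<in>Pow (ksets k ?V). (\<Sum>x\<in>?P m. F m x U) / (2 ^ m * a m)) \<le>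
        (1/2) ^ m * (2 ^ card (ksets k ?V) / real n)"
      by (simp only: sum_divide_distrib)
  qed
  also have "\<dots> = (\<Sum>m\<le>n. (1/2) ^ m) * (2 ^ card (ksets k ?V) / real n)"
    by (rule sum_distrib_right[symmetric])
  also have "\<dots> \<le> 2 * (2 ^ card (ksets k ?V) / real n)"
  proof (rule mult_right_mono)
    have "(\<Sum>m\<le>n. (1/2::real) ^ m) = 2 - (1/2) ^ n"
      by (induction n) (simp_all add: field_simps)
    then show "(\<Sum>m\<le>n. (1/2::real) ^ m) \<le> 2" by simp
  qed simp
  finally have "(\<Sum>U\<in>Pow (ksets k ?V). G U) \<le> 2 / real n * real (card (Pow (ksets k ?V)))"
    unfolding cQ by simp
  then obtain U where U: "U \<in> Pow (ksets k ?V)" "G U \<le> 2 / real n"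
    using ex_le_average[OF finQ, of G "2 / real n"] by blast
  have "F m x U \<le> 2 * 2 ^ m * a m / real n" if m: "m \<le> n" and x: "x \<in> ?P m" for m x
  proof -
    have "F m x U \<le> (\<Sum>x\<in>?P m. F m x U)"
      using finP F0 x by (intro member_le_sum) auto
    then have "F m x U / (2 ^ m * a m) \<le> (\<Sum>x\<in>?P m. F m x U) / (2 ^ m * a m)"
      using apos[of m] by (intro divide_right_mono) simp_all
    also have "\<dots> \<le> G U"
      unfolding G_def using m apos F0
      by (intro member_le_sum[of m "{..n}" "\<lambda>m. (\<Sum>x\<in>?P m. F m x U) / (2 ^ m * a m)"])
        (auto intro!: divide_nonneg_pos sum_nonneg mult_pos_pos)
    also have "\<dots> \<le> 2 / real n" by (rule U(2))
    finally have "F m x U \<le> 2 / real n * (2 ^ m * a m)"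
      using apos[of m] by (simp add: pos_divide_le_eq)
    then show ?thesis by simp
  qed
  note bound = this
  show ?thesis
  proof (intro exI[of _ U] conjI allI impI ballI)
    show "U \<subseteq> ksets k ?V" using U(1) by blast
    fix m U0 B assume "m \<le> n" "U0 \<in> Pow (ksets k {..<m})" "B \<in> labs T m"
    then show "(inj_density (join (tour k {..<m} U0) B) (join (tour k ?V U) N) -
      inj_density B N / 2 ^ card (ksets k {..<m}))\<^sup>2
      \<le> 2 * 2 ^ m * (real (card (?P m)) * (real m)\<^sup>2 + 1) / real n"
      using bound[of m "(U0, B)"] unfolding F_def a_def by simp
  qed
qed

lemma ex_random_tournaments:
  assumes k: "1 \<le> k" and T: "universal_theory T" and N: "\<And>n. N n \<in> fin_models T" "\<And>n. n \<le> card (verts (N n))"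
  shows "\<exists>U. \<forall>m. \<forall>U0\<in>Pow (ksets k {..<m}). \<forall>B\<in>labs T m.
    (\<lambda>n. inj_density (join (tour k {..<m} U0) B) (join (tour k (verts (N n)) (U n)) (N n)) -
      inj_density B (N n) / 2 ^ card (ksets k {..<m})) \<longlonglongrightarrow> 0"
proof -
  define c where "c m = 2 * 2 ^ m * (real (card (Pow (ksets k {..<m}) \<times> labs T m)) * (real m)\<^sup>2 + 1)" for m
  let ?R = "\<lambda>n U. \<forall>m\<le>n. \<forall>U0\<in>Pow (ksets k {..<m}). \<forall>B\<in>labs T m.
    (inj_density (join (tour k {..<m} U0) B) (join (tour k (verts (N n)) U) (N n)) -
      inj_density B (N n) / 2 ^ card (ksets k {..<m}))\<^sup>2 \<le> c m / real n"
  have "\<exists>U. 1 \<le> n \<longrightarrow> ?R n U" for n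
  proof (cases "1 \<le> n")
    case True
    obtain U where "?R n U" using ex_random_tournament[OF k T N(1) True N(2)] unfolding c_def by blast
    then show ?thesis by blast
  qed simp
  then obtain U where U: "\<And>n. 1 \<le> n \<Longrightarrow> ?R n (U n)" by metis
  show ?thesis
  proof (intro exI[of _ U] allI ballI)
    fix m U0 B assume UB: "U0 \<in> Pow (ksets k {..<m})" "B \<in> labs T m"
    let ?d = "\<lambda>n. inj_density (join (tour k {..<m} U0) B) (join (tour k (verts (N n)) (U n)) (N n)) -
      inj_density B (N n) / 2 ^ card (ksets k {..<m})"
    have "\<forall>\<^sub>F n in sequentially. norm ((?d n)\<^sup>2) \<le> c m / real n"
      using eventually_ge_at_top[of "max 1 m"]
    proof eventually_elim
      case (elim n)
      then have "1 \<le> n" "m \<le> n" by simp_all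
      then have "(?d n)\<^sup>2 \<le> c m / real n" using U[of n] UB by blast
      then show ?case by simp
    qed
    moreover have "(\<lambda>n. c m / real n) \<longlonglongrightarrow> 0" by (rule lim_const_over_n)
    ultimately have "(\<lambda>n. (?d n)\<^sup>2) \<longlonglongrightarrow> 0" by (rule Lim_null_comparison)
    then show "?d \<longlonglongrightarrow> 0" by (simp add: tendsto_power_zero power_tendsto_0_iff)
  qed
qed

text \<open>Isolates what the coupling argument needs of the quasirandom tournamon;
  \<open>labelled_quasirandom\<close> supplies the values from the theon.\<close>

definition uniform_tournamon :: "nat \<Rightarrow> (unit struct set \<Rightarrow> real) \<Rightarrow> bool" where
  "uniform_tournamon k \<phi> \<longleftrightarrow> \<phi> \<in> extensional (model_classes (tournament_theory k)) \<and>
     (\<forall>m. \<forall>U\<in>Pow (ksets k {..<m}). labelled \<phi> (tour k {..<m} U) = 1 / 2 ^ card (ksets k {..<m}))"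

lemma Hom_plus_independent_coupling:
  assumes k: "1 \<le> k" and \<phi>: "uniform_tournamon k \<phi>" and T: "universal_theory T" and \<psi>: "\<psi> \<in> Hom_plus T"
  shows "independent_coupling (tournament_theory k) T \<phi> \<psi> \<in> Hom_plus (union_theory (tournament_theory k) T)"
proof -
  obtain N where N: "conv_seq T \<psi> N" using \<psi> unfolding Hom_plus_iff by blast
  then have Nf: "N n \<in> fin_models T" for n unfolding conv_seq_def by blast
  obtain U where U: "\<forall>m. \<forall>U0\<in>Pow (ksets k {..<m}). \<forall>B\<in>labs T m.
    (\<lambda>n. inj_density (join (tour k {..<m} U0) B) (join (tour k (verts (N n)) (U n)) (N n)) -
      inj_density B (N n) / 2 ^ card (ksets k {..<m})) \<longlonglongrightarrow> 0"
    using ex_random_tournaments[OF k T Nf conv_seq_card[OF N]] by blast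
  let ?G = "\<lambda>n. join (tour k (verts (N n)) (U n)) (N n)"
  have "conv_seq (union_theory (tournament_theory k) T) (independent_coupling (tournament_theory k) T \<phi> \<psi>) ?G"
    unfolding conv_seq_def
  proof (intro conjI allI ballI)
    fix n
    show "?G n \<in> fin_models (union_theory (tournament_theory k) T)"
      using Nf[of n] model_tour[OF k] by (simp add: fin_models_def model_union)
  next
    show "strict_mono (\<lambda>n. card (verts (?G n)))" using N by (simp add: conv_seq_def)
  next
    fix m M assume M: "M \<in> labs (union_theory (tournament_theory k) T) m"
    obtain U0 where U0: "U0 \<in> Pow (ksets k {..<m})" "red Inl M = tour k {..<m} U0"
      using red_in_labs(1)[OF M] unfolding labs_tournament[OF k] by blast
    define B where "B = red Inr M"
    have B: "B \<in> labs T m" unfolding B_def by (rule red_in_labs(2)[OF M])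
    have Me: "M = join (tour k {..<m} U0) B" using join_red[of M] unfolding U0(2) B_def by (rule sym)
    have "(\<lambda>n. inj_density B (N n)) \<longlonglongrightarrow> labelled \<psi> B" using N B unfolding conv_seq_def by blast
    then have "(\<lambda>n. inj_density B (N n) / 2 ^ card (ksets k {..<m})) \<longlonglongrightarrow> labelled \<psi> B / 2 ^ card (ksets k {..<m})"
      by (intro tendsto_divide tendsto_const) simp_all
    from tendsto_add[OF U[rule_format, OF U0(1) B] this]
    have "(\<lambda>n. inj_density M (?G n)) \<longlonglongrightarrow> labelled \<psi> B / 2 ^ card (ksets k {..<m})"
      by (simp add: Me)
    moreover have "labelled \<phi> (red Inl M) = 1 / 2 ^ card (ksets k {..<m})"
      using \<phi> U0 by (simp add: uniform_tournamon_def)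
    then have "labelled (independent_coupling (tournament_theory k) T \<phi> \<psi>) M = labelled \<psi> B / 2 ^ card (ksets k {..<m})"
      unfolding labelled_independent_coupling[OF M] B_def by simp
    ultimately show "(\<lambda>n. inj_density M (?G n)) \<longlonglongrightarrow>
        labelled (independent_coupling (tournament_theory k) T \<phi> \<psi>) M" by (simp only:)
  qed
  moreover have "independent_coupling (tournament_theory k) T \<phi> \<psi> \<in> extensional (model_classes (union_theory (tournament_theory k) T))"
    by (simp add: independent_coupling_def)
  ultimately show ?thesis unfolding Hom_plus_iff by blast
qed

text \<open>In the empty language every bare set is a model, and joining it to a tournament changes
  no density. So random tournaments on the sets \<open>{..<n}\<close> are obtained as a special case
  of \<open>ex_random_tournaments\<close>.\<close>

lemma Hom_plus_tournamon:
  assumes k: "1 \<le> k" and \<phi>: "uniform_tournamon k \<phi>"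
  shows "\<phi> \<in> Hom_plus (tournament_theory k)"
proof -
  define T :: "unit univ_theory" where "T = \<lparr>preds = {}, arity = (\<lambda>_. 1), axioms = {}\<rparr>"
  define N :: "nat \<Rightarrow> unit struct" where "N n = \<lparr>verts = {..<n}, rels = (\<lambda>_. {})\<rparr>" for n
  have T: "universal_theory T" by (simp add: universal_theory_def T_def)
  have vN: "verts (N n) = {..<n}" for n by (simp add: N_def)
  have Nm: "model T (N n)" for n by (simp add: model_def is_struct_def T_def N_def)
  then have Nf: "N n \<in> fin_models T" for n by (simp add: fin_models_def vN)
  have Nl: "N m \<in> labs T m" for m using Nm by (simp add: labs_def vN)
  have cN: "n \<le> card (verts (N n))" for n by (simp add: vN)
  have pbN: "pb v (N n) = N m" if "v \<in> injs m V" for v n m V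
  proof (rule struct_eqI)
    show "verts (pb v (N n)) = verts (N m)" using that by (simp add: injs_def vN)
  qed (simp add: pb_def N_def)
  obtain U where U: "\<forall>m. \<forall>U0\<in>Pow (ksets k {..<m}). \<forall>B\<in>labs T m.
    (\<lambda>n. inj_density (join (tour k {..<m} U0) B) (join (tour k (verts (N n)) (U n)) (N n)) -
      inj_density B (N n) / 2 ^ card (ksets k {..<m})) \<longlonglongrightarrow> 0"
    using ex_random_tournaments[of k T N, OF k T Nf cN] by blast
  let ?G = "\<lambda>n. tour k (verts (N n)) (U n)"
  have "conv_seq (tournament_theory k) \<phi> ?G"
    unfolding conv_seq_def
  proof (intro conjI allI ballI)
    fix n
    show "?G n \<in> fin_models (tournament_theory k)" using model_tour[OF k] by (simp add: fin_models_def vN)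
  next
    show "strict_mono (\<lambda>n. card (verts (?G n)))" by (simp add: vN strict_mono_def)
  next
    fix m M assume "M \<in> labs (tournament_theory k) m"
    then obtain U0 where U0: "U0 \<in> Pow (ksets k {..<m})" "M = tour k {..<m} U0"
      unfolding labs_tournament[OF k] by blast
    have eq: "inj_density (join (tour k {..<m} U0) (N m)) (join (?G n) (N n)) = inj_density M (?G n)" for n
    proof -
      have "{v \<in> {v \<in> injs m (verts (N n)). pb v (N n) = N m}. pbU k v (U n) = U0} =
          {v \<in> injs m (verts (N n)). pb v (?G n) = M}"
      proof (intro equalityI subsetI)
        fix v assume "v \<in> {v \<in> {v \<in> injs m (verts (N n)). pb v (N n) = N m}. pbU k v (U n) = U0}"
        then have "v \<in> injs m (verts (N n))" "pbU k v (U n) = U0" by blast+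
        then show "v \<in> {v \<in> injs m (verts (N n)). pb v (?G n) = M}"
          using pb_tour[of v m "verts (N n)" k "U n"] U0(2) by simp
      next
        fix v assume "v \<in> {v \<in> injs m (verts (N n)). pb v (?G n) = M}"
        then have v: "v \<in> injs m (verts (N n))" "pb v (?G n) = M" by blast+
        then have "tour k {..<m} (pbU k v (U n)) = tour k {..<m} U0" using pb_tour[OF v(1)] U0(2) by simp
        then have "pbU k v (U n) = U0"
          by (rule tour_inj[OF _ pbU_subset[OF v(1)] PowD[OF U0(1)] k])
        then show "v \<in> {v \<in> {v \<in> injs m (verts (N n)). pb v (N n) = N m}. pbU k v (U n) = U0}"
          using v(1) pbN[OF v(1), of n] by simp
      qed
      moreover have "inj_density (join (tour k {..<m} U0) (N m)) (join (?G n) (N n)) =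
        real (card {v \<in> {v \<in> injs m (verts (N n)). pb v (N n) = N m}. pbU k v (U n) = U0}) / real (card (injs m (verts (N n))))"
        using U0(1) k vN by (intro inj_density_join_tour) auto
      moreover have "inj_density M (?G n) = real (card {v \<in> injs m (verts (N n)). pb v (?G n) = M}) / real (card (injs m (verts (N n))))"
        by (simp add: inj_density_def U0(2))
      ultimately show ?thesis by (simp only:)
    qed
    have "\<forall>\<^sub>F n in sequentially. inj_density (N m) (N n) / 2 ^ card (ksets k {..<m}) = 1 / 2 ^ card (ksets k {..<m})"
      using eventually_ge_at_top[of m]
    proof eventually_elim
      case (elim n)
      have "{v \<in> injs m (verts (N n)). pb v (N n) = N m} = injs m (verts (N n))"
        using pbN[of _ m "verts (N n)" n] by (intro equalityI subsetI) simp_all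
      moreover have "0 < card (injs m (verts (N n)))" using elim by (intro card_injs_pos) (simp_all add: vN)
      ultimately have "inj_density (N m) (N n) = 1" by (simp add: inj_density_labs[OF Nl])
      then show ?case by simp
    qed
    then have lim: "(\<lambda>n. inj_density (N m) (N n) / 2 ^ card (ksets k {..<m})) \<longlonglongrightarrow> 1 / 2 ^ card (ksets k {..<m})"
      by (rule tendsto_eventually)
    have "(\<lambda>n. inj_density M (?G n) - inj_density (N m) (N n) / 2 ^ card (ksets k {..<m})) \<longlonglongrightarrow> 0"
      using U[rule_format, OF U0(1) Nl] unfolding eq .
    from tendsto_add[OF this lim] have "(\<lambda>n. inj_density M (?G n)) \<longlonglongrightarrow> 1 / 2 ^ card (ksets k {..<m})" by simp
    then show "(\<lambda>n. inj_density M (?G n)) \<longlonglongrightarrow> labelled \<phi> M"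
      using \<phi> U0 by (simp add: uniform_tournamon_def)
  qed
  then show ?thesis using \<phi> unfolding Hom_plus_iff uniform_tournamon_def by blast
qed

section \<open>Cut norms of random tournaments\<close>

definition sg :: "nat set set \<Rightarrow> nat list \<Rightarrow> real" where
  "sg U u = (if set u \<in> U \<longleftrightarrow> lsgn u = 1 then 1 else -1)"

definition del :: "nat \<Rightarrow> nat list \<Rightarrow> nat list" where
  "del i u = take i u @ drop (Suc i) u"

text \<open>In \<open>cut_sum\<close>, the \<open>i\<close>-th factor is a \<open>{0, 1}\<close>-valued function not depending on the \<open>i\<close>-th entry.\<close>

definition fams :: "nat \<Rightarrow> nat \<Rightarrow> (nat \<Rightarrow> nat list set) set" where
  "fams k n = (\<Pi>\<^sub>E i\<in>{..<k}. Pow {xs. set xs \<subseteq> {..<n} \<and> length xs = k - 1})"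

definition cut_sum :: "nat \<Rightarrow> nat \<Rightarrow> nat set set \<Rightarrow> (nat \<Rightarrow> nat list set) \<Rightarrow> real" where
  "cut_sum k n U F = (\<Sum>u\<in>injs k {..<n}. sg U u * of_bool (\<forall>i<k. del i u \<in> F i))"

definition cut :: "nat \<Rightarrow> nat \<Rightarrow> nat set set \<Rightarrow> real" where
  "cut k n U = Max ((\<lambda>F. \<bar>cut_sum k n U F\<bar>) ` fams k n)"

lemma fams_finite: "finite (fams k n)" and fams_nonempty: "fams k n \<noteq> {}"
  and card_fams: "card (fams k n) = (2 ^ n ^ (k - 1)) ^ k"
proof -
  have fin: "finite {xs. set xs \<subseteq> {..<n} \<and> length xs = k - 1}"
    by (rule finite_lists_length_eq) simp
  then show "finite (fams k n)" unfolding fams_def by (intro finite_PiE) simp_all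
  show "fams k n \<noteq> {}" unfolding fams_def PiE_eq_empty_iff Pow_not_empty by blast
  have "card {xs. set xs \<subseteq> {..<n} \<and> length xs = k - 1} = n ^ (k - 1)"
    using card_lists_length_eq[of "{..<n}" "k - 1"] by simp
  then show "card (fams k n) = (2 ^ n ^ (k - 1)) ^ k"
    unfolding fams_def using fin by (simp add: card_PiE card_Pow)
qed

lemma cut_nonneg: "0 \<le> cut k n U"
proof -
  obtain F where "F \<in> fams k n" using fams_nonempty[of k n] by blast
  then have "\<bar>cut_sum k n U F\<bar> \<le> cut k n U" unfolding cut_def using fams_finite[of k n] by (intro Max_ge) simp_all
  then show ?thesis by (meson abs_ge_zero order_trans)
qed

text \<open>The assumption says that, among injections, C i depends on u only through
  \<open>del i u\<close>. It is therefore membership of \<open>del i u\<close> in a set, namely the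
  image of the tuples satisfying it.\<close>

lemma cut_bound:
  assumes "\<And>i u u'. i < k \<Longrightarrow> u \<in> injs k {..<n} \<Longrightarrow> u' \<in> injs k {..<n} \<Longrightarrow> del i u = del i u' \<Longrightarrow> C i u \<Longrightarrow> C i u'"
  shows "\<bar>\<Sum>u\<in>injs k {..<n}. sg U u * of_bool (\<forall>i<k. C i u)\<bar> \<le> cut k n U"
proof -
  define F where "F = (\<lambda>i\<in>{..<k}. del i ` {u \<in> injs k {..<n}. C i u})"
  have "del i u \<in> {xs. set xs \<subseteq> {..<n} \<and> length xs = k - 1}" if "i < k" "u \<in> injs k {..<n}" for i u
  proof -
    have u: "length u = k" "set u \<subseteq> {..<n}" using that by (simp_all add: injs_def)
    have "set (take i u) \<subseteq> set u" "set (drop (Suc i) u) \<subseteq> set u" by (rule set_take_subset set_drop_subset)+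
    then have "set (del i u) \<subseteq> {..<n}" using u(2) unfolding del_def set_append by blast
    moreover have "length (del i u) = k - 1" using that(1) u(1) by (simp add: del_def)
    ultimately show ?thesis by blast
  qed
  then have "F \<in> fams k n" unfolding F_def fams_def by (intro restrict_PiE_iff[THEN iffD2]) blast
  then have "\<bar>cut_sum k n U F\<bar> \<le> cut k n U" unfolding cut_def using fams_finite[of k n] by (intro Max_ge) simp_all
  moreover have "(\<forall>i<k. del i u \<in> F i) \<longleftrightarrow> (\<forall>i<k. C i u)" if u: "u \<in> injs k {..<n}" for u
  proof -
    have "del i u \<in> F i \<longleftrightarrow> C i u" if "i < k" for i
    proof
      assume "del i u \<in> F i"
      then have "del i u \<in> del i ` {u \<in> injs k {..<n}. C i u}" using \<open>i < k\<close> unfolding F_def by simp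
      then obtain u' where "u' \<in> injs k {..<n}" "C i u'" "del i u = del i u'"
        by blast
      then show "C i u" using assms[OF that, of u' u] u by simp
    next
      assume "C i u"
      then show "del i u \<in> F i" using that u unfolding F_def by simp
    qed
    then show ?thesis by simp
  qed
  then have "cut_sum k n U F = (\<Sum>u\<in>injs k {..<n}. sg U u * of_bool (\<forall>i<k. C i u))"
    unfolding cut_sum_def by (intro sum.cong refl) simp
  ultimately show ?thesis by simp
qed

text \<open>A weak form of cosh x \<le> exp (x^2 / 2), which has the right order and follows from
  quadratic bounds of exp on [-1, 1].\<close>

lemma exp_add_exp_minus_le:
  fixes x :: real
  assumes "\<bar>x\<bar> \<le> 1"
  shows "exp x + exp (- x) \<le> 2 * exp (x\<^sup>2)"
proof -
  have pos: "exp y + exp (- y) \<le> 2 * exp (y\<^sup>2)" if "0 \<le> y" "y \<le> 1" for y :: real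
  proof -
    have "exp y \<le> 1 + y + y\<^sup>2" using that by (rule exp_bound)
    moreover have "exp (- y) \<le> 1 - y + y\<^sup>2"
    proof -
      have "exp (- y) = 1 / exp y" by (simp add: exp_minus inverse_eq_divide)
      also have "\<dots> \<le> 1 / (1 + y)" using that exp_ge_add_one_self[of y] by (intro divide_left_mono mult_pos_pos) auto
      also have "\<dots> \<le> 1 - y + y\<^sup>2"
      proof -
        have "(1 - y + y\<^sup>2) * (1 + y) = 1 + y ^ 3" by (simp add: algebra_simps power2_eq_square power3_eq_cube)
        then have "1 \<le> (1 - y + y\<^sup>2) * (1 + y)" using that by simp
        then show ?thesis using that by (simp add: pos_divide_le_eq)
      qed
      finally show ?thesis .
    qed
    moreover have "1 + y\<^sup>2 \<le> exp (y\<^sup>2)" by (rule exp_ge_add_one_self)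
    ultimately show ?thesis by linarith
  qed
  show ?thesis
  proof (cases "0 \<le> x")
    case True
    then show ?thesis using pos[of x] assms by simp
  next
    case False
    then show ?thesis using pos[of "- x"] assms by (simp add: add.commute)
  qed
qed

text \<open>The moment generating function of a sum of independent fair signs factorises; here this
  is the expansion of a product over the subsets of Q.\<close>

lemma exp_moment_le:
  fixes c :: "'a \<Rightarrow> real"
  assumes "finite Q" "\<And>A. A \<in> Q \<Longrightarrow> \<bar>c A\<bar> \<le> b" "b \<le> 1"
  shows "(\<Sum>U\<in>Pow Q. exp (\<Sum>A\<in>Q. (if A \<in> U then 1 else -1) * c A)) \<le> 2 ^ card Q * exp (b\<^sup>2 * real (card Q))"
proof -
  have "exp (\<Sum>A\<in>Q. (if A \<in> U then 1 else -1) * c A) = (\<Prod>A\<in>U. exp (c A)) * (\<Prod>A\<in>Q - U. exp (- c A))"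
    if "U \<in> Pow Q" for U
  proof -
    have U: "U \<subseteq> Q" "finite U" using that assms(1) finite_subset by auto
    have "(\<Sum>A\<in>Q. (if A \<in> U then 1 else -1) * c A) =
        (\<Sum>A\<in>Q - U. (if A \<in> U then 1 else -1) * c A) + (\<Sum>A\<in>U. (if A \<in> U then 1 else -1) * c A)"
      using U(1) assms(1) by (rule sum.subset_diff)
    also have "(\<Sum>A\<in>Q - U. (if A \<in> U then 1 else -1) * c A) = (\<Sum>A\<in>Q - U. - c A)"
      by (intro sum.cong refl) simp
    also have "(\<Sum>A\<in>U. (if A \<in> U then 1 else -1) * c A) = (\<Sum>A\<in>U. c A)"
      by (intro sum.cong refl) simp
    finally show ?thesis using U(2) assms(1) by (simp only: exp_add exp_sum finite_Diff mult.commute)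
  qed
  then have "(\<Sum>U\<in>Pow Q. exp (\<Sum>A\<in>Q. (if A \<in> U then 1 else -1) * c A)) =
      (\<Sum>U\<in>Pow Q. (\<Prod>A\<in>U. exp (c A)) * (\<Prod>A\<in>Q - U. exp (- c A)))"
    by (intro sum.cong refl)
  also have "\<dots> = (\<Prod>A\<in>Q. exp (c A) + exp (- c A))"
    by (rule prod_add[OF assms(1), symmetric])
  also have "\<dots> \<le> (\<Prod>A\<in>Q. 2 * exp (b\<^sup>2))"
  proof (rule prod_mono, intro conjI)
    fix A assume A: "A \<in> Q"
    have "\<bar>c A\<bar> \<le> b" by (rule assms(2)[OF A])
    then have "exp (c A) + exp (- c A) \<le> 2 * exp ((c A)\<^sup>2)" using assms(3) by (intro exp_add_exp_minus_le) linarith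
    moreover have "(c A)\<^sup>2 \<le> b\<^sup>2" using \<open>\<bar>c A\<bar> \<le> b\<close> by (rule power2_le_iff_abs_le[THEN iffD2, rotated]) (use \<open>\<bar>c A\<bar> \<le> b\<close> in linarith)
    then have "2 * exp ((c A)\<^sup>2) \<le> 2 * exp (b\<^sup>2)" by simp
    ultimately show "exp (c A) + exp (- c A) \<le> 2 * exp (b\<^sup>2)" by linarith
    show "0 \<le> exp (c A) + exp (- c A)" by (intro add_nonneg_nonneg) simp_all
  qed
  also have "\<dots> = 2 ^ card Q * exp (b\<^sup>2 * real (card Q))"
    by (simp add: power_mult_distrib exp_of_nat_mult[symmetric] mult.commute)
  finally show ?thesis .
qed

lemma card_injs_with_set:
  assumes "A \<in> ksets k {..<n}"
  shows "card {u \<in> injs k {..<n}. set u = A} = fact k"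
proof -
  have A: "A \<subseteq> {..<n}" "card A = k" using assms by (simp_all add: ksets_def)
  then have "finite A" using finite_subset by blast
  then show ?thesis using injs_set_eq[OF A(2), of "{..<n}"] A by simp
qed

text \<open>The k! orderings of a k-set share one random sign. Grouping tuples by their sets leaves
  independent signs with bounded coefficients, to which \<open>exp_moment_le\<close>
  applies.\<close>

lemma cut_sum_eq:
  "\<exists>c :: nat set \<Rightarrow> real. (\<forall>A\<in>ksets k {..<n}. \<bar>c A\<bar> \<le> fact k) \<and>
    (\<forall>U. cut_sum k n U F = (\<Sum>A\<in>ksets k {..<n}. (if A \<in> U then 1 else -1) * c A))"
proof -
  define t :: "nat list \<Rightarrow> real" where
    "t u = (if lsgn u = 1 then 1 else -1) * of_bool (\<forall>i<k. del i u \<in> F i)" for u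
  define c :: "nat set \<Rightarrow> real" where "c A = (\<Sum>u\<in>{u \<in> injs k {..<n}. set u = A}. t u)" for A
  have t1: "\<bar>t u\<bar> \<le> 1" for u by (simp add: t_def)
  have "\<bar>c A\<bar> \<le> fact k" if "A \<in> ksets k {..<n}" for A
  proof -
    have "\<bar>c A\<bar> \<le> (\<Sum>u\<in>{u \<in> injs k {..<n}. set u = A}. \<bar>t u\<bar>)" unfolding c_def by (rule sum_abs)
    also have "\<dots> \<le> (\<Sum>u\<in>{u \<in> injs k {..<n}. set u = A}. 1)" by (rule sum_mono) (rule t1)
    also have "\<dots> = fact k" using card_injs_with_set[OF that] by simp
    finally show ?thesis .
  qed
  moreover have "cut_sum k n U F = (\<Sum>A\<in>ksets k {..<n}. (if A \<in> U then 1 else -1) * c A)" for U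
  proof -
    have "cut_sum k n U F = (\<Sum>u\<in>injs k {..<n}. (if set u \<in> U then 1 else -1) * t u)"
      unfolding cut_sum_def by (intro sum.cong refl) (simp add: sg_def t_def)
    also have "\<dots> = (\<Sum>A\<in>ksets k {..<n}. \<Sum>u\<in>{u \<in> injs k {..<n}. set u = A}. (if set u \<in> U then 1 else -1) * t u)"
    proof (rule sum.group[symmetric])
      show "set ` injs k {..<n} \<subseteq> ksets k {..<n}"
        by (rule image_subsetI) (simp add: injs_def ksets_def distinct_card)
    qed (simp_all add: finite_ksets)
    also have "\<dots> = (\<Sum>A\<in>ksets k {..<n}. (if A \<in> U then 1 else -1) * c A)"
      unfolding c_def sum_distrib_left by (intro sum.cong refl) simp
    finally show ?thesis .
  qed
  ultimately show ?thesis by blast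
qed

lemma card_ksets_le: "card (ksets k {..<n}) \<le> n ^ k"
proof -
  have "card (ksets k {..<n}) = n choose k" unfolding ksets_def using n_subsets[of "{..<n}" k] by simp
  then show ?thesis by (cases "k \<le> n") (simp_all add: binomial_le_pow binomial_eq_0)
qed

text \<open>Union bound over \<open>fams k n\<close>, whose logarithm is of order \<open>n ^ (k - 1)\<close>, against exponential
  moments at \<open>1 / sqrt n\<close>, whose logarithm is of order \<open>n ^ k / n\<close>.\<close>

lemma sum_cut_le:
  assumes k: "1 \<le> k" and n: "(fact k)\<^sup>2 \<le> n"
  shows "(\<Sum>U\<in>Pow (ksets k {..<n}). cut k n U) \<le>
    2 ^ card (ksets k {..<n}) * ((1 + real k + (fact k)\<^sup>2) * real n ^ k / sqrt (real n))"
proof -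
  let ?Q = "ksets k {..<n}"
  define r where "r = 1 / sqrt (real n)"
  define E where "E = exp ((r * fact k)\<^sup>2 * real n ^ k)"
  have finQ: "finite ?Q" by (simp add: finite_ksets)
  have n1: "1 \<le> n" using n by (metis fact_ge_1 le_trans one_le_power)
  have r0: "0 < r" using n1 by (simp add: r_def)
  \<comment> \<open>The scaled coefficients are bounded by \<open>r * fact k\<close>; the hypothesis
    on n is what keeps them within [-1, 1].\<close>
  have "(fact k)\<^sup>2 \<le> real n" using n by (metis of_nat_fact of_nat_le_iff of_nat_power)
  then have "fact k \<le> sqrt (real n)" by (rule real_le_rsqrt)
  then have rk: "r * fact k \<le> 1" using n1 by (simp add: r_def)
  have mom: "(\<Sum>U\<in>Pow ?Q. exp (s * r * cut_sum k n U F)) \<le> 2 ^ card ?Q * E" if s: "s = 1 \<or> s = -1" for s :: real and F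
  proof -
    obtain c where c: "\<And>A. A \<in> ?Q \<Longrightarrow> \<bar>c A\<bar> \<le> fact k"
      "\<And>U. cut_sum k n U F = (\<Sum>A\<in>?Q. (if A \<in> U then 1 else -1) * c A)"
      using cut_sum_eq[of k n F] by blast
    have "s * r * cut_sum k n U F = (\<Sum>A\<in>?Q. (if A \<in> U then 1 else -1) * (s * r * c A))" for U
      unfolding c(2) sum_distrib_left by (intro sum.cong refl) simp
    then have "(\<Sum>U\<in>Pow ?Q. exp (s * r * cut_sum k n U F)) =
        (\<Sum>U\<in>Pow ?Q. exp (\<Sum>A\<in>?Q. (if A \<in> U then 1 else -1) * (s * r * c A)))" by simp
    also have "\<dots> \<le> 2 ^ card ?Q * exp ((r * fact k)\<^sup>2 * real (card ?Q))"
    proof (rule exp_moment_le[OF finQ _ rk])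
      fix A assume "A \<in> ?Q"
      then have "r * \<bar>c A\<bar> \<le> r * fact k" using c(1) r0 by (intro mult_left_mono) simp_all
      moreover have "\<bar>s * r * c A\<bar> = r * \<bar>c A\<bar>" using s r0 by (auto simp: abs_mult)
      ultimately show "\<bar>s * r * c A\<bar> \<le> r * fact k" by simp
    qed
    also have "\<dots> \<le> 2 ^ card ?Q * E"
    proof -
      have "real (card ?Q) \<le> real n ^ k" using card_ksets_le[of k n] by (metis of_nat_le_iff of_nat_power)
      then show ?thesis unfolding E_def by (simp add: mult_left_mono)
    qed
    finally show ?thesis .
  qed
  have expcut: "exp (r * cut k n U) \<le> (\<Sum>F\<in>fams k n. exp (1 * r * cut_sum k n U F) + exp ((-1) * r * cut_sum k n U F))" for U
  proof -
    have "cut k n U \<in> (\<lambda>F. \<bar>cut_sum k n U F\<bar>) ` fams k n"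
      unfolding cut_def using fams_finite fams_nonempty by (intro Max_in) simp_all
    then obtain F where F: "F \<in> fams k n" "cut k n U = \<bar>cut_sum k n U F\<bar>" by blast
    have "exp (r * cut k n U) \<le> exp (1 * r * cut_sum k n U F) + exp ((-1) * r * cut_sum k n U F)"
      unfolding F(2) by (simp add: abs_if)
    also have "\<dots> \<le> (\<Sum>F\<in>fams k n. exp (1 * r * cut_sum k n U F) + exp ((-1) * r * cut_sum k n U F))"
      using F(1) fams_finite
      by (intro member_le_sum[of F "fams k n" "\<lambda>F. exp (1 * r * cut_sum k n U F) + exp ((-1) * r * cut_sum k n U F)"])
        (simp_all add: add_nonneg_nonneg)
    finally show ?thesis .
  qed
  \<comment> \<open>One moment bound for each choice of factors and each of the two signs hidden in
    the absolute value.\<close>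
  define b where "b = 2 * real (card (fams k n)) * E"
  have cpos: "0 < real (card (fams k n))" using fams_finite fams_nonempty by (simp add: card_gt_0_iff)
  have b0: "0 < b" unfolding b_def using cpos by (simp add: E_def)
  have "(\<Sum>U\<in>Pow ?Q. exp (r * cut k n U)) \<le>
      (\<Sum>U\<in>Pow ?Q. \<Sum>F\<in>fams k n. exp (1 * r * cut_sum k n U F) + exp ((-1) * r * cut_sum k n U F))"
    by (rule sum_mono) (rule expcut)
  also have "\<dots> = (\<Sum>F\<in>fams k n. (\<Sum>U\<in>Pow ?Q. exp (1 * r * cut_sum k n U F)) + (\<Sum>U\<in>Pow ?Q. exp ((-1) * r * cut_sum k n U F)))"
    unfolding sum.distrib[symmetric] by (rule sum.swap)
  also have "\<dots> \<le> (\<Sum>F\<in>fams k n. 2 ^ card ?Q * E + 2 ^ card ?Q * E)"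
    by (intro sum_mono add_mono mom) simp_all
  also have "\<dots> = 2 ^ card ?Q * b" by (simp add: b_def)
  finally have bound: "(\<Sum>U\<in>Pow ?Q. exp (r * cut k n U)) \<le> 2 ^ card ?Q * b" .
  \<comment> \<open>The inequality 1 + x \<le> exp x at x = r cut - ln b turns the exponential
    moment into a bound for the mean, replacing Jensen's inequality.\<close>
  have "(\<Sum>U\<in>Pow ?Q. 1 + (r * cut k n U - ln b)) \<le> (\<Sum>U\<in>Pow ?Q. exp (r * cut k n U) / b)"
  proof (rule sum_mono)
    fix U
    have "1 + (r * cut k n U - ln b) \<le> exp (r * cut k n U - ln b)" by (rule exp_ge_add_one_self)
    then show "1 + (r * cut k n U - ln b) \<le> exp (r * cut k n U) / b" using b0 by (simp add: exp_diff)
  qed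
  also have "\<dots> \<le> 2 ^ card ?Q"
    using bound b0 by (simp add: sum_divide_distrib[symmetric] pos_divide_le_eq)
  finally have "r * (\<Sum>U\<in>Pow ?Q. cut k n U) \<le> 2 ^ card ?Q * ln b"
    using finQ by (simp add: sum.distrib sum_subtractf card_Pow sum_distrib_left[symmetric])
  also have "\<dots> \<le> 2 ^ card ?Q * ((1 + real k + (fact k)\<^sup>2) * real n ^ (k - 1))"
  proof (rule mult_left_mono)
    have nk: "real n ^ k = real n * real n ^ (k - 1)" using k by (cases k) simp_all
    have "ln b = ln 2 + ln (real (card (fams k n))) + (r * fact k)\<^sup>2 * real n ^ k"
      unfolding b_def using cpos by (simp add: ln_mult E_def)
    also have "ln (real (card (fams k n))) = real k * (real n ^ (k - 1) * ln 2)"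
      unfolding card_fams by (simp add: ln_realpow)
    also have "(r * fact k)\<^sup>2 * real n ^ k = (fact k)\<^sup>2 * real n ^ (k - 1)"
      unfolding nk r_def using n1 by (simp add: power_mult_distrib power_divide)
    also have "ln 2 + real k * (real n ^ (k - 1) * ln 2) + (fact k)\<^sup>2 * real n ^ (k - 1) \<le>
        1 * real n ^ (k - 1) + real k * (real n ^ (k - 1) * 1) + (fact k)\<^sup>2 * real n ^ (k - 1)"
    proof -
      have l2: "ln 2 \<le> (1::real)" using ln_2_less_1 by simp
      have "1 \<le> real n ^ (k - 1)" using n1 by (intro one_le_power) simp
      then have "ln 2 \<le> 1 * real n ^ (k - 1)" using l2 by linarith
      moreover have "real k * (real n ^ (k - 1) * ln 2) \<le> real k * (real n ^ (k - 1) * 1)"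
        using l2 by (intro mult_left_mono) simp_all
      ultimately show ?thesis by linarith
    qed
    finally show "ln b \<le> (1 + real k + (fact k)\<^sup>2) * real n ^ (k - 1)" by (simp add: algebra_simps)
  qed simp
  finally have "r * (\<Sum>U\<in>Pow ?Q. cut k n U) \<le> 2 ^ card ?Q * ((1 + real k + (fact k)\<^sup>2) * real n ^ (k - 1))" .
  then have "(\<Sum>U\<in>Pow ?Q. cut k n U) \<le> sqrt (real n) * (2 ^ card ?Q * ((1 + real k + (fact k)\<^sup>2) * real n ^ (k - 1)))"
    using n1 by (simp add: r_def pos_divide_le_eq mult.commute)
  also have "\<dots> = 2 ^ card ?Q * ((1 + real k + (fact k)\<^sup>2) * (sqrt (real n) * real n ^ (k - 1)))" by simp
  also have "sqrt (real n) * real n ^ (k - 1) = real n ^ k / sqrt (real n)"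
  proof -
    have "real n = sqrt (real n) * sqrt (real n)" by simp
    moreover have "real n ^ k = real n * real n ^ (k - 1)" using k by (cases k) simp_all
    ultimately have "real n ^ k = sqrt (real n) * (sqrt (real n) * real n ^ (k - 1))" by (metis mult.assoc)
    then show ?thesis using n1 by simp
  qed
  finally show ?thesis by simp
qed

section \<open>Sampling from coordinates of bounded rank\<close>

definition low :: "nat \<Rightarrow> nat set \<Rightarrow> nat set set" where
  "low l V = {B \<in> fin_subsets V. card B \<le> l}"

text \<open>The counterpart of \<open>pull\<close> when only coordinates at sets of size at most l
  are retained.\<close>

definition lpull :: "nat \<Rightarrow> nat list \<Rightarrow> (nat set \<Rightarrow> 'a) \<Rightarrow> nat set \<Rightarrow> 'a" where
  "lpull l v \<theta> = (\<lambda>B\<in>low l {..<length v}. \<theta> ((!) v ` B))"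

definition samp :: "'p univ_theory \<Rightarrow> nat \<Rightarrow> ('p \<Rightarrow> (nat set \<Rightarrow> 'a) set) \<Rightarrow> nat \<Rightarrow> (nat set \<Rightarrow> 'a) \<Rightarrow> 'p struct" where
  "samp T l H m \<theta> = \<lparr>verts = {..<m}, rels = (\<lambda>P. if P \<in> preds T
     then {\<alpha>. length \<alpha> = arity T P \<and> distinct \<alpha> \<and> set \<alpha> \<subseteq> {..<m} \<and> lpull l \<alpha> \<theta> \<in> H P} else {})\<rparr>"

lemma verts_samp [simp]: "verts (samp T l H m \<theta>) = {..<m}"
  by (simp add: samp_def)

lemma mem_rels_samp: "\<alpha> \<in> rels (samp T l H m \<theta>) P \<longleftrightarrow> P \<in> preds T \<and> length \<alpha> = arity T P \<and>
    distinct \<alpha> \<and> set \<alpha> \<subseteq> {..<m} \<and> lpull l \<alpha> \<theta> \<in> H P"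
  by (simp add: samp_def)

lemma finite_low: "finite V \<Longrightarrow> finite (low l V)"
  unfolding low_def fin_subsets_def by (rule finite_subset[of _ "Pow V"]) auto

lemma low_image:
  assumes "v \<in> injs m V"
  shows "inj_on ((`) ((!) v)) (low l {..<m})" "(`) ((!) v) \<in> low l {..<m} \<rightarrow> low l V"
proof -
  have v: "length v = m" "distinct v" "set v \<subseteq> V" using assms by (simp_all add: injs_def)
  have inj: "inj_on ((!) v) {..<m}" using v by (intro inj_on_nth) auto
  then have "inj_on ((`) ((!) v)) (Pow {..<m})" by (rule inj_on_image_Pow)
  then show "inj_on ((`) ((!) v)) (low l {..<m})"
    by (rule inj_on_subset) (auto simp: low_def fin_subsets_def)
  show "(`) ((!) v) \<in> low l {..<m} \<rightarrow> low l V"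
  proof
    fix B assume "B \<in> low l {..<m}"
    then have B: "B \<subseteq> {..<m}" "finite B" "B \<noteq> {}" "card B \<le> l" by (simp_all add: low_def fin_subsets_def)
    have "(!) v ` B \<subseteq> V" using B(1) v(1,3) by (auto simp: subset_iff)
    moreover have "card ((!) v ` B) \<le> l" using B(2,4) card_image_le le_trans by blast
    ultimately show "(!) v ` B \<in> low l V" using B by (simp add: low_def fin_subsets_def)
  qed
qed

lemma lpull_lpull:
  assumes "set \<alpha> \<subseteq> {..<length v}"
  shows "lpull l \<alpha> (lpull l v \<theta>) = lpull l (map ((!) v) \<alpha>) \<theta>"
proof (rule ext)
  fix B
  show "lpull l \<alpha> (lpull l v \<theta>) B = lpull l (map ((!) v) \<alpha>) \<theta> B"
  proof (cases "B \<in> low l {..<length \<alpha>}")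
    case True
    then have B: "B \<subseteq> {..<length \<alpha>}" "finite B" "B \<noteq> {}" "card B \<le> l" by (simp_all add: low_def fin_subsets_def)
    have "(!) \<alpha> ` B \<subseteq> {..<length v}" using B(1) assms by (auto simp: subset_iff)
    moreover have "card ((!) \<alpha> ` B) \<le> l" using B(2,4) card_image_le le_trans by blast
    ultimately have "(!) \<alpha> ` B \<in> low l {..<length v}" using B by (simp add: low_def fin_subsets_def)
    moreover have "(!) v ` (!) \<alpha> ` B = (!) (map ((!) v) \<alpha>) ` B"
      unfolding image_image using B(1) by (intro image_cong refl) auto
    ultimately show ?thesis using True by (simp add: lpull_def)
  qed (simp add: lpull_def)
qed

lemma lpull_cong:
  assumes "\<And>B. B \<in> low l (set \<alpha>) \<Longrightarrow> \<theta> B = \<theta>' B"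
  shows "lpull l \<alpha> \<theta> = lpull l \<alpha> \<theta>'"
proof (rule ext)
  fix B
  show "lpull l \<alpha> \<theta> B = lpull l \<alpha> \<theta>' B"
  proof (cases "B \<in> low l {..<length \<alpha>}")
    case True
    then have B: "B \<subseteq> {..<length \<alpha>}" "finite B" "B \<noteq> {}" "card B \<le> l" by (simp_all add: low_def fin_subsets_def)
    have "(!) \<alpha> ` B \<subseteq> set \<alpha>" using B(1) by auto
    moreover have "card ((!) \<alpha> ` B) \<le> l" using B(2,4) card_image_le le_trans by blast
    ultimately have "(!) \<alpha> ` B \<in> low l (set \<alpha>)" using B by (simp add: low_def fin_subsets_def)
    then show ?thesis using assms True by (simp add: lpull_def)
  qed (simp add: lpull_def)
qed

lemma samp_cong:
  assumes "\<And>B. B \<in> low l {..<m} \<Longrightarrow> \<theta> B = \<theta>' B"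
  shows "samp T l H m \<theta> = samp T l H m \<theta>'"
proof (rule struct_eqI)
  fix P \<alpha>
  have "lpull l \<alpha> \<theta> = lpull l \<alpha> \<theta>'" if "set \<alpha> \<subseteq> {..<m}"
    using that assms by (intro lpull_cong) (auto simp: low_def fin_subsets_def)
  then show "\<alpha> \<in> rels (samp T l H m \<theta>) P \<longleftrightarrow> \<alpha> \<in> rels (samp T l H m \<theta>') P"
    unfolding mem_rels_samp by auto
qed simp

text \<open>Relabelling a sampled structure is relabelling its coordinates. Both the invariance of
  \<open>law\<close> and the comparison of events on [n] with events on [m] rest on this.\<close>

lemma pb_samp:
  assumes "v \<in> injs m {..<n}"
  shows "pb v (samp T l H n \<theta>) = samp T l H m (lpull l v \<theta>)"
proof (rule struct_eqI)
  have v: "length v = m" "distinct v" "set v \<subseteq> {..<n}" using assms by (simp_all add: injs_def)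
  show "verts (pb v (samp T l H n \<theta>)) = verts (samp T l H m (lpull l v \<theta>))" by (simp add: v)
  fix P \<alpha>
  show "\<alpha> \<in> rels (pb v (samp T l H n \<theta>)) P \<longleftrightarrow> \<alpha> \<in> rels (samp T l H m (lpull l v \<theta>)) P"
  proof (cases "set \<alpha> \<subseteq> {..<m}")
    case True
    have inj: "inj_on ((!) v) (set \<alpha>)" using True v by (intro inj_on_nth) auto
    have "set (map ((!) v) \<alpha>) \<subseteq> {..<n}" using True v(1,3) by (auto simp: subset_iff)
    moreover have "distinct (map ((!) v) \<alpha>) \<longleftrightarrow> distinct \<alpha>" using inj by (simp add: distinct_map)
    moreover have "\<alpha> \<in> rels (pb v (samp T l H n \<theta>)) P \<longleftrightarrow> map ((!) v) \<alpha> \<in> rels (samp T l H n \<theta>) P"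
      using True v(1) by (simp add: pb_def)
    ultimately show ?thesis
      using True v(1) lpull_lpull[of \<alpha> v l \<theta>] unfolding mem_rels_samp by simp
  next
    case False
    then show ?thesis using v(1) unfolding mem_rels_samp by (simp add: pb_def)
  qed
qed

lemma iso_pb:
  assumes "is_iso f M N" "wf_struct M" "verts M = {..<m}" "verts N = {..<m}"
  shows "\<exists>v\<in>injs m {..<m}. pb v N = M"
proof -
  define v where "v = map f [0..<m]"
  have bij: "bij_betw f {..<m} {..<m}" using is_iso_bij[OF assms(1)] assms(3,4) by simp
  have v: "length v = m" "distinct v" "set v = {..<m}"
    using bij by (simp_all add: v_def distinct_map bij_betw_def atLeast0LessThan)
  have wfN: "wf_struct N" using is_iso_wf assms by blast
  have "induced N (set v) = N"
    using wfN assms(4) v(3) by (intro struct_eqI) (auto simp: induced_def wf_struct_def)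
  moreover have "is_iso ((!) v) M N"
    using is_iso_cong[OF assms(2), of "(!) v" f N] assms(1,3) by (simp add: v_def)
  ultimately have "pb v N = M"
    using is_iso_nth_iff[OF v(2) assms(2), of N] v assms(3,4) by simp
  moreover have "v \<in> injs m {..<m}" using v by (simp add: injs_def)
  ultimately show ?thesis by blast
qed

section \<open>Independent coordinates under relabelling\<close>

lemma (in prob_space) prob_space_prod: "prob_space (\<Pi>\<^sub>M B\<in>K. M)"
  by (rule prob_space_PiM) (rule prob_space_axioms)

lemma (in prob_space) lpull_measurable:
  assumes "v \<in> injs m V" "low l V \<subseteq> K"
  shows "lpull l v \<in> (\<Pi>\<^sub>M B\<in>K. M) \<rightarrow>\<^sub>M (\<Pi>\<^sub>M B\<in>low l {..<m}. M)"
proof -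
  have "length v = m" using assms by (simp add: injs_def)
  then show ?thesis
    unfolding lpull_def \<open>length v = m\<close> using low_image(2)[OF assms(1), of l] assms(2)
    by (intro measurable_restrict measurable_component_singleton) auto
qed

text \<open>Distinct sets have distinct images under v, so the pulled back coordinates are
  independent coordinates without repetition.\<close>

lemma (in prob_space) distr_lpull:
  assumes "v \<in> injs m V" "low l V \<subseteq> K"
  shows "distr (\<Pi>\<^sub>M B\<in>K. M) (\<Pi>\<^sub>M B\<in>low l {..<m}. M) (lpull l v) = (\<Pi>\<^sub>M B\<in>low l {..<m}. M)"
proof -
  have "length v = m" using assms by (simp add: injs_def)
  then have eq: "lpull l v = (\<lambda>\<omega>. \<lambda>B\<in>low l {..<m}. \<omega> ((!) v ` B))" by (intro ext) (simp add: lpull_def)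
  have "(`) ((!) v) \<in> low l {..<m} \<rightarrow> K" using low_image(2)[OF assms(1), of l] assms(2) by blast
  then show ?thesis
    unfolding eq by (rule distr_PiM_reindex[OF prob_space_axioms low_image(1)[OF assms(1), of l]])
qed

lemma (in prob_space) measure_lpull:
  assumes "v \<in> injs m V" "low l V \<subseteq> K" "S \<in> sets (\<Pi>\<^sub>M B\<in>low l {..<m}. M)"
  shows "measure (\<Pi>\<^sub>M B\<in>K. M) {\<theta> \<in> space (\<Pi>\<^sub>M B\<in>K. M). lpull l v \<theta> \<in> S} = measure (\<Pi>\<^sub>M B\<in>low l {..<m}. M) S"
proof -
  have "measure (\<Pi>\<^sub>M B\<in>low l {..<m}. M) S = measure (distr (\<Pi>\<^sub>M B\<in>K. M) (\<Pi>\<^sub>M B\<in>low l {..<m}. M) (lpull l v)) S"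
    by (simp only: distr_lpull[OF assms(1,2)])
  also have "\<dots> = measure (\<Pi>\<^sub>M B\<in>K. M) (lpull l v -` S \<inter> space (\<Pi>\<^sub>M B\<in>K. M))"
    by (rule measure_distr[OF lpull_measurable[OF assms(1,2)] assms(3)])
  also have "lpull l v -` S \<inter> space (\<Pi>\<^sub>M B\<in>K. M) = {\<theta> \<in> space (\<Pi>\<^sub>M B\<in>K. M). lpull l v \<theta> \<in> S}" by blast
  finally show ?thesis by simp
qed

text \<open>The sets H replace the peons of a theon of bounded rank. They are measurable for the
  product measure itself, not only for its completion, so that Fubini and pullbacks apply
  directly.\<close>

locale sampler = prob_space \<Omega> for \<Omega> :: "'a measure" +
  fixes T :: "'p univ_theory" and l :: nat and H :: "'p \<Rightarrow> (nat set \<Rightarrow> 'a) set"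
  assumes T: "universal_theory T"
    and H: "P \<in> preds T \<Longrightarrow> H P \<in> sets (\<Pi>\<^sub>M B\<in>low l {..<arity T P}. \<Omega>)"
begin

definition law :: "nat \<Rightarrow> 'p struct \<Rightarrow> real" where
  "law m M = measure (\<Pi>\<^sub>M B\<in>low l {..<m}. \<Omega>) {\<theta> \<in> space (\<Pi>\<^sub>M B\<in>low l {..<m}. \<Omega>). samp T l H m \<theta> = M}"

text \<open>If M could not be a sample for formal reasons, the event is empty. Otherwise it is a
  finite Boolean combination of the conditions
  \<open>lpull l \<alpha> \<theta> \<in> H P\<close>.\<close>

lemma sets_samp_eq: "{\<theta> \<in> space (\<Pi>\<^sub>M B\<in>low l {..<m}. \<Omega>). samp T l H m \<theta> = M} \<in> sets (\<Pi>\<^sub>M B\<in>low l {..<m}. \<Omega>)"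
    (is "?S \<in> sets ?P")
proof (cases "verts M = {..<m} \<and> (\<forall>P \<alpha>. \<alpha> \<in> rels M P \<longrightarrow> P \<in> preds T \<and> \<alpha> \<in> injs (arity T P) {..<m})")
  case True
  have "samp T l H m \<theta> = M \<longleftrightarrow>
      (\<forall>P\<in>preds T. \<forall>\<alpha>\<in>injs (arity T P) {..<m}. lpull l \<alpha> \<theta> \<in> H P \<longleftrightarrow> \<alpha> \<in> rels M P)" for \<theta>
  proof
    assume "samp T l H m \<theta> = M"
    then have "\<alpha> \<in> rels (samp T l H m \<theta>) P \<longleftrightarrow> \<alpha> \<in> rels M P" for \<alpha> P by simp
    then show "\<forall>P\<in>preds T. \<forall>\<alpha>\<in>injs (arity T P) {..<m}. lpull l \<alpha> \<theta> \<in> H P \<longleftrightarrow> \<alpha> \<in> rels M P"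
      unfolding mem_rels_samp injs_def by blast
  next
    assume h: "\<forall>P\<in>preds T. \<forall>\<alpha>\<in>injs (arity T P) {..<m}. lpull l \<alpha> \<theta> \<in> H P \<longleftrightarrow> \<alpha> \<in> rels M P"
    show "samp T l H m \<theta> = M"
    proof (rule struct_eqI)
      fix P \<alpha>
      show "\<alpha> \<in> rels (samp T l H m \<theta>) P \<longleftrightarrow> \<alpha> \<in> rels M P"
      proof (cases "P \<in> preds T \<and> \<alpha> \<in> injs (arity T P) {..<m}")
        case True
        then have "lpull l \<alpha> \<theta> \<in> H P \<longleftrightarrow> \<alpha> \<in> rels M P" using h by blast
        then show ?thesis using True unfolding mem_rels_samp by (simp add: injs_def)
      next
        case False
        then have "\<alpha> \<notin> rels M P" using True by blast
        moreover have "\<alpha> \<notin> rels (samp T l H m \<theta>) P" using False unfolding mem_rels_samp by (auto simp: injs_def)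
        ultimately show ?thesis by blast
      qed
    qed (simp add: True)
  qed
  then have "?S = {\<theta> \<in> space ?P. \<forall>P\<in>preds T. \<forall>\<alpha>\<in>injs (arity T P) {..<m}. lpull l \<alpha> \<theta> \<in> H P \<longleftrightarrow> \<alpha> \<in> rels M P}"
    by simp
  also have "\<dots> \<in> sets ?P"
  proof (intro sets.sets_Collect_finite_All)
    show "finite (preds T)" using T by (simp add: universal_theory_def)
    fix P \<alpha> assume P: "P \<in> preds T" "\<alpha> \<in> injs (arity T P) {..<m}"
    have "lpull l \<alpha> -` H P \<inter> space ?P \<in> sets ?P"
      by (rule measurable_sets[OF lpull_measurable[OF P(2) order_refl] H[OF P(1)]])
    moreover have "lpull l \<alpha> -` H P \<inter> space ?P = {\<theta> \<in> space ?P. lpull l \<alpha> \<theta> \<in> H P}" by blast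
    ultimately have "{\<theta> \<in> space ?P. lpull l \<alpha> \<theta> \<in> H P} \<in> sets ?P" by simp
    then show "{\<theta> \<in> space ?P. lpull l \<alpha> \<theta> \<in> H P \<longleftrightarrow> \<alpha> \<in> rels M P} \<in> sets ?P"
      by (cases "\<alpha> \<in> rels M P") (simp_all add: sets.sets_Collect_neg)
  qed simp
  finally show ?thesis .
next
  case False
  have "samp T l H m \<theta> \<noteq> M" for \<theta>
  proof
    assume eq: "samp T l H m \<theta> = M"
    have "verts M = {..<m}" unfolding eq[symmetric] by simp
    moreover have "P \<in> preds T \<and> \<alpha> \<in> injs (arity T P) {..<m}" if "\<alpha> \<in> rels M P" for P \<alpha>
      using that unfolding eq[symmetric] mem_rels_samp injs_def by blast
    ultimately show False using False by blast
  qed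
  then have empty: "?S = {}" by blast
  show ?thesis unfolding empty by (rule sets.empty_sets)
qed

text \<open>Pulling coordinates back along v preserves their law and turns a sample M into
  \<open>pb v M\<close>. An inequality is enough, since \<open>law_iso\<close> uses it in both
  directions.\<close>

lemma law_pb_ge:
  assumes "v \<in> injs m {..<m}"
  shows "law m M \<le> law m (pb v M)"
proof -
  interpret P: prob_space "\<Pi>\<^sub>M B\<in>low l {..<m}. \<Omega>" by (rule prob_space_prod)
  let ?P = "\<Pi>\<^sub>M B\<in>low l {..<m}. \<Omega>" and ?S = "{\<theta> \<in> space (\<Pi>\<^sub>M B\<in>low l {..<m}. \<Omega>). samp T l H m \<theta> = pb v M}"
  have meas: "{\<theta> \<in> space ?P. lpull l v \<theta> \<in> ?S} \<in> sets ?P"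
  proof -
    have "lpull l v -` ?S \<inter> space ?P \<in> sets ?P"
      by (rule measurable_sets[OF lpull_measurable[OF assms order_refl] sets_samp_eq])
    moreover have "lpull l v -` ?S \<inter> space ?P = {\<theta> \<in> space ?P. lpull l v \<theta> \<in> ?S}" by blast
    ultimately show ?thesis by simp
  qed
  have "{\<theta> \<in> space ?P. samp T l H m \<theta> = M} \<subseteq> {\<theta> \<in> space ?P. lpull l v \<theta> \<in> ?S}"
  proof safe
    fix \<theta> assume "\<theta> \<in> space ?P" "M = samp T l H m \<theta>"
    then show "lpull l v \<theta> \<in> space ?P" "samp T l H m (lpull l v \<theta>) = pb v (samp T l H m \<theta>)"
      using measurable_space[OF lpull_measurable[OF assms order_refl]] pb_samp[OF assms, of T l H \<theta>] by simp_all
  qed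
  then have "law m M \<le> measure ?P {\<theta> \<in> space ?P. lpull l v \<theta> \<in> ?S}"
    unfolding law_def by (rule P.finite_measure_mono[OF _ meas])
  also have "\<dots> = law m (pb v M)"
    unfolding law_def by (rule measure_lpull[OF assms order_refl sets_samp_eq])
  finally show ?thesis .
qed

lemma law_iso:
  assumes "N \<in> iso_class M" "wf_struct M" "verts M = {..<m}" "verts N = {..<m}"
  shows "law m N = law m M"
proof -
  obtain f where f: "is_iso f M N" using assms(1) unfolding mem_iso_class by blast
  have "law m N \<le> law m M" using iso_pb[OF f assms(2-4)] law_pb_ge by blast
  moreover have "law m M \<le> law m N"
    using iso_pb[OF is_iso_inv[OF f assms(2)] is_iso_wf[OF f assms(2)] assms(4,3)] law_pb_ge by blast
  ultimately show ?thesis by simp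
qed

lemma law_iso_class:
  assumes "wf_struct M" "verts M = {..<m}"
  shows "{\<theta> \<in> space (\<Pi>\<^sub>M B\<in>low l {..<m}. \<Omega>). samp T l H m \<theta> \<in> iso_class M} \<in> sets (\<Pi>\<^sub>M B\<in>low l {..<m}. \<Omega>)"
    "real (card (Aut M)) / fact m *
      measure (\<Pi>\<^sub>M B\<in>low l {..<m}. \<Omega>) {\<theta> \<in> space (\<Pi>\<^sub>M B\<in>low l {..<m}. \<Omega>). samp T l H m \<theta> \<in> iso_class M} = law m M"
proof -
  interpret P: prob_space "\<Pi>\<^sub>M B\<in>low l {..<m}. \<Omega>" by (rule prob_space_prod)
  let ?P = "\<Pi>\<^sub>M B\<in>low l {..<m}. \<Omega>"
  let ?C = "{N \<in> iso_class M. verts N = {..<m}}"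
  have card: "card ?C * card (Aut M) = fact m" by (rule iso_class_card_labs[OF assms])
  then have "card ?C \<noteq> 0" by (metis fact_nonzero mult_zero_left)
  then have fin: "finite ?C" by (metis card.infinite)
  have eq: "{\<theta> \<in> space ?P. samp T l H m \<theta> \<in> iso_class M} = (\<Union>N\<in>?C. {\<theta> \<in> space ?P. samp T l H m \<theta> = N})"
  proof (intro equalityI subsetI)
    fix \<theta> assume "\<theta> \<in> {\<theta> \<in> space ?P. samp T l H m \<theta> \<in> iso_class M}"
    then show "\<theta> \<in> (\<Union>N\<in>?C. {\<theta> \<in> space ?P. samp T l H m \<theta> = N})" by simp
  next
    fix \<theta> assume "\<theta> \<in> (\<Union>N\<in>?C. {\<theta> \<in> space ?P. samp T l H m \<theta> = N})"
    then show "\<theta> \<in> {\<theta> \<in> space ?P. samp T l H m \<theta> \<in> iso_class M}" by auto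
  qed
  show "{\<theta> \<in> space ?P. samp T l H m \<theta> \<in> iso_class M} \<in> sets ?P"
    unfolding eq using fin sets_samp_eq by (rule sets.finite_UN)
  have "measure ?P {\<theta> \<in> space ?P. samp T l H m \<theta> \<in> iso_class M} = (\<Sum>N\<in>?C. law m N)"
    unfolding eq law_def
  proof (rule P.finite_measure_finite_Union[OF fin])
    show "(\<lambda>N. {\<theta> \<in> space ?P. samp T l H m \<theta> = N}) ` ?C \<subseteq> sets ?P" using sets_samp_eq by blast
    show "disjoint_family_on (\<lambda>N. {\<theta> \<in> space ?P. samp T l H m \<theta> = N}) ?C"
      unfolding disjoint_family_on_def by auto
  qed
  also have "\<dots> = real (card ?C) * law m M" using law_iso[OF _ assms] by simp
  finally have "real (card (Aut M)) * measure ?P {\<theta> \<in> space ?P. samp T l H m \<theta> \<in> iso_class M} =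
      real (card ?C * card (Aut M)) * law m M" by simp
  then show "real (card (Aut M)) / fact m * measure ?P {\<theta> \<in> space ?P. samp T l H m \<theta> \<in> iso_class M} = law m M"
    unfolding card by simp
qed

text \<open>The event measured by \<open>theon_limit\<close> lives in the completed space and agrees
  only almost surely with an event in the retained coordinates; completeness makes it measurable.
  The automorphism factor turns the probability of a class into that of one labelled model.\<close>

lemma labelled_theon_limit:
  assumes ae: "\<And>m. AE \<theta> in (\<Pi>\<^sub>M A\<in>fin_subsets UNIV. \<Omega>). induced (theon_struct T N \<theta>) {..<m} = samp T l H m \<theta>"
    and M: "M \<in> labs T m"
  shows "labelled (theon_limit T \<Omega> N) M = law m M"
proof -
  interpret PF: prob_space "\<Pi>\<^sub>M A\<in>fin_subsets UNIV. \<Omega>" by (rule prob_space_prod)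
  let ?F = "\<Pi>\<^sub>M A\<in>fin_subsets UNIV. \<Omega>" and ?P = "\<Pi>\<^sub>M B\<in>low l {..<m}. \<Omega>"
  have wf: "wf_struct M" and vM: "verts M = {..<m}" using labs_wf[OF M] labs_verts[OF M] .
  have up: "[0..<m] \<in> injs m UNIV" by (simp add: injs_def)
  have low_sub: "low l UNIV \<subseteq> fin_subsets UNIV" by (auto simp: low_def)
  have samp_up: "samp T l H m (lpull l [0..<m] \<theta>) = samp T l H m \<theta>" for \<theta>
  proof (rule samp_cong)
    fix B assume B: "B \<in> low l {..<m}"
    then have "B \<subseteq> {..<m}" by (simp add: low_def fin_subsets_def)
    then have "(!) [0..<m] ` B = id ` B" by (intro image_cong) auto
    then show "lpull l [0..<m] \<theta> B = \<theta> B" using B by (simp add: lpull_def)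
  qed
  define S where "S = {\<theta> \<in> space ?P. samp T l H m \<theta> \<in> iso_class M}"
  have S: "S \<in> sets ?P" unfolding S_def by (rule law_iso_class(1)[OF wf vM])
  define A where "A = {\<theta> \<in> space ?F. lpull l [0..<m] \<theta> \<in> S}"
  have A: "A \<in> sets ?F"
  proof -
    have "lpull l [0..<m] -` S \<inter> space ?F \<in> sets ?F"
      by (rule measurable_sets[OF lpull_measurable[OF up low_sub] S])
    moreover have "lpull l [0..<m] -` S \<inter> space ?F = A" unfolding A_def by blast
    ultimately show ?thesis by simp
  qed
  have A_iff: "\<theta> \<in> A \<longleftrightarrow> samp T l H m \<theta> \<in> iso_class M" if "\<theta> \<in> space ?F" for \<theta>
    using that measurable_space[OF lpull_measurable[OF up low_sub] that] by (simp add: A_def S_def samp_up)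
  have cl: "iso_class M \<in> model_classes T" using labs_fin_models[OF M] unfolding model_classes_def by blast
  have "(SOME N. N \<in> iso_class M) \<in> iso_class M" by (rule someI[of _ M]) simp
  then obtain f where "is_iso f M (SOME N. N \<in> iso_class M)" unfolding mem_iso_class by blast
  from card_verts_iso[OF this] have some: "card (verts (SOME N. N \<in> iso_class M)) = m" using vM by simp
  define A' where "A' = {\<theta> \<in> space ?F. induced (theon_struct T N \<theta>) {..<m} \<in> iso_class M}"
  have "AE \<theta> in ?F. \<theta> \<in> A \<longleftrightarrow> \<theta> \<in> A'"
    using ae[of m] AE_space
  proof eventually_elim
    case (elim \<theta>)
    then show ?case using A_iff[of \<theta>] by (simp add: A'_def)
  qed
  then have aeq: "AE \<theta> in completion ?F. \<theta> \<in> A \<longleftrightarrow> \<theta> \<in> A'" by (rule AE_completion)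
  have Ac: "A \<in> sets (completion ?F)" using A by simp
  have "A' \<in> sets (completion ?F)" using aeq Ac by (rule completion.in_sets_AE) (auto simp: A'_def)
  then have "measure (completion ?F) A' = measure (completion ?F) A"
    using measure_eq_AE[OF aeq Ac] by simp
  also have "\<dots> = measure ?F A" using A by simp
  also have "\<dots> = measure ?P S" unfolding A_def by (rule measure_lpull[OF up low_sub S])
  finally have "theon_limit T \<Omega> N (iso_class M) = measure ?P S"
    using cl by (simp add: theon_limit_def Let_def some A'_def \<E>_def)
  then have "labelled (theon_limit T \<Omega> N) M = real (card (Aut M)) / fact m * measure ?P S"
    by (simp add: labelled_def vM)
  also have "\<dots> = law m M" unfolding S_def by (rule law_iso_class(2)[OF wf vM])
  finally show ?thesis .
qed

end

text \<open>The set witnessing \<open>peon_rank_le\<close> comes without measurability. By Fubini,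
  for almost every choice y of the coordinates at larger sets, the section at y of a measurable
  version of N agrees almost surely with that set; one such section serves as H.\<close>

lemma rank_reduction:
  assumes "prob_space \<Omega>" and N: "N \<in> sets (\<E> {..<a} \<Omega>)" and rank: "peon_rank_le a \<Omega> N l"
  shows "\<exists>H\<in>sets (\<Pi>\<^sub>M B\<in>low l {..<a}. \<Omega>).
    AE x in (\<Pi>\<^sub>M B\<in>fin_subsets {..<a}. \<Omega>). x \<in> N \<longleftrightarrow> restrict x (low l {..<a}) \<in> H"
proof -
  interpret prob_space \<Omega> by fact
  interpret product_prob_space "\<lambda>_. \<Omega>" UNIV by standard
  let ?I = "low l {..<a}"
  let ?J = "fin_subsets {..<a} - ?I"
  let ?F = "\<Pi>\<^sub>M B\<in>fin_subsets {..<a}. \<Omega>"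
  let ?PI = "\<Pi>\<^sub>M B\<in>?I. \<Omega>"
  let ?PJ = "\<Pi>\<^sub>M B\<in>?J. \<Omega>"
  have finF: "finite (fin_subsets {..<a})"
    unfolding fin_subsets_def by (rule finite_subset[of _ "Pow {..<a}"]) auto
  have IF: "?I \<subseteq> fin_subsets {..<a}" by (auto simp: low_def)
  have fin: "finite ?I" "finite ?J" using finF IF finite_subset by auto
  have Un: "?J \<union> ?I = fin_subsets {..<a}" using IF by blast
  interpret PI: prob_space ?PI by (rule prob_space_PiM) (rule assms(1))
  interpret PJ: prob_space ?PJ by (rule prob_space_PiM) (rule assms(1))
  interpret P: pair_sigma_finite ?PJ ?PI by standard
  obtain H0 where H0: "N = {x \<in> space (\<E> {..<a} \<Omega>). restrict x {A \<in> fin_subsets {..<a}. card A \<le> l} \<in> H0}"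
    using rank unfolding peon_rank_le_def by blast
  have N_iff: "x \<in> N \<longleftrightarrow> restrict x ?I \<in> H0" if "x \<in> space ?F" for x
    using that unfolding H0 by (simp add: \<E>_def low_def)
  have "N \<in> sets (completion ?F)" using N by (simp add: \<E>_def)
  then obtain S N0 N' where S: "N = S \<union> N0" "N0 \<subseteq> N'" "N' \<in> null_sets ?F" "S \<in> sets ?F"
    unfolding sets_completion by (rule completionE)
  have "AE x in ?F. x \<in> N \<longleftrightarrow> x \<in> S"
    using AE_not_in[OF S(3)] by eventually_elim (use S(1,2) in blast)
  moreover have disj: "?J \<inter> ?I = {}" by blast
  have "distr (?PJ \<Otimes>\<^sub>M ?PI) ?F (merge ?J ?I) = ?F"
    using distr_merge[OF disj fin(2,1)] unfolding Un .
  ultimately have "AE x in distr (?PJ \<Otimes>\<^sub>M ?PI) ?F (merge ?J ?I). x \<in> N \<longleftrightarrow> x \<in> S" by (simp only:)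
  moreover have mm: "merge ?J ?I \<in> ?PJ \<Otimes>\<^sub>M ?PI \<rightarrow>\<^sub>M ?F"
    using measurable_merge[of ?J ?I "\<lambda>_. \<Omega>"] unfolding Un .
  ultimately have "AE z in ?PJ \<Otimes>\<^sub>M ?PI. merge ?J ?I z \<in> N \<longleftrightarrow> merge ?J ?I z \<in> S"
    by (intro AE_distrD[OF mm])
  then have "AE y in ?PJ. AE x in ?PI. merge ?J ?I (y, x) \<in> N \<longleftrightarrow> merge ?J ?I (y, x) \<in> S"
    by (rule P.AE_pair)
  with AE_space have "AE y in ?PJ. y \<in> space ?PJ \<and> (AE x in ?PI. merge ?J ?I (y, x) \<in> N \<longleftrightarrow> merge ?J ?I (y, x) \<in> S)"
    by eventually_elim blast
  then have "\<exists>y. y \<in> space ?PJ \<and> (AE x in ?PI. merge ?J ?I (y, x) \<in> N \<longleftrightarrow> merge ?J ?I (y, x) \<in> S)"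
    using PJ.AE_contr by (metis (mono_tags, lifting) eventually_mono)
  then obtain y where y: "y \<in> space ?PJ" "AE x in ?PI. merge ?J ?I (y, x) \<in> N \<longleftrightarrow> merge ?J ?I (y, x) \<in> S"
    by blast
  have my: "(\<lambda>x. merge ?J ?I (y, x)) \<in> ?PI \<rightarrow>\<^sub>M ?F"
    using measurable_compose[OF measurable_Pair1'[OF y(1)] mm] by simp
  define H where "H = {x \<in> space ?PI. merge ?J ?I (y, x) \<in> S}"
  have "(\<lambda>x. merge ?J ?I (y, x)) -` S \<inter> space ?PI \<in> sets ?PI" by (rule measurable_sets[OF my S(4)])
  moreover have "(\<lambda>x. merge ?J ?I (y, x)) -` S \<inter> space ?PI = H" unfolding H_def by blast
  ultimately have H: "H \<in> sets ?PI" by simp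
  have "AE x in ?PI. x \<in> H0 \<longleftrightarrow> x \<in> H"
    using y(2) AE_space
  proof eventually_elim
    case (elim x)
    have "restrict (merge ?J ?I (y, x)) ?I = x"
    proof (rule ext)
      fix B show "restrict (merge ?J ?I (y, x)) ?I B = x B"
        using elim(2) by (cases "B \<in> ?I") (auto simp: merge_def space_PiM PiE_def extensional_def)
    qed
    then show ?case
      using elim N_iff[OF measurable_space[OF my elim(2)]] by (simp add: H_def)
  qed
  moreover have "distr ?F ?PI (\<lambda>x. restrict x ?I) = ?PI"
  proof -
    have "id \<in> ?I \<rightarrow> fin_subsets {..<a}" using IF by auto
    from distr_PiM_reindex[OF assms(1) inj_on_id this] show ?thesis by (simp only: id_apply)
  qed
  ultimately have ae: "AE x in distr ?F ?PI (\<lambda>x. restrict x ?I). x \<in> H0 \<longleftrightarrow> x \<in> H" by (simp only:)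
  have "(\<lambda>x. restrict x ?I) \<in> ?F \<rightarrow>\<^sub>M ?PI" by (rule measurable_restrict_subset[OF IF])
  from AE_distrD[OF this ae] have "AE x in ?F. restrict x ?I \<in> H0 \<longleftrightarrow> restrict x ?I \<in> H" .
  with AE_space have "AE x in ?F. x \<in> N \<longleftrightarrow> restrict x ?I \<in> H"
    by eventually_elim (simp add: N_iff)
  then show ?thesis using H by blast
qed

lemma low_self: "low a {..<a} = fin_subsets {..<a}"
  using card_mono[of "{..<a}"] by (auto simp: low_def fin_subsets_def)

lemma pull_eq_lpull: "pull \<alpha> = lpull (length \<alpha>) \<alpha>"
  by (intro ext) (simp add: pull_def lpull_def low_self)

text \<open>Coordinates pulled back along a tuple have the law for which
  \<open>rank_reduction\<close> replaced the peon, so the exceptional sets remain null. For each m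
  only finitely many predicates and tuples are involved.\<close>

lemma ex_sampler:
  fixes T :: "'p univ_theory" and \<Omega> :: "'a measure"
  assumes T: "universal_theory T" and theon: "is_theon T \<Omega> N"
    and rank: "\<And>P. P \<in> preds T \<Longrightarrow> peon_rank_le (arity T P) \<Omega> (N P) l"
  shows "\<exists>H. sampler \<Omega> T l H \<and> (\<forall>m. \<forall>M\<in>labs T m. labelled (theon_limit T \<Omega> N) M = sampler.law \<Omega> T l H m M)"
proof -
  have \<Omega>: "prob_space \<Omega>" and N: "\<And>P. P \<in> preds T \<Longrightarrow> N P \<in> sets (\<E> {..<arity T P} \<Omega>)"
    using theon unfolding is_theon_def atomless_complete_prob_def by blast+
  interpret \<Omega>: prob_space \<Omega> by fact
  let ?Q = "\<lambda>P H. H \<in> sets (\<Pi>\<^sub>M B\<in>low l {..<arity T P}. \<Omega>) \<and>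
    (AE x in (\<Pi>\<^sub>M B\<in>fin_subsets {..<arity T P}. \<Omega>). x \<in> N P \<longleftrightarrow> restrict x (low l {..<arity T P}) \<in> H)"
  have "\<exists>H. ?Q P H" if "P \<in> preds T" for P
    using rank_reduction[OF \<Omega> N[OF that] rank[OF that]] by blast
  then have "\<forall>P\<in>preds T. \<exists>H. ?Q P H" by blast
  from bchoice[OF this] obtain H where HQ: "\<And>P. P \<in> preds T \<Longrightarrow> ?Q P (H P)" by blast
  interpret sampler \<Omega> T l H
    by unfold_locales (use T HQ in simp_all)
  have "AE \<theta> in (\<Pi>\<^sub>M A\<in>fin_subsets UNIV. \<Omega>). induced (theon_struct T N \<theta>) {..<m} = samp T l H m \<theta>" for m
  proof -
    let ?F = "\<Pi>\<^sub>M A\<in>fin_subsets UNIV. \<Omega>"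
    have one: "AE \<theta> in ?F. pull \<alpha> \<theta> \<in> N P \<longleftrightarrow> lpull l \<alpha> \<theta> \<in> H P"
      if P: "P \<in> preds T" and \<alpha>: "\<alpha> \<in> injs (arity T P) {..<m}" for P \<alpha>
    proof -
      let ?a = "arity T P"
      have len: "length \<alpha> = ?a" using \<alpha> by (simp add: injs_def)
      have \<alpha>U: "\<alpha> \<in> injs ?a UNIV" using \<alpha> by (simp add: injs_def)
      have sub: "low ?a UNIV \<subseteq> fin_subsets UNIV" by (auto simp: low_def)
      have "AE x in distr ?F (\<Pi>\<^sub>M B\<in>low ?a {..<?a}. \<Omega>) (lpull ?a \<alpha>). x \<in> N P \<longleftrightarrow> restrict x (low l {..<?a}) \<in> H P"
        unfolding \<Omega>.distr_lpull[OF \<alpha>U sub] unfolding low_self using HQ[OF P] by blast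
      then have "AE \<theta> in ?F. lpull ?a \<alpha> \<theta> \<in> N P \<longleftrightarrow> restrict (lpull ?a \<alpha> \<theta>) (low l {..<?a}) \<in> H P"
        by (rule AE_distrD[OF \<Omega>.lpull_measurable[OF \<alpha>U sub]])
      moreover have r: "restrict (lpull ?a \<alpha> \<theta>) (low l {..<?a}) = lpull l \<alpha> \<theta>" for \<theta>
        unfolding lpull_def len low_self by (intro ext) (auto simp: low_def restrict_def)
      ultimately show ?thesis unfolding pull_eq_lpull len r by blast
    qed
    have "AE \<theta> in ?F. \<forall>P\<in>preds T. \<forall>\<alpha>\<in>injs (arity T P) {..<m}. pull \<alpha> \<theta> \<in> N P \<longleftrightarrow> lpull l \<alpha> \<theta> \<in> H P"
      using T one by (intro AE_finite_allI) (simp_all add: universal_theory_def)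
    then show ?thesis
    proof eventually_elim
      case (elim \<theta>)
      show ?case
      proof (rule struct_eqI)
        fix P \<alpha>
        show "\<alpha> \<in> rels (induced (theon_struct T N \<theta>) {..<m}) P \<longleftrightarrow> \<alpha> \<in> rels (samp T l H m \<theta>) P"
        proof (cases "P \<in> preds T \<and> \<alpha> \<in> injs (arity T P) {..<m}")
          case True
          then have "pull \<alpha> \<theta> \<in> N P \<longleftrightarrow> lpull l \<alpha> \<theta> \<in> H P" using elim by blast
          then show ?thesis using True by (simp add: mem_rels_samp induced_def theon_struct_def injs_def)
        next
          case False
          then show ?thesis by (auto simp: mem_rels_samp induced_def theon_struct_def injs_def)
        qed
      qed simp
    qed
  qed
  then have "\<forall>m. \<forall>M\<in>labs T m. labelled (theon_limit T \<Omega> N) M = law m M"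
    using labelled_theon_limit by blast
  then show ?thesis using sampler_axioms by blast
qed

section \<open>Uniqueness of the coupling\<close>

lemma card_injs_le: "card (injs m {..<n}) \<le> n ^ m"
proof -
  have "card (injs m {..<n}) \<le> card {xs. set xs \<subseteq> {..<n} \<and> length xs = m}"
    by (intro card_mono finite_lists_length_eq) (auto simp: injs_def)
  then show ?thesis by (simp add: card_lists_length_eq)
qed

text \<open>The cut bounds are expressed in powers of n, the bias in numbers of injections; they
  differ at most by a factor independent of n.\<close>

lemma pow_le_card_injs:
  assumes "1 \<le> m" "m \<le> n"
  shows "real n ^ m \<le> real m ^ m * real (card (injs m {..<n}))"
proof -
  have "(real n / real m) ^ m \<le> real (n choose m)"
    using binomial_ge_n_over_k_pow_k[OF assms(2), where 'a = real] by simp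
  also have "\<dots> \<le> real (card (injs m {..<n}))"
  proof -
    have "1 * real (n choose m) \<le> fact m * real (n choose m)" by (rule mult_right_mono[OF fact_ge_1]) simp
    then show ?thesis by (simp add: card_injs)
  qed
  finally have "real n ^ m / real m ^ m \<le> real (card (injs m {..<n}))" by (simp add: power_divide)
  then show ?thesis using assms by (simp add: pos_divide_le_eq mult.commute)
qed

text \<open>The tail t will be held fixed while u varies. Disjointness is kept as a factor so that u
  runs through all injections, as in \<open>cut_sum\<close>.\<close>

lemma sum_injs_split:
  fixes f :: "nat list \<Rightarrow> real"
  assumes "k \<le> m"
  shows "(\<Sum>v\<in>injs m {..<n}. f v) =
    (\<Sum>t\<in>injs (m - k) {..<n}. \<Sum>u\<in>injs k {..<n}. f (u @ t) * of_bool (set u \<inter> set t = {}))"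
proof -
  have "(\<Sum>v\<in>injs m {..<n}. f v) =
      (\<Sum>(t, u)\<in>Sigma (injs (m - k) {..<n}) (\<lambda>t. {u \<in> injs k {..<n}. set u \<inter> set t = {}}). f (u @ t))"
  proof (rule sum.reindex_bij_witness[where j = "\<lambda>v. (drop k v, take k v)" and i = "\<lambda>(t, u). u @ t"])
    fix v assume v: "v \<in> injs m {..<n}"
    then have v': "length v = m" "distinct v" "set v \<subseteq> {..<n}" by (simp_all add: injs_def)
    have "set (take k v) \<subseteq> {..<n}" "set (drop k v) \<subseteq> {..<n}"
      using v'(3) set_take_subset[of k v] set_drop_subset[of k v] by blast+
    moreover have "set (take k v) \<inter> set (drop k v) = {}"
      using v'(2) set_take_disj_set_drop_if_distinct[of v k k] by simp
    ultimately show "(drop k v, take k v) \<in> Sigma (injs (m - k) {..<n}) (\<lambda>t. {u \<in> injs k {..<n}. set u \<inter> set t = {}})"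
      using v' assms by (simp add: injs_def)
  next
    fix x assume "x \<in> Sigma (injs (m - k) {..<n}) (\<lambda>t. {u \<in> injs k {..<n}. set u \<inter> set t = {}})"
    then obtain t u where x: "x = (t, u)" "t \<in> injs (m - k) {..<n}" "u \<in> injs k {..<n}" "set u \<inter> set t = {}" by blast
    then show "(case x of (t, u) \<Rightarrow> u @ t) \<in> injs m {..<n}" using assms by (simp add: injs_def)
    show "(drop k (case x of (t, u) \<Rightarrow> u @ t), take k (case x of (t, u) \<Rightarrow> u @ t)) = x"
      using x by (simp add: injs_def)
  qed simp_all
  also have "\<dots> = (\<Sum>t\<in>injs (m - k) {..<n}. \<Sum>u\<in>{u \<in> injs k {..<n}. set u \<inter> set t = {}}. f (u @ t))"
    by (rule sum.Sigma[symmetric]) simp_all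
  also have "\<dots> = (\<Sum>t\<in>injs (m - k) {..<n}. \<Sum>u\<in>injs k {..<n}. f (u @ t) * of_bool (set u \<inter> set t = {}))"
  proof (rule sum.cong[OF refl])
    fix t
    have "(\<Sum>u\<in>{u \<in> injs k {..<n}. set u \<inter> set t = {}}. f (u @ t)) =
        (\<Sum>u\<in>injs k {..<n}. if set u \<inter> set t = {} then f (u @ t) else 0)"
      by (rule sum.inter_filter) simp
    also have "\<dots> = (\<Sum>u\<in>injs k {..<n}. f (u @ t) * of_bool (set u \<inter> set t = {}))"
      by (rule sum.cong[OF refl]) simp
    finally show "(\<Sum>u\<in>{u \<in> injs k {..<n}. set u \<inter> set t = {}}. f (u @ t)) =
        (\<Sum>u\<in>injs k {..<n}. f (u @ t) * of_bool (set u \<inter> set t = {}))" .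
  qed
  finally show ?thesis .
qed

lemma del_eq_nth:
  assumes "del i u = del i u'" "length u = k" "length u' = k" "i < k" "j < k" "j \<noteq> i"
  shows "u ! j = u' ! j"
proof (cases "j < i")
  case True
  then have "del i u ! j = u ! j" "del i u' ! j = u' ! j" using assms(2-) by (simp_all add: del_def nth_append)
  then show ?thesis using arg_cong[OF assms(1), of "\<lambda>w. w ! j"] by (simp only:)
next
  case False
  then have "del i u ! (j - 1) = u ! j" "del i u' ! (j - 1) = u' ! j"
    using assms(2-) by (auto simp: del_def nth_append)
  then show ?thesis using arg_cong[OF assms(1), of "\<lambda>w. w ! (j - 1)"] by (simp only:)
qed

text \<open>Each condition x ignores the entry at \<open>ms x\<close> < k. With the entries beyond k
  fixed, collecting the conditions by the ignored index gives the factors of a cut sum in the first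
  k entries.\<close>

lemma slice_bound:
  assumes k: "2 \<le> k" "k \<le> m" and ms: "\<And>x. x \<in> X \<Longrightarrow> ms x < k"
    and \<Phi>: "\<And>x v v'. x \<in> X \<Longrightarrow> length v = m \<Longrightarrow> length v' = m \<Longrightarrow>
      (\<And>j. j < m \<Longrightarrow> j \<noteq> ms x \<Longrightarrow> v ! j = v' ! j) \<Longrightarrow> \<Phi> x v \<Longrightarrow> \<Phi> x v'"
  shows "\<bar>\<Sum>v\<in>injs m {..<n}. sg U (take k v) * of_bool (\<forall>x\<in>X. \<Phi> x v)\<bar> \<le> real n ^ (m - k) * cut k n U"
proof -
  \<comment> \<open>Disjointness of u and t is distributed over the factors as well: factor i speaks
    of all entries except the i-th.\<close>
  define C where "C t i u \<longleftrightarrow> (\<forall>x\<in>X. ms x = i \<longrightarrow> \<Phi> x (u @ t)) \<and> (\<forall>j<k. j \<noteq> i \<longrightarrow> u ! j \<notin> set t)" for t i u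
  have inner: "\<bar>\<Sum>u\<in>injs k {..<n}. sg U (take k (u @ t)) * of_bool (\<forall>x\<in>X. \<Phi> x (u @ t)) * of_bool (set u \<inter> set t = {})\<bar>
      \<le> cut k n U" if t: "t \<in> injs (m - k) {..<n}" for t
  proof -
    have "(\<Sum>u\<in>injs k {..<n}. sg U (take k (u @ t)) * of_bool (\<forall>x\<in>X. \<Phi> x (u @ t)) * of_bool (set u \<inter> set t = {})) =
        (\<Sum>u\<in>injs k {..<n}. sg U u * of_bool (\<forall>i<k. C t i u))"
    proof (rule sum.cong[OF refl])
      fix u assume "u \<in> injs k {..<n}"
      then have len: "length u = k" by (simp add: injs_def)
      have "(\<forall>i<k. C t i u) \<longleftrightarrow> (\<forall>x\<in>X. \<Phi> x (u @ t)) \<and> set u \<inter> set t = {}"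
      proof
        assume h: "\<forall>i<k. C t i u"
        have "\<Phi> x (u @ t)" if "x \<in> X" for x using h ms[OF that] that unfolding C_def by blast
        moreover have "u ! j \<notin> set t" if "j < k" for j
        proof -
          \<comment> \<open>Here k \<ge> 2 matters: only a factor with index other than j constrains
            the j-th entry.\<close>
          have "\<exists>i<k. j \<noteq> i" using k(1) by (intro exI[of _ "if j = 0 then 1 else 0"]) auto
          then show ?thesis using h that unfolding C_def by blast
        qed
        then have "set u \<inter> set t = {}" using len by (auto simp: in_set_conv_nth)
        ultimately show "(\<forall>x\<in>X. \<Phi> x (u @ t)) \<and> set u \<inter> set t = {}" by blast
      next
        assume h: "(\<forall>x\<in>X. \<Phi> x (u @ t)) \<and> set u \<inter> set t = {}"
        have "u ! j \<notin> set t" if "j < k" for j using h nth_mem[of j u] that len by blast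
        then show "\<forall>i<k. C t i u" using h unfolding C_def by blast
      qed
      then show "sg U (take k (u @ t)) * of_bool (\<forall>x\<in>X. \<Phi> x (u @ t)) * of_bool (set u \<inter> set t = {}) =
          sg U u * of_bool (\<forall>i<k. C t i u)"
        using len by simp
    qed
    also have "\<bar>\<dots>\<bar> \<le> cut k n U"
    proof (rule cut_bound)
      fix i u u' assume i: "i < k" and u: "u \<in> injs k {..<n}" "u' \<in> injs k {..<n}" and eq: "del i u = del i u'"
        and C: "C t i u"
      have len: "length u = k" "length u' = k" "length t = m - k" using u t by (simp_all add: injs_def)
      have nth: "u ! j = u' ! j" if "j < k" "j \<noteq> i" for j
        by (rule del_eq_nth[OF eq len(1,2) i that])
      have "\<Phi> x (u' @ t)" if x: "x \<in> X" "ms x = i" for x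
      proof (rule \<Phi>[OF x(1)])
        show "\<Phi> x (u @ t)" using C x unfolding C_def by blast
        fix j assume "j < m" "j \<noteq> ms x"
        then show "(u @ t) ! j = (u' @ t) ! j" using nth[of j] x(2) len by (simp add: nth_append)
      qed (use len k in simp_all)
      moreover have "u' ! j \<notin> set t" if "j < k" "j \<noteq> i" for j
        using C that nth[OF that] unfolding C_def by metis
      ultimately show "C t i u'" unfolding C_def by blast
    qed
    finally show ?thesis .
  qed
  have "(\<Sum>v\<in>injs m {..<n}. sg U (take k v) * of_bool (\<forall>x\<in>X. \<Phi> x v)) =
    (\<Sum>t\<in>injs (m - k) {..<n}. \<Sum>u\<in>injs k {..<n}.
      sg U (take k (u @ t)) * of_bool (\<forall>x\<in>X. \<Phi> x (u @ t)) * of_bool (set u \<inter> set t = {}))"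
    by (rule sum_injs_split[OF k(2)])
  also have "\<bar>\<dots>\<bar> \<le> (\<Sum>t\<in>injs (m - k) {..<n}. \<bar>\<Sum>u\<in>injs k {..<n}.
      sg U (take k (u @ t)) * of_bool (\<forall>x\<in>X. \<Phi> x (u @ t)) * of_bool (set u \<inter> set t = {})\<bar>)"
    by (rule sum_abs)
  also have "\<dots> \<le> (\<Sum>t\<in>injs (m - k) {..<n}. cut k n U)" by (rule sum_mono) (rule inner)
  also have "\<dots> = real (card (injs (m - k) {..<n})) * cut k n U" by simp
  also have "\<dots> \<le> real n ^ (m - k) * cut k n U"
  proof (rule mult_right_mono[OF _ cut_nonneg])
    have "real (card (injs (m - k) {..<n})) \<le> real (n ^ (m - k))" by (rule of_nat_mono[OF card_injs_le])
    then show "real (card (injs (m - k) {..<n})) \<le> real n ^ (m - k)" by simp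
  qed
  finally show ?thesis .
qed

text \<open>The symmetric difference of U with \<open>{A}\<close>, that is, the reversal of one
  orientation.\<close>

definition flip :: "'a \<Rightarrow> 'a set \<Rightarrow> 'a set" where
  "flip A U = (if A \<in> U then U - {A} else insert A U)"

lemma mem_flip: "B \<in> flip A U \<longleftrightarrow> (B \<in> U) \<noteq> (B = A)"
  by (auto simp: flip_def)

definition disc :: "nat \<Rightarrow> nat set set \<Rightarrow> nat list \<Rightarrow> nat set set \<Rightarrow> real" where
  "disc k U0 v U = of_bool (pbU k v U = U0) - of_bool (pbU k v U = flip {..<k} U0)"

lemma disc_abs_le: "\<bar>disc k U0 v U\<bar> \<le> 1"
  by (simp add: disc_def)

lemma first_ksets: "k \<le> m \<Longrightarrow> {..<k} \<in> ksets k {..<m}"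
  by (auto simp: ksets_def)

lemma first_mem_pbU:
  assumes "v \<in> injs m V" "k \<le> m"
  shows "{..<k} \<in> pbU k v U \<longleftrightarrow> sg U (take k v) = 1"
proof -
  have len: "length v = m" using assms by (simp add: injs_def)
  have "sl {..<k} = [0..<k]" by (simp add: lessThan_atLeast0)
  then have "map ((!) v) (sl {..<k}) = take k v"
    using len assms(2) by (intro nth_equalityI) simp_all
  moreover have "(!) v ` {..<k} = set (take k v)"
    using len assms(2) by (simp add: nth_image lessThan_atLeast0)
  ultimately show ?thesis using first_ksets[OF assms(2)] len by (simp add: pbU_def sg_def)
qed

text \<open>The two events agree at every k-set except the first. There the difference of the
  indicators is, up to a constant sign, the orientation of the tuple of the first k entries; this
  produces the signed sum of the cut norm.\<close>

lemma disc_eq: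
  assumes v: "v \<in> injs m V" and k: "k \<le> m" and U0: "U0 \<subseteq> ksets k {..<m}"
  shows "disc k U0 v U = (if {..<k} \<in> U0 then 1 else -1) * sg U (take k v) *
    of_bool (\<forall>A\<in>ksets k {..<m} - {{..<k}}. A \<in> pbU k v U \<longleftrightarrow> A \<in> U0)"
proof -
  let ?h = "\<forall>A\<in>ksets k {..<m} - {{..<k}}. A \<in> pbU k v U \<longleftrightarrow> A \<in> U0"
  have ext: "pbU k v U = W \<longleftrightarrow> (\<forall>A\<in>ksets k {..<m}. A \<in> pbU k v U \<longleftrightarrow> A \<in> W)" if "W \<subseteq> ksets k {..<m}" for W
    using pbU_subset[OF v, of k U] that by blast
  have 0: "pbU k v U = U0 \<longleftrightarrow> ?h \<and> ({..<k} \<in> pbU k v U \<longleftrightarrow> {..<k} \<in> U0)"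
    unfolding ext[OF U0] using first_ksets[OF k] by blast
  have sub: "flip {..<k} U0 \<subseteq> ksets k {..<m}" using U0 first_ksets[OF k] by (auto simp: flip_def)
  have 1: "pbU k v U = flip {..<k} U0 \<longleftrightarrow> ?h \<and> ({..<k} \<in> pbU k v U \<longleftrightarrow> {..<k} \<notin> U0)"
    unfolding ext[OF sub] mem_flip using first_ksets[OF k] by blast
  have "sg U (take k v) = 1 \<or> sg U (take k v) = -1" by (simp add: sg_def)
  then show ?thesis
    unfolding disc_def 0 1 first_mem_pbU[OF v k] by (cases "?h"; cases "{..<k} \<in> U0") auto
qed

text \<open>The sum is the integral over D of the function bounded in the last assumption. Thus
  cancellation between weights of different sign, which is seen pointwise, survives
  integration.\<close>

lemma (in finite_measure) weighted_measure_bound: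
  assumes "finite I" "D \<in> sets M" "\<And>v. v \<in> I \<Longrightarrow> E v \<in> sets M"
    and b: "\<And>\<theta>. \<theta> \<in> D \<Longrightarrow> \<bar>\<Sum>v\<in>I. w v * of_bool (\<theta> \<in> E v)\<bar> \<le> b"
  shows "\<bar>\<Sum>v\<in>I. w v * measure M (D \<inter> E v)\<bar> \<le> b * measure M D"
proof -
  have int: "integrable M (\<lambda>\<theta>. w v * indicator (D \<inter> E v) \<theta> :: real)" if "v \<in> I" for v
    using assms(2) assms(3)[OF that] by (intro integrable_mult_right integrable_real_indicator) (auto simp: emeasure_eq_measure)
  have "(\<Sum>v\<in>I. w v * measure M (D \<inter> E v)) = (\<Sum>v\<in>I. \<integral>\<theta>. w v * indicator (D \<inter> E v) \<theta> \<partial>M)"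
    using assms(2,3) sets.sets_into_space by (intro sum.cong refl) (auto simp: Int_absorb2 sets.Int_space_eq2)
  also have "\<dots> = (\<integral>\<theta>. (\<Sum>v\<in>I. w v * indicator (D \<inter> E v) \<theta>) \<partial>M)"
    by (rule Bochner_Integration.integral_sum[symmetric]) (rule int)
  finally have eq: "(\<Sum>v\<in>I. w v * measure M (D \<inter> E v)) = (\<integral>\<theta>. (\<Sum>v\<in>I. w v * indicator (D \<inter> E v) \<theta>) \<partial>M)" .
  have "\<bar>\<integral>\<theta>. (\<Sum>v\<in>I. w v * indicator (D \<inter> E v) \<theta>) \<partial>M\<bar> \<le> (\<integral>\<theta>. b * indicator D \<theta> \<partial>M)"
  proof -
    have "norm (\<integral>\<theta>. (\<Sum>v\<in>I. w v * indicator (D \<inter> E v) \<theta>) \<partial>M) \<le> (\<integral>\<theta>. b * indicator D \<theta> \<partial>M)"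
    proof (rule order_trans[OF integral_norm_bound integral_mono])
      show "integrable M (\<lambda>\<theta>. norm (\<Sum>v\<in>I. w v * indicator (D \<inter> E v) \<theta> :: real))"
        by (intro integrable_norm Bochner_Integration.integrable_sum int)
      show "integrable M (\<lambda>\<theta>. b * indicator D \<theta> :: real)"
        using assms(2) by (intro integrable_mult_right integrable_real_indicator) (auto simp: emeasure_eq_measure)
      fix \<theta> assume "\<theta> \<in> space M"
      show "norm (\<Sum>v\<in>I. w v * indicator (D \<inter> E v) \<theta> :: real) \<le> b * indicator D \<theta>"
      proof (cases "\<theta> \<in> D")
        case True
        then have "(\<Sum>v\<in>I. w v * indicator (D \<inter> E v) \<theta>) = (\<Sum>v\<in>I. w v * of_bool (\<theta> \<in> E v))"
          by (intro sum.cong refl) (simp add: indicator_def)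
        then show ?thesis using b[OF True] True by simp
      qed simp
    qed
    then show ?thesis by simp
  qed
  also have "\<dots> = b * measure M D"
    using assms(2) sets.sets_into_space by (simp add: Int_absorb2 sets.Int_space_eq2)
  finally show ?thesis unfolding eq .
qed

text \<open>A coupling reduced to labelled values: \<open>left\<close> is the uniform tournament
  marginal, and in \<open>right\<close> the second marginal is already expressed by
  sampling.\<close>

locale tournament_coupling = sampler \<Omega> T l H
  for \<Omega> :: "'a measure" and T :: "'p univ_theory" and l H +
  fixes k :: nat and \<xi> :: "(unit + 'p) struct set \<Rightarrow> real"
  assumes l: "1 \<le> l" and k: "k = Suc l"
    and \<xi>: "\<xi> \<in> Hom_plus (union_theory (tournament_theory k) T)"
    and left: "U \<subseteq> ksets k {..<m} \<Longrightarrow>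
      (\<Sum>B\<in>labs T m. labelled \<xi> (join (tour k {..<m} U) B)) = 1 / 2 ^ card (ksets k {..<m})"
    and right: "B \<in> labs T m \<Longrightarrow> (\<Sum>A\<in>labs (tournament_theory k) m. labelled \<xi> (join A B)) = law m B"
begin

section \<open>Joint values of tournament and model\<close>

definition joint :: "nat \<Rightarrow> nat set set \<Rightarrow> 'p struct \<Rightarrow> real" where
  "joint m U B = labelled \<xi> (join (tour k {..<m} U) B)"

lemma k_ge: "1 \<le> k" "2 \<le> k" using l k by auto

lemma universal: "universal_theory (union_theory (tournament_theory k) T)"
  by (rule universal_union[OF universal_tournament[OF k_ge(1)] T])

lemma join_labs: "U \<subseteq> ksets k {..<m} \<Longrightarrow> B \<in> labs T m \<Longrightarrow>
    join (tour k {..<m} U) B \<in> labs (union_theory (tournament_theory k) T) m"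
  by (rule join_in_labs) (auto simp: labs_tournament[OF k_ge(1)])

lemma joint_nonneg: "U \<subseteq> ksets k {..<m} \<Longrightarrow> B \<in> labs T m \<Longrightarrow> 0 \<le> joint m U B"
  unfolding joint_def by (rule labelled_nonneg[OF \<xi> join_labs])

lemma sum_joint_right:
  assumes "B \<in> labs T m"
  shows "(\<Sum>U\<in>Pow (ksets k {..<m}). joint m U B) = law m B"
proof -
  have inj: "inj_on (tour k {..<m}) (Pow (ksets k {..<m}))"
  proof (rule inj_onI)
    fix U U' assume "U \<in> Pow (ksets k {..<m})" "U' \<in> Pow (ksets k {..<m})" "tour k {..<m} U = tour k {..<m} U'"
    then show "U = U'" using tour_inj k_ge(1) by blast
  qed
  show ?thesis
    unfolding right[OF assms, symmetric] labs_tournament[OF k_ge(1)] sum.reindex[OF inj] joint_def by simp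
qed

lemma joint_le_law:
  assumes "U \<subseteq> ksets k {..<m}" "B \<in> labs T m"
  shows "joint m U B \<le> law m B"
  unfolding sum_joint_right[OF assms(2), symmetric]
  by (rule member_le_sum) (use assms joint_nonneg finite_ksets[of "{..<m}" k] in auto)

lemma joint_div_law:
  assumes "U \<subseteq> ksets k {..<m}" "B \<in> labs T m"
  shows "joint m U B / law m B * law m B = joint m U B"
  using joint_le_law[OF assms] joint_nonneg[OF assms] by (cases "law m B = 0") simp_all

lemma law_nonneg: "0 \<le> law m M"
  by (simp add: law_def)

lemma finite_labsT: "finite (labs T m)"
  using T by (simp add: finite_labs universal_theory_def)

text \<open>This is \<open>labelled_consistent\<close> for the union theory, with the models on [n]
  parametrised by the pairs of U and M.\<close>

lemma joint_consistent:
  assumes v: "v \<in> injs m {..<n}" and U0: "U0 \<subseteq> ksets k {..<m}" and B: "B \<in> labs T m"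
  shows "joint m U0 B = (\<Sum>U\<in>{U \<in> Pow (ksets k {..<n}). pbU k v U = U0}. \<Sum>M\<in>{M \<in> labs T n. pb v M = B}. joint n U M)"
proof -
  let ?A = "{U \<in> Pow (ksets k {..<n}). pbU k v U = U0}" and ?B = "{M \<in> labs T n. pb v M = B}"
  let ?j = "\<lambda>(U, M). join (tour k {..<n} U) M"
  have len: "length v = m" using v by (simp add: injs_def)
  have pbj: "pb v (join (tour k {..<n} U) M) = join (tour k {..<m} U0) B \<longleftrightarrow> pbU k v U = U0 \<and> pb v M = B"
    if M: "M \<in> labs T n" for U M
  proof -
    have "pb v (join (tour k {..<n} U) M) = join (tour k {..<m} (pbU k v U)) (pb v M)"
      using labs_verts[OF M] by (simp add: pb_join pb_tour[OF v])
    also have "\<dots> = join (tour k {..<m} U0) B \<longleftrightarrow> tour k {..<m} (pbU k v U) = tour k {..<m} U0 \<and> pb v M = B"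
      using len labs_verts[OF B] by (intro join_eq_iff) simp_all
    also have "\<dots> \<longleftrightarrow> pbU k v U = U0 \<and> pb v M = B"
      using tour_inj[OF _ pbU_subset[OF v] U0 k_ge(1)] by blast
    finally show ?thesis .
  qed
  have img: "{K \<in> labs (union_theory (tournament_theory k) T) n. pb v K = join (tour k {..<m} U0) B} = ?j ` (?A \<times> ?B)"
  proof (intro equalityI subsetI)
    fix K assume "K \<in> {K \<in> labs (union_theory (tournament_theory k) T) n. pb v K = join (tour k {..<m} U0) B}"
    then have K: "K \<in> labs (union_theory (tournament_theory k) T) n" "pb v K = join (tour k {..<m} U0) B" by simp_all
    obtain U where U: "U \<in> Pow (ksets k {..<n})" "red Inl K = tour k {..<n} U"
      using red_in_labs(1)[OF K(1)] unfolding labs_tournament[OF k_ge(1)] by blast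
    have M: "red Inr K \<in> labs T n" by (rule red_in_labs(2)[OF K(1)])
    have Ke: "K = join (tour k {..<n} U) (red Inr K)" using join_red[of K] unfolding U(2) by (rule sym)
    have "pb v (join (tour k {..<n} U) (red Inr K)) = join (tour k {..<m} U0) B"
      unfolding Ke[symmetric] by (rule K(2))
    then have "pbU k v U = U0 \<and> pb v (red Inr K) = B" using pbj[OF M] by (simp only:)
    then have "(U, red Inr K) \<in> ?A \<times> ?B" using U(1) M by simp
    moreover have "K = ?j (U, red Inr K)" using Ke by simp
    ultimately show "K \<in> ?j ` (?A \<times> ?B)" by (rule rev_image_eqI)
  next
    fix K assume "K \<in> ?j ` (?A \<times> ?B)"
    then obtain p where p: "p \<in> ?A \<times> ?B" "K = ?j p" by (rule imageE)
    obtain U M where pe: "p = (U, M)" by (cases p)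
    have UM: "U \<subseteq> ksets k {..<n}" "pbU k v U = U0" "M \<in> labs T n" "pb v M = B"
      "K = join (tour k {..<n} U) M" using p unfolding pe by simp_all
    have "pb v K = join (tour k {..<m} U0) B" unfolding UM(5) using pbj[OF UM(3), of U] UM(2,4) by (simp only:)
    moreover have "K \<in> labs (union_theory (tournament_theory k) T) n" unfolding UM(5) by (rule join_labs[OF UM(1,3)])
    ultimately show "K \<in> {K \<in> labs (union_theory (tournament_theory k) T) n. pb v K = join (tour k {..<m} U0) B}"
      by (intro CollectI conjI)
  qed
  have inj: "inj_on ?j (?A \<times> ?B)"
  proof (rule inj_onI)
    fix p q assume p: "p \<in> ?A \<times> ?B" and q: "q \<in> ?A \<times> ?B" and eq: "?j p = ?j q"
    obtain U M where pe: "p = (U, M)" by (cases p)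
    obtain U' M' where qe: "q = (U', M')" by (cases q)
    have p': "p = (U, M)" "U \<subseteq> ksets k {..<n}" "M \<in> labs T n" using p unfolding pe by simp_all
    have q': "q = (U', M')" "U' \<subseteq> ksets k {..<n}" "M' \<in> labs T n" using q unfolding qe by simp_all
    have "tour k {..<n} U = tour k {..<n} U' \<and> M = M'"
      using eq join_eq_iff[of "tour k {..<n} U" M "tour k {..<n} U'" M'] labs_verts[OF p'(3)] labs_verts[OF q'(3)]
      unfolding p'(1) q'(1) by simp
    then show "p = q" using tour_inj[OF _ p'(2) q'(2) k_ge(1)] p'(1) q'(1) by simp
  qed
  have "joint m U0 B = (\<Sum>K\<in>?j ` (?A \<times> ?B). labelled \<xi> K)"
    unfolding joint_def labelled_consistent[OF universal \<xi> join_labs[OF U0 B] v] img ..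
  also have "\<dots> = (\<Sum>p\<in>?A \<times> ?B. labelled \<xi> (?j p))"
    using sum.reindex[OF inj, of "labelled \<xi>"] by (simp only: comp_def)
  also have "\<dots> = (\<Sum>(U, M)\<in>?A \<times> ?B. joint n U M)"
    by (rule sum.cong[OF refl]) (auto simp: joint_def)
  also have "\<dots> = (\<Sum>U\<in>?A. \<Sum>M\<in>?B. joint n U M)" by (rule sum.cartesian_product[symmetric])
  finally show ?thesis .
qed

section \<open>Weights and bias on n points\<close>

abbreviation coords :: "nat \<Rightarrow> (nat set \<Rightarrow> 'a) measure" where
  "coords n \<equiv> (\<Pi>\<^sub>M B\<in>low l {..<n}. \<Omega>)"

definition fib :: "nat \<Rightarrow> 'p struct \<Rightarrow> (nat set \<Rightarrow> 'a) set" where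
  "fib n M = {\<theta> \<in> space (coords n). samp T l H n \<theta> = M}"

definition pre :: "nat \<Rightarrow> nat list \<Rightarrow> (nat set \<Rightarrow> 'a) set \<Rightarrow> (nat set \<Rightarrow> 'a) set" where
  "pre n v S = {\<theta> \<in> space (coords n). lpull l v \<theta> \<in> S}"

text \<open>The joint probability that the tournament on \<open>[n]\<close> is \<open>U\<close> and the coordinates, pulled back along
  \<open>v\<close>, lie in \<open>S\<close>. Where \<open>law n M = 0\<close>, also \<open>joint n U M = 0\<close>, and the quotient is \<open>0\<close>.\<close>

definition wt :: "nat \<Rightarrow> nat set set \<Rightarrow> nat list \<Rightarrow> (nat set \<Rightarrow> 'a) set \<Rightarrow> real" where
  "wt n U v S = (\<Sum>M\<in>labs T n. joint n U M / law n M * measure (coords n) (fib n M \<inter> pre n v S))"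

definition bias :: "nat \<Rightarrow> nat set set \<Rightarrow> nat \<Rightarrow> (nat set \<Rightarrow> 'a) set \<Rightarrow> real" where
  "bias m U0 n S = (\<Sum>v\<in>injs m {..<n}. \<Sum>U\<in>Pow (ksets k {..<n}). disc k U0 v U * wt n U v S) / real (card (injs m {..<n}))"

lemma prob_coords: "prob_space (coords n)"
  by (rule prob_space_prod)

lemma sets_fib: "fib n M \<in> sets (coords n)"
  unfolding fib_def by (rule sets_samp_eq)

lemma measure_fib: "measure (coords n) (fib n M) = law n M"
  by (simp add: fib_def law_def)

lemma sets_pre:
  assumes "v \<in> injs m {..<n}" "S \<in> sets (coords m)"
  shows "pre n v S \<in> sets (coords n)"
proof -
  have "lpull l v -` S \<inter> space (coords n) \<in> sets (coords n)"
    by (rule measurable_sets[OF lpull_measurable[OF assms(1) order_refl] assms(2)])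
  moreover have "lpull l v -` S \<inter> space (coords n) = pre n v S" unfolding pre_def by blast
  ultimately show ?thesis by simp
qed

lemma measure_pre:
  assumes "v \<in> injs m {..<n}" "S \<in> sets (coords m)"
  shows "measure (coords n) (pre n v S) = measure (coords m) S"
  unfolding pre_def by (rule measure_lpull[OF assms(1) order_refl assms(2)])

lemma wt_nonneg: "U \<in> Pow (ksets k {..<n}) \<Longrightarrow> 0 \<le> wt n U v S"
  unfolding wt_def using joint_nonneg[of U n] law_nonneg[of n] by (intro sum_nonneg mult_nonneg_nonneg divide_nonneg_nonneg) auto

text \<open>Given M, the conditional probabilities of the tournaments sum to at most 1, so only the
  law of the coordinates remains.\<close>

lemma sum_wt_le:
  assumes v: "v \<in> injs m {..<n}" and S: "S \<in> sets (coords m)"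
  shows "(\<Sum>U\<in>Pow (ksets k {..<n}). wt n U v S) \<le> measure (coords m) S"
proof -
  interpret P: prob_space "coords n" by (rule prob_coords)
  have "(\<Sum>U\<in>Pow (ksets k {..<n}). wt n U v S) =
      (\<Sum>M\<in>labs T n. \<Sum>U\<in>Pow (ksets k {..<n}). joint n U M / law n M * measure (coords n) (fib n M \<inter> pre n v S))"
    unfolding wt_def by (rule sum.swap)
  also have "\<dots> \<le> (\<Sum>M\<in>labs T n. measure (coords n) (fib n M \<inter> pre n v S))"
  proof (rule sum_mono)
    fix M assume M: "M \<in> labs T n"
    have "(\<Sum>U\<in>Pow (ksets k {..<n}). joint n U M / law n M * measure (coords n) (fib n M \<inter> pre n v S)) =
        law n M / law n M * measure (coords n) (fib n M \<inter> pre n v S)"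
      by (simp only: sum_distrib_right[symmetric] sum_divide_distrib[symmetric] sum_joint_right[OF M])
    \<comment> \<open>The quotient is 1, or 0 / 0 = 0 if M has probability 0.\<close>
    also have "\<dots> \<le> 1 * measure (coords n) (fib n M \<inter> pre n v S)"
      by (rule mult_right_mono) simp_all
    finally show "(\<Sum>U\<in>Pow (ksets k {..<n}). joint n U M / law n M * measure (coords n) (fib n M \<inter> pre n v S)) \<le>
        measure (coords n) (fib n M \<inter> pre n v S)" by simp
  qed
  also have "\<dots> = measure (coords n) (\<Union>M\<in>labs T n. fib n M \<inter> pre n v S)"
  proof (rule P.finite_measure_finite_Union[symmetric, OF finite_labsT])
    show "(\<lambda>M. fib n M \<inter> pre n v S) ` labs T n \<subseteq> sets (coords n)"
      using sets_fib sets_pre[OF v S] by blast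
    show "disjoint_family_on (\<lambda>M. fib n M \<inter> pre n v S) (labs T n)"
      unfolding disjoint_family_on_def fib_def by auto
  qed
  also have "\<dots> \<le> measure (coords n) (pre n v S)"
    by (rule P.finite_measure_mono[OF _ sets_pre[OF v S]]) blast
  also have "\<dots> = measure (coords m) S" by (rule measure_pre[OF v S])
  finally show ?thesis .
qed

text \<open>The essential point is uniformity in n: it lets the limit pass through countable unions
  in \<open>bias_tendsto\<close>.\<close>

lemma bias_bound:
  assumes S: "S \<in> sets (coords m)"
  shows "\<bar>bias m U0 n S\<bar> \<le> measure (coords m) S"
proof -
  let ?I = "injs m {..<n}"
  have "\<bar>\<Sum>v\<in>?I. \<Sum>U\<in>Pow (ksets k {..<n}). disc k U0 v U * wt n U v S\<bar> \<le>
      (\<Sum>v\<in>?I. \<bar>\<Sum>U\<in>Pow (ksets k {..<n}). disc k U0 v U * wt n U v S\<bar>)"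
    by (rule sum_abs)
  also have "\<dots> \<le> (\<Sum>v\<in>?I. measure (coords m) S)"
  proof (rule sum_mono)
    fix v assume v: "v \<in> ?I"
    have "\<bar>\<Sum>U\<in>Pow (ksets k {..<n}). disc k U0 v U * wt n U v S\<bar> \<le>
        (\<Sum>U\<in>Pow (ksets k {..<n}). \<bar>disc k U0 v U * wt n U v S\<bar>)" by (rule sum_abs)
    also have "\<dots> \<le> (\<Sum>U\<in>Pow (ksets k {..<n}). wt n U v S)"
    proof (rule sum_mono)
      fix U assume "U \<in> Pow (ksets k {..<n})"
      then have "0 \<le> wt n U v S" by (rule wt_nonneg)
      then show "\<bar>disc k U0 v U * wt n U v S\<bar> \<le> wt n U v S"
        using mult_right_mono[OF disc_abs_le[of k U0 v U], of "wt n U v S"] by (simp add: abs_mult)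
    qed
    also have "\<dots> \<le> measure (coords m) S" by (rule sum_wt_le[OF v S])
    finally show "\<bar>\<Sum>U\<in>Pow (ksets k {..<n}). disc k U0 v U * wt n U v S\<bar> \<le> measure (coords m) S" .
  qed
  also have "\<dots> = real (card ?I) * measure (coords m) S" by simp
  finally have "\<bar>\<Sum>v\<in>?I. \<Sum>U\<in>Pow (ksets k {..<n}). disc k U0 v U * wt n U v S\<bar> \<le> real (card ?I) * measure (coords m) S" .
  note bound = this
  show ?thesis
  proof (cases "card ?I = 0")
    case False
    then have "0 < real (card ?I)" by linarith
    then show ?thesis
      using bound unfolding bias_def abs_divide abs_of_nat by (simp only: pos_divide_le_eq mult.commute)
  qed (simp add: bias_def)
qed

lemma bias_Un:
  assumes "S \<in> sets (coords m)" "S' \<in> sets (coords m)" "S \<inter> S' = {}"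
  shows "bias m U0 n (S \<union> S') = bias m U0 n S + bias m U0 n S'"
proof -
  interpret P: prob_space "coords n" by (rule prob_coords)
  have "wt n U v (S \<union> S') = wt n U v S + wt n U v S'" if v: "v \<in> injs m {..<n}" for U v
  proof -
    have "measure (coords n) (fib n M \<inter> pre n v (S \<union> S')) =
        measure (coords n) (fib n M \<inter> pre n v S) + measure (coords n) (fib n M \<inter> pre n v S')" for M
    proof -
      have "fib n M \<inter> pre n v (S \<union> S') = (fib n M \<inter> pre n v S) \<union> (fib n M \<inter> pre n v S')"
        unfolding pre_def by blast
      moreover have "(fib n M \<inter> pre n v S) \<inter> (fib n M \<inter> pre n v S') = {}" using assms(3) unfolding pre_def by blast
      ultimately show ?thesis
        using P.finite_measure_Union[of "fib n M \<inter> pre n v S" "fib n M \<inter> pre n v S'"]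
          sets.Int[OF sets_fib sets_pre[OF v assms(1)]] sets.Int[OF sets_fib sets_pre[OF v assms(2)]] by simp
    qed
    then show ?thesis unfolding wt_def by (simp only: distrib_left sum.distrib)
  qed
  note wt_Un = this
  have "(\<Sum>v\<in>injs m {..<n}. \<Sum>U\<in>Pow (ksets k {..<n}). disc k U0 v U * wt n U v (S \<union> S')) =
      (\<Sum>v\<in>injs m {..<n}. (\<Sum>U\<in>Pow (ksets k {..<n}). disc k U0 v U * wt n U v S) +
        (\<Sum>U\<in>Pow (ksets k {..<n}). disc k U0 v U * wt n U v S'))"
  proof (rule sum.cong[OF refl])
    fix v assume v: "v \<in> injs m {..<n}"
    show "(\<Sum>U\<in>Pow (ksets k {..<n}). disc k U0 v U * wt n U v (S \<union> S')) =
        (\<Sum>U\<in>Pow (ksets k {..<n}). disc k U0 v U * wt n U v S) +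
        (\<Sum>U\<in>Pow (ksets k {..<n}). disc k U0 v U * wt n U v S')"
      by (simp only: wt_Un[OF v] distrib_left sum.distrib)
  qed
  then show ?thesis unfolding bias_def by (simp only: sum.distrib add_divide_distrib)
qed

text \<open>This event depends on the coordinates only through the model: pulled back along v they
  give B exactly when M does. So the weight is the \<xi>-probability of U together with such an M,
  and by consistency the sum over U is the same for every v.\<close>

lemma bias_fib:
  assumes B: "B \<in> labs T m" and U0: "U0 \<subseteq> ksets k {..<m}" and m: "k \<le> m" "m \<le> n"
  shows "bias m U0 n (fib m B) = joint m U0 B - joint m (flip {..<k} U0) B"
proof -
  have fU0: "flip {..<k} U0 \<subseteq> ksets k {..<m}" using U0 first_ksets[OF m(1)] by (auto simp: flip_def)
  have fin: "finite (Pow (ksets k {..<n}))" by (simp add: finite_ksets)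
  have "(\<Sum>U\<in>Pow (ksets k {..<n}). disc k U0 v U * wt n U v (fib m B)) = joint m U0 B - joint m (flip {..<k} U0) B"
    if v: "v \<in> injs m {..<n}" for v
  proof -
    have wt: "wt n U v (fib m B) = (\<Sum>M\<in>{M \<in> labs T n. pb v M = B}. joint n U M)" if U: "U \<in> Pow (ksets k {..<n})" for U
    proof -
      have "joint n U M / law n M * measure (coords n) (fib n M \<inter> pre n v (fib m B)) =
          (if pb v M = B then joint n U M else 0)" if M: "M \<in> labs T n" for M
      proof (cases "pb v M = B")
        case True
        have "fib n M \<inter> pre n v (fib m B) = fib n M"
        proof (intro equalityI subsetI)
          fix \<theta> assume "\<theta> \<in> fib n M"
          then have \<theta>: "\<theta> \<in> space (coords n)" "samp T l H n \<theta> = M" by (simp_all add: fib_def)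
          have "lpull l v \<theta> \<in> space (coords m)"
            by (rule measurable_space[OF lpull_measurable[OF v order_refl] \<theta>(1)])
          then have "lpull l v \<theta> \<in> fib m B" using pb_samp[OF v, of T l H \<theta>] \<theta>(2) True by (simp add: fib_def)
          then show "\<theta> \<in> fib n M \<inter> pre n v (fib m B)" using \<theta> \<open>\<theta> \<in> fib n M\<close> by (simp add: pre_def)
        qed blast
        then show ?thesis using joint_div_law[of U n M] U M True by (simp add: measure_fib)
      next
        case False
        have "\<theta> \<notin> fib n M \<inter> pre n v (fib m B)" for \<theta>
          using False pb_samp[OF v, of T l H \<theta>] by (auto simp: fib_def pre_def)
        then have "fib n M \<inter> pre n v (fib m B) = {}" by blast
        then show ?thesis using False by simp
      qed
      then have "wt n U v (fib m B) = (\<Sum>M\<in>labs T n. if pb v M = B then joint n U M else 0)"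
        unfolding wt_def by (intro sum.cong refl)
      also have "\<dots> = (\<Sum>M\<in>{M \<in> labs T n. pb v M = B}. joint n U M)"
        by (rule sum.inter_filter[symmetric, OF finite_labsT])
      finally show ?thesis .
    qed
    have part: "(\<Sum>U\<in>Pow (ksets k {..<n}). of_bool (pbU k v U = W) * wt n U v (fib m B)) = joint m W B"
      if W: "W \<subseteq> ksets k {..<m}" for W
    proof -
      have "(\<Sum>U\<in>Pow (ksets k {..<n}). of_bool (pbU k v U = W) * wt n U v (fib m B)) =
          (\<Sum>U\<in>Pow (ksets k {..<n}). if pbU k v U = W then (\<Sum>M\<in>{M \<in> labs T n. pb v M = B}. joint n U M) else 0)"
        by (intro sum.cong refl) (simp add: wt)
      also have "\<dots> = (\<Sum>U\<in>{U \<in> Pow (ksets k {..<n}). pbU k v U = W}. \<Sum>M\<in>{M \<in> labs T n. pb v M = B}. joint n U M)"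
        by (rule sum.inter_filter[symmetric, OF fin])
      also have "\<dots> = joint m W B" by (rule joint_consistent[OF v W B, symmetric])
      finally show ?thesis .
    qed
    show ?thesis
      unfolding disc_def left_diff_distrib sum_subtractf part[OF U0] part[OF fU0] ..
  qed
  note inner = this
  have "(\<Sum>v\<in>injs m {..<n}. \<Sum>U\<in>Pow (ksets k {..<n}). disc k U0 v U * wt n U v (fib m B)) =
      (\<Sum>v\<in>injs m {..<n}. joint m U0 B - joint m (flip {..<k} U0) B)"
    by (rule sum.cong[OF refl inner])
  then have eq: "(\<Sum>v\<in>injs m {..<n}. \<Sum>U\<in>Pow (ksets k {..<n}). disc k U0 v U * wt n U v (fib m B)) =
      real (card (injs m {..<n})) * (joint m U0 B - joint m (flip {..<k} U0) B)"
    by (simp only: sum_constant)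
  have "0 < card (injs m {..<n})" using m(2) by (intro card_injs_pos) simp_all
  then have "real (card (injs m {..<n})) \<noteq> 0" by linarith
  then show ?thesis unfolding bias_def eq by (rule nonzero_mult_div_cancel_left)
qed

text \<open>U and \<theta> are fixed, and only v varies. A side of the rectangle and a prescribed
  orientation are both conditions on the restriction of v to a set A, which ignore the entry at a
  point of [k] outside A; so both fit \<open>slice_bound\<close>.\<close>

lemma disc_rectangle_bound:
  assumes m: "k \<le> m" and U0: "U0 \<subseteq> ksets k {..<m}" and \<theta>: "\<theta> \<in> space (coords n)"
  shows "\<bar>\<Sum>v\<in>injs m {..<n}. disc k U0 v U * of_bool (\<theta> \<in> pre n v (\<Pi>\<^sub>E B\<in>low l {..<m}. X B))\<bar> \<le> real n ^ (m - k) * cut k n U"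
proof -
  let ?K = "ksets k {..<m} - {{..<k}}"
  \<comment> \<open>Cardinality separates the two kinds of sets: k for orientations, at most l for
    coordinates.\<close>
  define \<Phi> where "\<Phi> A v \<longleftrightarrow> (if card A = k then A \<in> pbU k v U \<longleftrightarrow> A \<in> U0 else \<theta> ((!) v ` A) \<in> X A)" for A v
  \<comment> \<open>A point of [k] outside A; it exists because A is smaller than k or is a k-set
    other than [k].\<close>
  define ms where "ms A = (SOME i. i < k \<and> i \<notin> A)" for A
  have A: "A \<subseteq> {..<m} \<and> ms A < k \<and> ms A \<notin> A" if "A \<in> ?K \<union> low l {..<m}" for A
  proof -
    have sub: "A \<subseteq> {..<m}" using that by (auto simp: ksets_def low_def fin_subsets_def)
    then have finA: "finite A" using finite_subset by blast
    have "\<not> {..<k} \<subseteq> A"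
    proof
      assume s: "{..<k} \<subseteq> A"
      then have "k \<le> card A" using card_mono[OF finA s] by simp
      then have "A \<in> ?K" using that k by (auto simp: low_def)
      then have "card A = k" "A \<noteq> {..<k}" by (auto simp: ksets_def)
      then show False using card_subset_eq[OF finA s] by simp
    qed
    then have "\<exists>i. i < k \<and> i \<notin> A" by blast
    then show ?thesis using sub someI_ex[of "\<lambda>i. i < k \<and> i \<notin> A"] unfolding ms_def by blast
  qed
  have mem: "disc k U0 v U * of_bool (\<theta> \<in> pre n v (\<Pi>\<^sub>E B\<in>low l {..<m}. X B)) =
      (if {..<k} \<in> U0 then 1 else -1) * (sg U (take k v) * of_bool (\<forall>A\<in>?K \<union> low l {..<m}. \<Phi> A v))"
    if v: "v \<in> injs m {..<n}" for v
  proof -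
    have len: "length v = m" using v by (simp add: injs_def)
    have "\<theta> \<in> pre n v (\<Pi>\<^sub>E B\<in>low l {..<m}. X B) \<longleftrightarrow> (\<forall>B\<in>low l {..<m}. \<theta> ((!) v ` B) \<in> X B)"
      using \<theta> by (simp add: pre_def lpull_def len restrict_PiE_iff Pi_iff)
    also have "\<dots> \<longleftrightarrow> (\<forall>A\<in>low l {..<m}. \<Phi> A v)"
    proof (rule ball_cong[OF refl])
      fix B assume "B \<in> low l {..<m}"
      then have "card B \<noteq> k" using k by (auto simp: low_def)
      then show "\<theta> ((!) v ` B) \<in> X B \<longleftrightarrow> \<Phi> B v" by (simp add: \<Phi>_def)
    qed
    finally have 1: "\<theta> \<in> pre n v (\<Pi>\<^sub>E B\<in>low l {..<m}. X B) \<longleftrightarrow> (\<forall>A\<in>low l {..<m}. \<Phi> A v)" .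
    have 2: "(\<forall>A\<in>?K. A \<in> pbU k v U \<longleftrightarrow> A \<in> U0) \<longleftrightarrow> (\<forall>A\<in>?K. \<Phi> A v)"
    proof (rule ball_cong[OF refl])
      fix A assume "A \<in> ?K"
      then have "card A = k" by (simp add: ksets_def)
      then show "(A \<in> pbU k v U \<longleftrightarrow> A \<in> U0) \<longleftrightarrow> \<Phi> A v" by (simp add: \<Phi>_def)
    qed
    show ?thesis
      unfolding disc_eq[OF v m U0] 1 2 ball_Un of_bool_conj by simp
  qed
  have "(\<Sum>v\<in>injs m {..<n}. disc k U0 v U * of_bool (\<theta> \<in> pre n v (\<Pi>\<^sub>E B\<in>low l {..<m}. X B))) =
      (if {..<k} \<in> U0 then 1 else -1) * (\<Sum>v\<in>injs m {..<n}. sg U (take k v) * of_bool (\<forall>A\<in>?K \<union> low l {..<m}. \<Phi> A v))"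
    unfolding sum_distrib_left by (rule sum.cong[OF refl mem])
  moreover have "\<bar>\<Sum>v\<in>injs m {..<n}. sg U (take k v) * of_bool (\<forall>A\<in>?K \<union> low l {..<m}. \<Phi> A v)\<bar> \<le> real n ^ (m - k) * cut k n U"
  proof (rule slice_bound[OF k_ge(2) m, where ms = ms])
    fix A assume "A \<in> ?K \<union> low l {..<m}"
    then show "ms A < k" using A by blast
  next
    fix A v v' assume A': "A \<in> ?K \<union> low l {..<m}" and len: "length v = m" "length v' = m"
      and eq: "\<And>j. j < m \<Longrightarrow> j \<noteq> ms A \<Longrightarrow> v ! j = v' ! j" and \<Phi>: "\<Phi> A v"
    have e: "v ! j = v' ! j" if "j \<in> A" for j using A[OF A'] eq[of j] that by blast
    have finA: "finite A" using A[OF A'] finite_subset by blast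
    have img: "(!) v ` A = (!) v' ` A" using e by (intro image_cong refl)
    have "map ((!) v) (sl A) = map ((!) v') (sl A)" using e finA by (intro map_cong refl) simp
    then have "A \<in> pbU k v U \<longleftrightarrow> A \<in> pbU k v' U" unfolding pbU_def by (simp only: mem_Collect_eq img len)
    then show "\<Phi> A v'" using \<Phi> unfolding \<Phi>_def img by (cases "card A = k") simp_all
  qed
  ultimately show ?thesis by (cases "{..<k} \<in> U0") simp_all
qed

text \<open>For fixed U the sum over v is estimated on each fibre of M, where the weight
  \<open>joint n U M / law n M\<close> is constant. Summing over M leaves the cut norm times the
  probability of U, the same for all U by \<open>left\<close>, and summing over U then gives the
  mean cut norm.\<close>

lemma bias_rectangle_bound:
  assumes m: "k \<le> m" "m \<le> n" "(fact k)\<^sup>2 \<le> n" and U0: "U0 \<subseteq> ksets k {..<m}"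
    and X: "\<And>B. B \<in> low l {..<m} \<Longrightarrow> X B \<in> sets \<Omega>"
  shows "\<bar>bias m U0 n (\<Pi>\<^sub>E B\<in>low l {..<m}. X B)\<bar> \<le> (1 + real k + (fact k)\<^sup>2) * real m ^ m / sqrt (real n)"
proof -
  interpret P: prob_space "coords n" by (rule prob_coords)
  let ?S = "\<Pi>\<^sub>E B\<in>low l {..<m}. X B" and ?I = "injs m {..<n}" and ?Q = "Pow (ksets k {..<n})"
  let ?c = "1 / 2 ^ card (ksets k {..<n}) :: real" and ?K = "1 + real k + (fact k)\<^sup>2 :: real"
  have S: "?S \<in> sets (coords m)" using X by (intro sets_PiM_I_finite finite_low) simp_all
  have one: "\<bar>\<Sum>v\<in>?I. disc k U0 v U * wt n U v ?S\<bar> \<le> real n ^ (m - k) * cut k n U * ?c" if U: "U \<in> ?Q" for U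
  proof -
    let ?b = "real n ^ (m - k) * cut k n U"
    have "(\<Sum>v\<in>?I. disc k U0 v U * wt n U v ?S) =
        (\<Sum>v\<in>?I. \<Sum>M\<in>labs T n. joint n U M / law n M * (disc k U0 v U * measure (coords n) (fib n M \<inter> pre n v ?S)))"
      unfolding wt_def sum_distrib_left by (intro sum.cong refl) (simp only: mult_ac)
    also have "\<dots> = (\<Sum>M\<in>labs T n. \<Sum>v\<in>?I. joint n U M / law n M * (disc k U0 v U * measure (coords n) (fib n M \<inter> pre n v ?S)))"
      by (rule sum.swap)
    also have "\<dots> = (\<Sum>M\<in>labs T n. joint n U M / law n M * (\<Sum>v\<in>?I. disc k U0 v U * measure (coords n) (fib n M \<inter> pre n v ?S)))"
      by (simp only: sum_distrib_left)
    finally have split: "(\<Sum>v\<in>?I. disc k U0 v U * wt n U v ?S) =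
        (\<Sum>M\<in>labs T n. joint n U M / law n M * (\<Sum>v\<in>?I. disc k U0 v U * measure (coords n) (fib n M \<inter> pre n v ?S)))" .
    have "\<bar>\<Sum>v\<in>?I. disc k U0 v U * wt n U v ?S\<bar> \<le> (\<Sum>M\<in>labs T n. \<bar>joint n U M / law n M * (\<Sum>v\<in>?I. disc k U0 v U * measure (coords n) (fib n M \<inter> pre n v ?S))\<bar>)"
      unfolding split by (rule sum_abs)
    also have "\<dots> \<le> (\<Sum>M\<in>labs T n. ?b * joint n U M)"
    proof (rule sum_mono)
      fix M assume M: "M \<in> labs T n"
      have "\<bar>\<Sum>v\<in>?I. disc k U0 v U * measure (coords n) (fib n M \<inter> pre n v ?S)\<bar> \<le> ?b * measure (coords n) (fib n M)"
      proof (rule P.weighted_measure_bound)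
        fix \<theta> assume "\<theta> \<in> fib n M"
        then have "\<theta> \<in> space (coords n)" by (simp add: fib_def)
        then show "\<bar>\<Sum>v\<in>?I. disc k U0 v U * of_bool (\<theta> \<in> pre n v ?S)\<bar> \<le> ?b"
          by (rule disc_rectangle_bound[OF m(1) U0])
      qed (use sets_fib sets_pre[OF _ S] in simp_all)
      then have b: "\<bar>\<Sum>v\<in>?I. disc k U0 v U * measure (coords n) (fib n M \<inter> pre n v ?S)\<bar> \<le> ?b * law n M"
        by (simp only: measure_fib)
      have j0: "0 \<le> joint n U M / law n M"
        using joint_nonneg[of U n M] law_nonneg[of n M] U M by (intro divide_nonneg_nonneg) auto
      have "\<bar>joint n U M / law n M * (\<Sum>v\<in>?I. disc k U0 v U * measure (coords n) (fib n M \<inter> pre n v ?S))\<bar> =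
          joint n U M / law n M * \<bar>\<Sum>v\<in>?I. disc k U0 v U * measure (coords n) (fib n M \<inter> pre n v ?S)\<bar>"
        using j0 by (simp only: abs_mult abs_of_nonneg)
      also have "\<dots> \<le> joint n U M / law n M * (?b * law n M)" by (rule mult_left_mono[OF b j0])
      also have "\<dots> = ?b * (joint n U M / law n M * law n M)" by (simp only: mult_ac)
      also have "\<dots> = ?b * joint n U M" using joint_div_law[of U n M] U M by simp
      finally show "\<bar>joint n U M / law n M * (\<Sum>v\<in>?I. disc k U0 v U * measure (coords n) (fib n M \<inter> pre n v ?S))\<bar> \<le> ?b * joint n U M" .
    qed
    also have "\<dots> = ?b * ?c"
      using left[of U n] U unfolding sum_distrib_left[symmetric] joint_def by simp
    finally show ?thesis .
  qed
  have "\<bar>\<Sum>v\<in>?I. \<Sum>U\<in>?Q. disc k U0 v U * wt n U v ?S\<bar> = \<bar>\<Sum>U\<in>?Q. \<Sum>v\<in>?I. disc k U0 v U * wt n U v ?S\<bar>"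
    by (rule arg_cong[where f = abs, OF sum.swap])
  also have "\<dots> \<le> (\<Sum>U\<in>?Q. \<bar>\<Sum>v\<in>?I. disc k U0 v U * wt n U v ?S\<bar>)" by (rule sum_abs)
  also have "\<dots> \<le> (\<Sum>U\<in>?Q. real n ^ (m - k) * cut k n U * ?c)" by (rule sum_mono) (rule one)
  also have "\<dots> = real n ^ (m - k) * ?c * (\<Sum>U\<in>?Q. cut k n U)"
    unfolding sum_distrib_left by (intro sum.cong refl) (simp only: mult_ac)
  also have "\<dots> \<le> real n ^ (m - k) * ?c * (2 ^ card (ksets k {..<n}) * (?K * real n ^ k / sqrt (real n)))"
    by (rule mult_left_mono[OF sum_cut_le[OF k_ge(1) m(3)]]) simp
  also have "\<dots> = ?K * real n ^ m / sqrt (real n)"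
  proof -
    have "real n ^ m = real n ^ (m - k) * real n ^ k" using m(1) by (simp add: power_add[symmetric])
    then show ?thesis by simp
  qed
  \<comment> \<open>Changes the normalisation to the one in \<open>bias\<close>, at the cost of the
    constant \<open>m ^ m\<close>.\<close>
  also have "?K * real n ^ m / sqrt (real n) \<le> ?K * (real m ^ m * real (card ?I)) / sqrt (real n)"
  proof (rule divide_right_mono[OF mult_left_mono])
    show "real n ^ m \<le> real m ^ m * real (card ?I)" using m k_ge by (intro pow_le_card_injs) simp_all
    show "0 \<le> ?K" by (intro add_nonneg_nonneg) simp_all
  qed simp
  finally have main: "\<bar>\<Sum>v\<in>?I. \<Sum>U\<in>?Q. disc k U0 v U * wt n U v ?S\<bar> \<le> ?K * real m ^ m / sqrt (real n) * real (card ?I)"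
    by (simp add: mult_ac)
  have "0 < card ?I" using m(2) by (intro card_injs_pos) simp_all
  then have "0 < real (card ?I)" by linarith
  then show ?thesis
    using main unfolding bias_def abs_divide abs_of_nat by (simp only: pos_divide_le_eq)
qed

text \<open>The limit is taken for each event separately. Complements and finite disjoint unions
  follow from additivity; a countable union needs in addition that its tail has small bias for all n
  at once.\<close>

lemma bias_tendsto:
  assumes m: "k \<le> m" and U0: "U0 \<subseteq> ksets k {..<m}" and S: "S \<in> sets (coords m)"
  shows "(\<lambda>n. bias m U0 n S) \<longlonglongrightarrow> 0"
proof -
  interpret P: prob_space "coords m" by (rule prob_coords)
  let ?A = "prod_algebra (low l {..<m}) (\<lambda>_. \<Omega>)"
  let ?\<Omega> = "\<Pi>\<^sub>E B\<in>low l {..<m}. space \<Omega>"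
  have sets: "sets (coords m) = sigma_sets ?\<Omega> ?A" by (rule sets_PiM)
  have space: "space (coords m) = ?\<Omega>" by (rule space_PiM)
  have rect: "(\<lambda>n. bias m U0 n (\<Pi>\<^sub>E B\<in>low l {..<m}. X B)) \<longlonglongrightarrow> 0"
    if X: "\<And>B. B \<in> low l {..<m} \<Longrightarrow> X B \<in> sets \<Omega>" for X
  proof (rule Lim_null_comparison)
    let ?c = "(1 + real k + (fact k)\<^sup>2) * real m ^ m"
    show "\<forall>\<^sub>F n in sequentially. norm (bias m U0 n (\<Pi>\<^sub>E B\<in>low l {..<m}. X B)) \<le> ?c / sqrt (real n)"
      using eventually_ge_at_top[of "max m ((fact k)\<^sup>2)"]
    proof eventually_elim
      case (elim n)
      then show ?case using bias_rectangle_bound[OF m _ _ U0 X, of n] by simp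
    qed
    show "(\<lambda>n. ?c / sqrt (real n)) \<longlonglongrightarrow> 0"
      by (rule tendsto_divide_0[OF tendsto_const])
        (intro filterlim_at_top_imp_at_infinity filterlim_compose[OF sqrt_at_top filterlim_real_sequentially])
  qed
  have "S \<in> sigma_sets ?\<Omega> ?A" using S by (simp only: sets)
  then show ?thesis
  proof (induction rule: sigma_sets_induct_disjoint[OF Int_stable_prod_algebra prod_algebra_sets_into_space, consumes 1, case_names basic empty compl union])
    case (basic A)
    then obtain X where X: "A = (\<Pi>\<^sub>E B\<in>low l {..<m}. X B)" "\<And>B. B \<in> low l {..<m} \<Longrightarrow> X B \<in> sets \<Omega>"
      unfolding prod_algebra_eq_finite[OF finite_low[OF finite_lessThan]] by auto
    show ?case unfolding X(1) by (rule rect[OF X(2)])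
  next
    case empty
    have "bias m U0 n {} = 0" for n using bias_bound[of "{}" m U0 n] by simp
    then show ?case by simp
  next
    case (compl A)
    have A: "A \<in> sets (coords m)" using compl(1) by (simp only: sets)
    have A': "?\<Omega> - A \<in> sets (coords m)" unfolding space[symmetric] using A by (rule sets.compl_sets)
    have "A \<union> (?\<Omega> - A) = ?\<Omega>" using sets.sets_into_space[OF A] unfolding space by blast
    then have "bias m U0 n (?\<Omega> - A) = bias m U0 n ?\<Omega> - bias m U0 n A" for n
      using bias_Un[OF A A', of U0 n] by simp
    moreover have "(\<lambda>n. bias m U0 n ?\<Omega> - bias m U0 n A) \<longlonglongrightarrow> 0 - 0"
      by (rule tendsto_diff[OF rect compl(2)]) simp
    ultimately show ?case by simp
  next
    case (union A)
    have A: "A i \<in> sets (coords m)" for i using union(2) unfolding sets by blast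
    \<comment> \<open>The tail beyond the first j sets. Its measure tends to 0 with j, and by
      \<open>bias_bound\<close> it dominates the bias independently of n.\<close>
    define R where "R j = (\<Union>i. A i) - (\<Union>i<j. A i)" for j
    have R: "R j \<in> sets (coords m)" for j
      unfolding R_def using A by (intro sets.Diff sets.countable_UN sets.finite_UN) auto
    have part: "(\<Union>i<j. A i) \<in> sets (coords m)" for j using A by (intro sets.finite_UN) auto
    have R0: "(\<lambda>j. measure (coords m) (R j)) \<longlonglongrightarrow> 0"
    proof -
      have "decseq R" unfolding R_def decseq_def by force
      moreover have "(\<Inter>j. R j) = {}" unfolding R_def by blast
      moreover have "range R \<subseteq> sets (coords m)" using R by blast
      ultimately show ?thesis using P.finite_Lim_measure_decseq[of R] by simp
    qed
    have parts: "(\<lambda>n. bias m U0 n (\<Union>i<j. A i)) \<longlonglongrightarrow> 0" for j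
    proof (induction j)
      case 0
      have "bias m U0 n {} = 0" for n using bias_bound[of "{}" m U0 n] by simp
      then show ?case by simp
    next
      case (Suc j)
      have "(\<Union>i<j. A i) \<inter> A j = {}"
        using union(1) unfolding disjoint_family_on_def by (auto dest: less_imp_neq)
      moreover have "(\<Union>i<Suc j. A i) = (\<Union>i<j. A i) \<union> A j" by (auto simp: less_Suc_eq)
      ultimately have "bias m U0 n (\<Union>i<Suc j. A i) = bias m U0 n (\<Union>i<j. A i) + bias m U0 n (A j)" for n
        using bias_Un[OF part A] by simp
      moreover have "(\<lambda>n. bias m U0 n (\<Union>i<j. A i) + bias m U0 n (A j)) \<longlonglongrightarrow> 0 + 0"
        by (rule tendsto_add[OF Suc union(3)])
      ultimately show ?case by simp
    qed
    show ?case
    proof (rule LIMSEQ_I)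
      fix r :: real assume r: "0 < r"
      then obtain j where j: "norm (measure (coords m) (R j) - 0) < r / 2"
        using LIMSEQ_D[OF R0, of "r / 2"] by auto
      obtain n0 where n0: "\<And>n. n0 \<le> n \<Longrightarrow> norm (bias m U0 n (\<Union>i<j. A i) - 0) < r / 2"
        using LIMSEQ_D[OF parts[of j], of "r / 2"] r by auto
      have "norm (bias m U0 n (\<Union>i. A i) - 0) < r" if "n0 \<le> n" for n
      proof -
        have "(\<Union>i. A i) = (\<Union>i<j. A i) \<union> R j" "(\<Union>i<j. A i) \<inter> R j = {}" unfolding R_def by blast+
        then have "bias m U0 n (\<Union>i. A i) = bias m U0 n (\<Union>i<j. A i) + bias m U0 n (R j)"
          using bias_Un[OF part R, of j j U0 n] by simp
        moreover have "\<bar>bias m U0 n (R j)\<bar> < r / 2" using bias_bound[OF R, of U0 n j] j by simp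
        moreover have "\<bar>bias m U0 n (\<Union>i<j. A i)\<bar> < r / 2" using n0[OF that] by simp
        ultimately show ?thesis by simp
      qed
      then show "\<exists>n0. \<forall>n\<ge>n0. norm (bias m U0 n (\<Union>i. A i) - 0) < r" by blast
    qed
  qed
qed

text \<open>The bias of a model event tends to 0 but does not depend on n from m on, so its constant
  value is 0.\<close>

lemma joint_flip_first:
  assumes "k \<le> m" "U0 \<subseteq> ksets k {..<m}" "B \<in> labs T m"
  shows "joint m (flip {..<k} U0) B = joint m U0 B"
proof -
  have "\<forall>\<^sub>F n in sequentially. bias m U0 n (fib m B) = joint m U0 B - joint m (flip {..<k} U0) B"
    using eventually_ge_at_top[of m] by eventually_elim (rule bias_fib[OF assms(3,2,1)])
  then have "(\<lambda>n. bias m U0 n (fib m B)) \<longlonglongrightarrow> joint m U0 B - joint m (flip {..<k} U0) B"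
    by (rule tendsto_eventually)
  then have "joint m U0 B - joint m (flip {..<k} U0) B = 0"
    using bias_tendsto[OF assms(1,2) sets_fib] by (rule LIMSEQ_unique)
  then show ?thesis by simp
qed

text \<open>For v from [m] to [m], pulling back is an isomorphism, and labelled values are
  isomorphism invariant.\<close>

lemma joint_pb:
  assumes v: "v \<in> injs m {..<m}" and U: "U \<subseteq> ksets k {..<m}" and B: "B \<in> labs T m"
  shows "joint m (pbU k v U) (pb v B) = joint m U B"
proof -
  let ?K = "join (tour k {..<m} U) B"
  have v': "length v = m" "distinct v" "set v \<subseteq> {..<m}" using v by (simp_all add: injs_def)
  then have sv: "set v = {..<m}" by (intro card_subset_eq) (simp_all add: distinct_card)
  have wf: "wf_struct ?K" by (rule labs_wf[OF join_labs[OF U B]])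
  have "induced ?K (set v) = ?K"
    using wf sv by (intro struct_eqI) (auto simp: induced_def wf_struct_def)
  moreover have "is_iso ((!) v) (pb v ?K) (induced ?K (set v))"
    using is_iso_nth_iff[of v "pb v ?K" ?K] v' by simp
  ultimately have "is_iso ((!) v) (pb v ?K) ?K" by simp
  then have "labelled \<xi> (pb v ?K) = labelled \<xi> ?K" by (rule labelled_iso) simp_all
  moreover have "pb v ?K = join (tour k {..<m} (pbU k v U)) (pb v B)"
    using labs_verts[OF B] by (simp add: pb_join pb_tour[OF v])
  ultimately show ?thesis unfolding joint_def by simp
qed

text \<open>Relabelling the vertices moves an arbitrary \<open>k\<close>-set to \<open>{..<k}\<close>.\<close>

lemma joint_flip:
  assumes A: "A \<in> ksets k {..<m}" and U: "U \<subseteq> ksets k {..<m}" and B: "B \<in> labs T m"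
  shows "joint m (flip A U) B = joint m U B"
proof -
  have A': "A \<subseteq> {..<m}" "card A = k" "finite A" using A finite_subset by (auto simp: ksets_def)
  then have km: "k \<le> m" using card_mono[of "{..<m}" A] by simp
  define v where "v = sl A @ sl ({..<m} - A)"
  have v: "v \<in> injs m {..<m}"
    using A' km by (auto simp: injs_def v_def card_Diff_subset)
  have v': "length v = m" "distinct v" using v by (simp_all add: injs_def)
  have inj: "inj_on ((!) v) {..<m}" using v' by (intro inj_on_nth) auto
  have img: "(!) v ` {..<k} = A"
  proof -
    have "(!) v ` {..<k} = set (take k v)" using v' km by (simp add: nth_image lessThan_atLeast0)
    also have "take k v = sl A" using A' by (simp add: v_def)
    finally show ?thesis using A'(3) by simp
  qed
  have flip: "pbU k v (flip A U) = flip {..<k} (pbU k v U)"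
  proof (rule set_eqI)
    fix C
    show "C \<in> pbU k v (flip A U) \<longleftrightarrow> C \<in> flip {..<k} (pbU k v U)"
    proof (cases "C \<in> ksets k {..<m}")
      case True
      then have "C \<subseteq> {..<m}" by (simp add: ksets_def)
      then have "(!) v ` C = (!) v ` {..<k} \<longleftrightarrow> C = {..<k}"
        using km by (intro inj_on_image_eq_iff[OF inj]) auto
      then have "(!) v ` C = A \<longleftrightarrow> C = {..<k}" by (simp only: img)
      then show ?thesis using True v'(1) unfolding mem_flip by (auto simp: pbU_def mem_flip)
    next
      case False
      then have "C \<noteq> {..<k}" using first_ksets[OF km] by blast
      then show ?thesis using False v'(1) unfolding mem_flip by (simp add: pbU_def)
    qed
  qed
  have fU: "flip A U \<subseteq> ksets k {..<m}" using U A by (auto simp: flip_def)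
  have pB: "pb v B \<in> labs T m"
    using pb_in_labs[of T B v m] B v by (simp add: labs_def)
  have "joint m (flip A U) B = joint m (flip {..<k} (pbU k v U)) (pb v B)"
    using joint_pb[OF v fU B] by (simp add: flip)
  also have "\<dots> = joint m (pbU k v U) (pb v B)"
    by (rule joint_flip_first[OF km pbU_subset[OF v] pB])
  also have "\<dots> = joint m U B" by (rule joint_pb[OF v U B])
  finally show ?thesis .
qed

text \<open>Single flips connect every tournament with the one encoded by the empty set, so for
  fixed B all tournaments have equal joint values, and these sum to \<open>law m B\<close>.\<close>

lemma joint_eq:
  assumes U: "U \<subseteq> ksets k {..<m}" and B: "B \<in> labs T m"
  shows "joint m U B = law m B / 2 ^ card (ksets k {..<m})"
proof -
  have fin: "finite (ksets k {..<m})" by (simp add: finite_ksets)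
  have empty: "joint m W B = joint m {} B" if "W \<subseteq> ksets k {..<m}" for W
  proof -
    have "finite W" using that fin by (rule finite_subset)
    then show ?thesis using that
    proof (induction W)
      case (insert A W)
      then have "flip A W = insert A W" by (simp add: flip_def)
      then show ?case using joint_flip[of A m W B] insert B by simp
    qed simp
  qed
  have "law m B = (\<Sum>W\<in>Pow (ksets k {..<m}). joint m U B)"
    unfolding sum_joint_right[OF B, symmetric]
  proof (rule sum.cong[OF refl])
    fix W assume "W \<in> Pow (ksets k {..<m})"
    then show "joint m W B = joint m U B" using empty[of W] empty[OF U] by simp
  qed
  also have "\<dots> = 2 ^ card (ksets k {..<m}) * joint m U B" using fin by (simp add: card_Pow)
  finally show ?thesis by simp
qed

end

section \<open>The quasirandom tournamon\<close>

lemma space_unit_interval: "space unit_interval = {0..1}"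
  by (simp add: unit_interval_def space_restrict_space)

lemma emeasure_unit_interval:
  "X \<subseteq> {0..1} \<Longrightarrow> emeasure unit_interval X = emeasure lebesgue X"
  unfolding unit_interval_def by (rule emeasure_restrict_space) simp_all

lemma prob_space_unit_interval: "prob_space unit_interval"
proof
  have "emeasure lebesgue {0..1::real} = 1" by simp
  then show "emeasure unit_interval (space unit_interval) = 1"
    by (simp only: space_unit_interval emeasure_unit_interval[OF order_refl])
qed

lemma id_borel_unit_interval: "(\<lambda>x. x) \<in> borel_measurable unit_interval"
proof -
  have "(\<lambda>x::real. x) \<in> borel_measurable lebesgue" by (rule measurable_completion) simp
  then show ?thesis unfolding unit_interval_def by (rule measurable_restrict_space1)
qed

lemma AE_unit_interval_neq: "AE x in unit_interval. x \<noteq> c"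
proof (rule AE_I)
  show "{x \<in> space unit_interval. \<not> x \<noteq> c} \<subseteq> {c} \<inter> {0..1}" by (auto simp: space_unit_interval)
  have "emeasure lebesgue ({c} \<inter> {0..1}) = 0" by (cases "c \<in> {0..1}") simp_all
  then show "emeasure unit_interval ({c} \<inter> {0..1}) = 0" by (simp add: emeasure_unit_interval)
  show "{c} \<inter> {0..1} \<in> sets unit_interval"
    unfolding unit_interval_def by (subst sets_restrict_space_iff) simp_all
qed

lemma reflect_measurable: "(\<lambda>x. 1 - x) \<in> unit_interval \<rightarrow>\<^sub>M unit_interval"
  unfolding unit_interval_def
proof (rule measurable_restrict_space3)
  show "(\<lambda>x::real. 1 - x) \<in> lebesgue \<rightarrow>\<^sub>M lebesgue"
    using lebesgue_affine_measurable[of "\<lambda>_::real. -1" 1] by simp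
qed auto

lemma emeasure_reflect:
  assumes "X \<in> sets unit_interval"
  shows "emeasure unit_interval ((\<lambda>x. 1 - x) -` X \<inter> space unit_interval) = emeasure unit_interval X"
proof -
  have X: "X \<subseteq> {0..1}" using sets.sets_into_space[OF assms] by (simp add: space_unit_interval)
  have "(\<lambda>x. 1 - x) -` X \<inter> space unit_interval = (\<lambda>x. -1 *\<^sub>R x + 1) ` X"
  proof (intro equalityI subsetI)
    fix x assume "x \<in> (\<lambda>x. 1 - x) -` X \<inter> space unit_interval"
    then show "x \<in> (\<lambda>x. -1 *\<^sub>R x + 1) ` X" by (intro rev_image_eqI[of "1 - x"]) simp_all
  next
    fix x assume "x \<in> (\<lambda>x. -1 *\<^sub>R x + 1) ` X"
    then show "x \<in> (\<lambda>x. 1 - x) -` X \<inter> space unit_interval" using X by (auto simp: space_unit_interval)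
  qed
  moreover have "(\<lambda>x. 1 - x) -` X \<inter> space unit_interval \<subseteq> {0..1}" by (auto simp: space_unit_interval)
  ultimately show ?thesis
    using emeasure_lebesgue_affine[of "-1::real" 1 X] X by (simp add: emeasure_unit_interval)
qed

lemma sorting_perm_eq: "sorting_perm k x \<sigma> \<longleftrightarrow> srt k (\<lambda>i. x {i}) \<sigma>"
  by (simp add: sorting_perm_def srt_def)

lemma space_\<E>: "space (\<E> V \<Omega>) = space (\<Pi>\<^sub>M A\<in>fin_subsets V. \<Omega>)"
  by (simp add: \<E>_def)

text \<open>A finite union over the possible sorting permutations. Measurability holds before
  completion, as \<open>sampler\<close> demands.\<close>

lemma sets_tournament_peon:
  assumes k: "1 \<le> k"
  shows "tournament_peon k \<in> sets (\<Pi>\<^sub>M A\<in>fin_subsets {..<k}. unit_interval)"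
proof -
  let ?P = "\<Pi>\<^sub>M A\<in>fin_subsets {..<k}. unit_interval"
  have comp: "(\<lambda>x. x A) \<in> borel_measurable ?P" if "A \<in> fin_subsets {..<k}" for A
    by (rule measurable_compose[OF measurable_component_singleton[OF that] id_borel_unit_interval])
  have single: "{i} \<in> fin_subsets {..<k}" if "i < k" for i using that by (simp add: fin_subsets_def)
  have top: "{..<k} \<in> fin_subsets {..<k}" using k by (auto simp: fin_subsets_def lessThan_empty_iff)
  have lt: "{x \<in> space ?P. x {i} < x {j}} \<in> sets ?P" if "i < k" "j < k" for i j
    by (rule borel_measurable_less[OF comp[OF single[OF that(1)]] comp[OF single[OF that(2)]]])
  have half: "{x \<in> space ?P. x {..<k} < 1/2} \<in> sets ?P"
    by (rule borel_measurable_less[OF comp[OF top] borel_measurable_const])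
  have "{x \<in> space ?P. (x {..<k} < 1/2 \<longleftrightarrow> sign \<sigma> = 1) \<and> (\<forall>i\<in>{..<k}. \<forall>j\<in>{..<k}. i < j \<longrightarrow> x {inv \<sigma> i} < x {inv \<sigma> j})} \<in> sets ?P"
    if \<sigma>: "\<sigma> permutes {..<k}" for \<sigma>
  proof (intro sets.sets_Collect_conj sets.sets_Collect_finite_All)
    show "{x \<in> space ?P. x {..<k} < 1/2 \<longleftrightarrow> sign \<sigma> = 1} \<in> sets ?P"
      using half sets.sets_Collect_neg[OF half] by (cases "sign \<sigma> = 1") simp_all
    fix i j assume ij: "i \<in> {..<k}" "j \<in> {..<k}"
    then have "inv \<sigma> i < k" "inv \<sigma> j < k"
      using permutes_in_image[OF permutes_inv[OF \<sigma>], of i] permutes_in_image[OF permutes_inv[OF \<sigma>], of j] by simp_all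
    then show "{x \<in> space ?P. i < j \<longrightarrow> x {inv \<sigma> i} < x {inv \<sigma> j}} \<in> sets ?P"
      using lt by (cases "i < j") simp_all
  qed simp_all
  note each = this
  have "finite {\<sigma>. \<sigma> permutes {..<k}}" by (rule finite_permutations) simp
  then have "(\<Union>\<sigma>\<in>{\<sigma>. \<sigma> permutes {..<k}}. {x \<in> space ?P. (x {..<k} < 1/2 \<longleftrightarrow> sign \<sigma> = 1) \<and>
      (\<forall>i\<in>{..<k}. \<forall>j\<in>{..<k}. i < j \<longrightarrow> x {inv \<sigma> i} < x {inv \<sigma> j})}) \<in> sets ?P"
    by (rule sets.finite_UN) (rule each, simp)
  moreover have "tournament_peon k = (\<Union>\<sigma>\<in>{\<sigma>. \<sigma> permutes {..<k}}. {x \<in> space ?P. (x {..<k} < 1/2 \<longleftrightarrow> sign \<sigma> = 1) \<and>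
      (\<forall>i\<in>{..<k}. \<forall>j\<in>{..<k}. i < j \<longrightarrow> x {inv \<sigma> i} < x {inv \<sigma> j})})"
  proof (intro equalityI subsetI)
    fix x assume "x \<in> tournament_peon k"
    then obtain \<sigma> where x: "x \<in> space ?P" "\<sigma> permutes {..<k}" "\<forall>i j. i < j \<and> j < k \<longrightarrow> x {inv \<sigma> i} < x {inv \<sigma> j}"
        "x {..<k} < 1/2 \<longleftrightarrow> sign \<sigma> = 1"
      unfolding tournament_peon_def sorting_perm_def space_\<E> by blast
    then have "x \<in> {x \<in> space ?P. (x {..<k} < 1/2 \<longleftrightarrow> sign \<sigma> = 1) \<and>
      (\<forall>i\<in>{..<k}. \<forall>j\<in>{..<k}. i < j \<longrightarrow> x {inv \<sigma> i} < x {inv \<sigma> j})}" by blast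
    then show "x \<in> (\<Union>\<sigma>\<in>{\<sigma>. \<sigma> permutes {..<k}}. {x \<in> space ?P. (x {..<k} < 1/2 \<longleftrightarrow> sign \<sigma> = 1) \<and>
      (\<forall>i\<in>{..<k}. \<forall>j\<in>{..<k}. i < j \<longrightarrow> x {inv \<sigma> i} < x {inv \<sigma> j})})"
      by (rule UN_I[of \<sigma>, rotated]) (use x(2) in simp)
  next
    fix x assume "x \<in> (\<Union>\<sigma>\<in>{\<sigma>. \<sigma> permutes {..<k}}. {x \<in> space ?P. (x {..<k} < 1/2 \<longleftrightarrow> sign \<sigma> = 1) \<and>
      (\<forall>i\<in>{..<k}. \<forall>j\<in>{..<k}. i < j \<longrightarrow> x {inv \<sigma> i} < x {inv \<sigma> j})})"
    then obtain \<sigma> where x: "\<sigma> permutes {..<k}" "x \<in> space ?P" "x {..<k} < 1/2 \<longleftrightarrow> sign \<sigma> = 1"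
      "\<forall>i\<in>{..<k}. \<forall>j\<in>{..<k}. i < j \<longrightarrow> x {inv \<sigma> i} < x {inv \<sigma> j}" by blast
    have "x {inv \<sigma> i} < x {inv \<sigma> j}" if "i < j \<and> j < k" for i j using x(4) that by simp
    then have "\<exists>\<sigma>. sorting_perm k x \<sigma> \<and> (x {..<k} < 1/2 \<longleftrightarrow> sign \<sigma> = 1)"
      unfolding sorting_perm_def using x(1,3) by blast
    then show "x \<in> tournament_peon k" unfolding tournament_peon_def space_\<E> using x(2) by blast
  qed
  ultimately show ?thesis by (simp only:)
qed

lemma sampler_tournament:
  assumes "1 \<le> k"
  shows "sampler unit_interval (tournament_theory k) k (\<lambda>_. tournament_peon k)"
proof -
  interpret prob_space unit_interval by (rule prob_space_unit_interval)
  show ?thesis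
    by unfold_locales (use universal_tournament[OF assms] sets_tournament_peon[OF assms] in \<open>simp_all add: low_self\<close>)
qed

text \<open>With all coordinates other than a fixed, the coordinate at a almost surely avoids the
  one value at b; Fubini does the rest.\<close>

lemma AE_PiM_neq:
  fixes \<Omega> :: "real measure"
  assumes \<Omega>: "prob_space \<Omega>" "(\<lambda>x. x) \<in> borel_measurable \<Omega>" "\<And>c. AE x in \<Omega>. x \<noteq> c"
    and I: "finite I" "a \<in> I" "b \<in> I" "a \<noteq> b"
  shows "AE \<theta> in (\<Pi>\<^sub>M i\<in>I. \<Omega>). \<theta> a \<noteq> \<theta> b"
proof -
  interpret \<Omega>: prob_space \<Omega> by (rule \<Omega>)
  interpret product_prob_space "\<lambda>_. \<Omega>" UNIV by standard
  let ?J = "I - {a}"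
  let ?PJ = "\<Pi>\<^sub>M i\<in>?J. \<Omega>" and ?PA = "\<Pi>\<^sub>M i\<in>{a}. \<Omega>" and ?P = "\<Pi>\<^sub>M i\<in>I. \<Omega>"
  interpret PJ: prob_space ?PJ by (rule prob_space_PiM) (rule \<Omega>(1))
  interpret PA: prob_space ?PA by (rule prob_space_PiM) (rule \<Omega>(1))
  interpret Q: pair_sigma_finite ?PJ ?PA by standard
  have Un: "?J \<union> {a} = I" using I by blast
  have disj: "?J \<inter> {a} = {}" by blast
  have fin: "finite ?J" "finite {a}" using I by simp_all
  have dist: "distr (?PJ \<Otimes>\<^sub>M ?PA) ?P (merge ?J {a}) = ?P" using distr_merge[OF disj fin] unfolding Un .
  have mm: "merge ?J {a} \<in> ?PJ \<Otimes>\<^sub>M ?PA \<rightarrow>\<^sub>M ?P" using measurable_merge[of ?J "{a}" "\<lambda>_. \<Omega>"] unfolding Un .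
  have bJ: "b \<in> ?J" using I by blast
  have ca: "(\<lambda>y. y a) \<in> ?PA \<rightarrow>\<^sub>M \<Omega>" by (rule measurable_component_singleton) simp
  have cb: "(\<lambda>y. y b) \<in> ?PJ \<rightarrow>\<^sub>M \<Omega>" by (rule measurable_component_singleton[OF bJ])
  have mb: "(\<lambda>z. fst z b) \<in> borel_measurable (?PJ \<Otimes>\<^sub>M ?PA)"
    by (rule measurable_compose[OF measurable_compose[OF measurable_fst cb] \<Omega>(2)])
  have ma: "(\<lambda>z. snd z a) \<in> borel_measurable (?PJ \<Otimes>\<^sub>M ?PA)"
    by (rule measurable_compose[OF measurable_compose[OF measurable_snd ca] \<Omega>(2)])
  have "AE z in ?PJ \<Otimes>\<^sub>M ?PA. snd z a \<noteq> fst z b"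
  proof (rule Q.AE_pair_measure)
    show "{z \<in> space (?PJ \<Otimes>\<^sub>M ?PA). snd z a \<noteq> fst z b} \<in> sets (?PJ \<Otimes>\<^sub>M ?PA)"
      by (rule borel_measurable_neq[OF ma mb])
    have "AE y in ?PA. y a \<noteq> x b" for x :: "'a \<Rightarrow> real"
      by (rule AE_PiM_component[where P = "\<lambda>y. y \<noteq> x b"]) (use \<Omega> in simp_all)
    then show "AE x in ?PJ. AE y in ?PA. snd (x, y) a \<noteq> fst (x, y) b" by simp
  qed
  then have "AE z in ?PJ \<Otimes>\<^sub>M ?PA. merge ?J {a} z a \<noteq> merge ?J {a} z b"
    using bJ by (auto simp: merge_def split_beta' elim: eventually_mono)
  moreover have cP: "(\<lambda>\<theta>. \<theta> i) \<in> ?P \<rightarrow>\<^sub>M \<Omega>" if "i \<in> I" for i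
    by (rule measurable_component_singleton[OF that])
  have "{\<theta> \<in> space ?P. \<theta> a \<noteq> \<theta> b} \<in> sets ?P"
    by (rule borel_measurable_neq[OF measurable_compose[OF cP[OF I(2)] \<Omega>(2)] measurable_compose[OF cP[OF I(3)] \<Omega>(2)]])
  ultimately have "AE \<theta> in distr (?PJ \<Otimes>\<^sub>M ?PA) ?P (merge ?J {a}). \<theta> a \<noteq> \<theta> b"
    by (subst AE_distr_iff[OF mm])
  then show ?thesis by (simp only: dist)
qed

text \<open>The symmetry that makes the tournament uniform: moving the coordinate at a k-set across
  1/2 reverses the orientation of this set alone and preserves the measure.\<close>

lemma distr_reflect_coordinate:
  assumes I: "finite I" "A \<in> I"
  shows "(\<lambda>\<theta>. \<theta>(A := 1 - \<theta> A)) \<in> (\<Pi>\<^sub>M i\<in>I. unit_interval) \<rightarrow>\<^sub>M (\<Pi>\<^sub>M i\<in>I. unit_interval)" (is ?m)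
    and "distr (\<Pi>\<^sub>M i\<in>I. unit_interval) (\<Pi>\<^sub>M i\<in>I. unit_interval) (\<lambda>\<theta>. \<theta>(A := 1 - \<theta> A)) = (\<Pi>\<^sub>M i\<in>I. unit_interval)" (is ?d)
proof -
  interpret prob_space unit_interval by (rule prob_space_unit_interval)
  interpret product_prob_space "\<lambda>_. unit_interval" UNIV by standard
  let ?P = "\<Pi>\<^sub>M i\<in>I. unit_interval"
  let ?f = "\<lambda>\<theta>. \<theta>(A := 1 - \<theta> A)"
  have f_eq: "?f \<theta> = (\<lambda>i\<in>I. (if i = A then 1 - \<theta> i else \<theta> i))" if "\<theta> \<in> space ?P" for \<theta>
    using that I(2) by (auto simp: space_PiM PiE_def extensional_def fun_eq_iff)
  have comp: "(\<lambda>\<theta>. if i = A then 1 - \<theta> i else \<theta> i) \<in> ?P \<rightarrow>\<^sub>M unit_interval" if "i \<in> I" for i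
    using measurable_compose[OF measurable_component_singleton[OF that] reflect_measurable]
      measurable_component_singleton[OF that, of "\<lambda>_. unit_interval"] by (cases "i = A") simp_all
  have "(\<lambda>\<theta>. \<lambda>i\<in>I. (if i = A then 1 - \<theta> i else \<theta> i)) \<in> ?P \<rightarrow>\<^sub>M ?P"
    by (rule measurable_restrict) (rule comp)
  then show m: ?m by (subst measurable_cong[OF f_eq])
  show ?d
  proof (rule PiM_eqI[OF I(1)])
    fix X :: "'a \<Rightarrow> real set" assume X: "\<And>i. i \<in> I \<Longrightarrow> X i \<in> sets unit_interval"
    define Y where "Y i = (if i = A then (\<lambda>x. 1 - x) -` X i \<inter> space unit_interval else X i)" for i
    have Y0: "Y i \<in> sets unit_interval \<and> emeasure unit_interval (Y i) = emeasure unit_interval (X i)" if "i \<in> I" for i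
    proof (cases "i = A")
      case True
      then have "Y i = (\<lambda>x. 1 - x) -` X i \<inter> space unit_interval" by (simp add: Y_def)
      then show ?thesis
        using measurable_sets[OF reflect_measurable X[OF that]] emeasure_reflect[OF X[OF that]] by (simp only:)
    qed (use X[OF that] in \<open>simp add: Y_def\<close>)
    have Y: "Y i \<in> sets unit_interval" "emeasure unit_interval (Y i) = emeasure unit_interval (X i)" if "i \<in> I" for i
      using Y0[OF that] by blast+
    have Xsub: "X i \<subseteq> space unit_interval" if "i \<in> I" for i using sets.sets_into_space[OF X[OF that]] .
    have "?f -` (\<Pi>\<^sub>E i\<in>I. X i) \<inter> space ?P = (\<Pi>\<^sub>E i\<in>I. Y i)"
    proof (intro equalityI subsetI)
      fix \<theta> assume "\<theta> \<in> ?f -` (\<Pi>\<^sub>E i\<in>I. X i) \<inter> space ?P"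
      then have 1: "?f \<theta> \<in> (\<Pi>\<^sub>E i\<in>I. X i)" and 2: "\<theta> \<in> space ?P" by blast+
      have "\<theta> i \<in> Y i" if "i \<in> I" for i
        using PiE_mem[OF 1 that] 2 that by (cases "i = A") (auto simp: Y_def space_PiM)
      then show "\<theta> \<in> (\<Pi>\<^sub>E i\<in>I. Y i)" using 2 by (auto simp: space_PiM PiE_def)
    next
      fix \<theta> assume \<theta>: "\<theta> \<in> (\<Pi>\<^sub>E i\<in>I. Y i)"
      have "\<theta> i \<in> space unit_interval" if "i \<in> I" for i
        using PiE_mem[OF \<theta> that] Xsub[OF that] by (auto simp: Y_def split: if_splits)
      then have "\<theta> \<in> space ?P" using \<theta> by (auto simp: space_PiM PiE_def)
      moreover have "?f \<theta> i \<in> X i" if "i \<in> I" for i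
        using PiE_mem[OF \<theta> that] by (cases "i = A") (auto simp: Y_def)
      then have "?f \<theta> \<in> (\<Pi>\<^sub>E i\<in>I. X i)" using \<theta> I(2) by (auto simp: PiE_def extensional_def)
      ultimately show "\<theta> \<in> ?f -` (\<Pi>\<^sub>E i\<in>I. X i) \<inter> space ?P" by blast
    qed
    then have "emeasure (distr ?P ?P ?f) (\<Pi>\<^sub>E i\<in>I. X i) = emeasure ?P (\<Pi>\<^sub>E i\<in>I. Y i)"
      using X I(1) by (subst emeasure_distr[OF m]) (auto intro: sets_PiM_I_finite)
    also have "\<dots> = (\<Prod>i\<in>I. emeasure unit_interval (Y i))"
      using I(1) Y(1) by (intro emeasure_PiM) simp_all
    also have "\<dots> = (\<Prod>i\<in>I. emeasure unit_interval (X i))" by (rule prod.cong[OF refl Y(2)])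
    finally show "emeasure (distr ?P ?P ?f) (\<Pi>\<^sub>E i\<in>I. X i) = (\<Prod>i\<in>I. emeasure unit_interval (X i))" .
  qed simp
qed

text \<open>The tournament of the peon in the encoding by sets. The peon orients relative to the
  order of the singleton coordinates, the encoding relative to the order of the labels; the sign
  compares the two.\<close>

definition orient :: "nat \<Rightarrow> nat \<Rightarrow> (nat set \<Rightarrow> real) \<Rightarrow> nat set set" where
  "orient k m \<theta> = {A \<in> ksets k {..<m}. \<theta> A < 1/2 \<longleftrightarrow> osgn (\<lambda>i. \<theta> {i}) (sl A) = 1}"

text \<open>Distinct singleton coordinates provide the sorting permutation, and
  \<open>osgn_sl\<close> separates its sign on a tuple into the part belonging to the vertex set and
  the part belonging to the labels.\<close>

lemma samp_tournament:
  assumes k: "1 \<le> k" and \<theta>: "\<theta> \<in> space (\<Pi>\<^sub>M B\<in>low k {..<m}. unit_interval)" and inj: "inj_on (\<lambda>i. \<theta> {i}) {..<m}"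
  shows "samp (tournament_theory k) k (\<lambda>_. tournament_peon k) m \<theta> = tour k {..<m} (orient k m \<theta>)"
proof (rule struct_eqI)
  interpret prob_space unit_interval by (rule prob_space_unit_interval)
  fix P :: unit and \<alpha>
  show "\<alpha> \<in> rels (samp (tournament_theory k) k (\<lambda>_. tournament_peon k) m \<theta>) P \<longleftrightarrow>
      \<alpha> \<in> rels (tour k {..<m} (orient k m \<theta>)) P"
  proof (cases "length \<alpha> = k \<and> distinct \<alpha> \<and> set \<alpha> \<subseteq> {..<m}")
    case True
    then have \<alpha>: "length \<alpha> = k" "distinct \<alpha>" "set \<alpha> \<subseteq> {..<m}" by simp_all
    then have \<alpha>I: "\<alpha> \<in> injs k {..<m}" by (simp add: injs_def)
    let ?x = "lpull k \<alpha> \<theta>"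
    let ?z = "\<lambda>i. \<theta> {i}"
    have x: "?x \<in> space (\<E> {..<k} unit_interval)"
      using measurable_space[OF lpull_measurable[OF \<alpha>I order_refl] \<theta>] unfolding space_\<E> low_self .
    have single: "?x {i} = ?z (\<alpha> ! i)" if "i < k" for i
      using that \<alpha>(1) k by (simp add: lpull_def low_def fin_subsets_def)
    have "{..<k} \<in> low k {..<k}" using k by (auto simp: low_self fin_subsets_def lessThan_empty_iff)
    then have top: "?x {..<k} = \<theta> (set \<alpha>)"
      using \<alpha>(1) by (simp add: lpull_def nth_image lessThan_atLeast0)
    have injz: "inj_on ?z (set \<alpha>)" using inj \<alpha>(3) by (rule inj_on_subset)
    obtain \<sigma> where \<sigma>: "srt (length \<alpha>) (\<lambda>i. ?z (\<alpha> ! i)) \<sigma>"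
      using srt_exists[OF inj_on_nth_comp[OF \<alpha>(2) injz]] by blast
    have eq: "sorting_perm k ?x \<tau> \<longleftrightarrow> srt (length \<alpha>) (\<lambda>i. ?z (\<alpha> ! i)) \<tau>" for \<tau>
      unfolding sorting_perm_eq \<alpha>(1) by (rule srt_cong) (rule single)
    have "?x \<in> tournament_peon k \<longleftrightarrow> (\<exists>\<tau>. sorting_perm k ?x \<tau> \<and> (\<theta> (set \<alpha>) < 1/2 \<longleftrightarrow> sign \<tau> = 1))"
      using x by (simp add: tournament_peon_def top)
    also have "\<dots> \<longleftrightarrow> (\<theta> (set \<alpha>) < 1/2 \<longleftrightarrow> sign \<sigma> = 1)"
      unfolding eq using \<sigma> srt_unique[OF _ \<sigma>] by blast
    also have "\<dots> \<longleftrightarrow> (\<theta> (set \<alpha>) < 1/2 \<longleftrightarrow> osgn ?z \<alpha> = 1)" by (simp only: osgn_eq[OF \<sigma>])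
    also have "\<dots> \<longleftrightarrow> ((\<theta> (set \<alpha>) < 1/2 \<longleftrightarrow> osgn ?z (sl (set \<alpha>)) = 1) \<longleftrightarrow> lsgn \<alpha> = 1)"
      unfolding osgn_sl[OF \<alpha>(2) injz]
      using osgn_cases[of ?z "sl (set \<alpha>)"] osgn_cases[of real \<alpha>] by auto
    also have "\<dots> \<longleftrightarrow> (set \<alpha> \<in> orient k m \<theta> \<longleftrightarrow> lsgn \<alpha> = 1)"
      using \<alpha> by (simp add: orient_def ksets_def distinct_card)
    finally show ?thesis using \<alpha> by (simp add: mem_rels_samp mem_rels_tour)
  next
    case False
    then show ?thesis unfolding mem_rels_samp mem_rels_tour by auto
  qed
qed simp

text \<open>As in \<open>joint_eq\<close>, invariance under flips makes all tournaments equally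
  likely; here it comes from reflecting the coordinate at one k-set. The bound k \<ge> 2 keeps that
  coordinate apart from the singleton coordinates, which determine the signs.\<close>

lemma labelled_quasirandom:
  assumes k: "2 \<le> k" and U: "U \<subseteq> ksets k {..<m}"
  shows "labelled (quasirandom_tournamon k) (tour k {..<m} U) = 1 / 2 ^ card (ksets k {..<m})"
proof -
  have k1: "1 \<le> k" using k by simp
  interpret sampler unit_interval "tournament_theory k" k "\<lambda>_. tournament_peon k" by (rule sampler_tournament[OF k1])
  let ?P = "\<Pi>\<^sub>M B\<in>low k {..<m}. unit_interval"
  let ?samp = "samp (tournament_theory k) k (\<lambda>_. tournament_peon k) m"
  interpret P: prob_space ?P by (rule prob_space_prod)
  have fin: "finite (low k {..<m})" by (simp add: finite_low)
  have finU: "finite (Pow (ksets k {..<m}))" by (simp add: finite_ksets)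
  have "induced (theon_struct (tournament_theory k) (\<lambda>_. tournament_peon k) \<theta>) {..<n} =
      samp (tournament_theory k) k (\<lambda>_. tournament_peon k) n \<theta>" for \<theta> n
    by (rule struct_eqI) (auto simp: induced_def theon_struct_def mem_rels_samp pull_eq_lpull)
  then have lab: "labelled (quasirandom_tournamon k) M = law m M" if "M \<in> labs (tournament_theory k) m" for M
    unfolding quasirandom_tournamon_def by (intro labelled_theon_limit[OF _ that]) simp
  have single: "{i} \<in> low k {..<m}" if "i < m" for i using that k1 by (simp add: low_def fin_subsets_def)
  have kset: "A \<in> low k {..<m}" "{i} \<noteq> A" if "A \<in> ksets k {..<m}" for A i
    using that k finite_subset[of A "{..<m}"] by (auto simp: ksets_def low_def fin_subsets_def)
  have "AE \<theta> in ?P. \<forall>i\<in>{..<m}. \<forall>j\<in>{..<m}. i \<noteq> j \<longrightarrow> \<theta> {i} \<noteq> \<theta> {j}"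
  proof (intro AE_finite_allI finite_lessThan)
    fix i j assume ij: "i \<in> {..<m}" "j \<in> {..<m}"
    have "AE \<theta> in ?P. \<theta> {i} \<noteq> \<theta> {j}" if "i \<noteq> j"
      using ij that single
      by (intro AE_PiM_neq prob_space_unit_interval id_borel_unit_interval AE_unit_interval_neq fin) simp_all
    then show "AE \<theta> in ?P. i \<noteq> j \<longrightarrow> \<theta> {i} \<noteq> \<theta> {j}" by (cases "i = j") simp_all
  qed
  then have inj: "AE \<theta> in ?P. inj_on (\<lambda>i. \<theta> {i}) {..<m}"
    by eventually_elim (auto simp: inj_on_def)
  have S: "AE \<theta> in ?P. ?samp \<theta> = tour k {..<m} (orient k m \<theta>)"
    using inj AE_space by eventually_elim (rule samp_tournament[OF k1])
  have sets: "{\<theta> \<in> space ?P. ?samp \<theta> = M} \<in> sets ?P" for M by (rule sets_samp_eq)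
  have sub: "orient k m \<theta> \<subseteq> ksets k {..<m}" for \<theta> by (auto simp: orient_def)
  have flip: "law m (tour k {..<m} (flip A W)) = law m (tour k {..<m} W)"
    if A: "A \<in> ksets k {..<m}" and W: "W \<subseteq> ksets k {..<m}" for A W
  proof -
    let ?f = "\<lambda>\<theta>. \<theta>(A := 1 - \<theta> A)"
    note f = distr_reflect_coordinate[OF fin kset(1)[OF A]]
    have fW: "flip A W \<subseteq> ksets k {..<m}" using W A by (auto simp: flip_def)
    \<comment> \<open>At 1/2 the reflection leaves the coordinate, and hence the orientation,
      unchanged.\<close>
    have half: "AE \<theta> in ?P. \<theta> A \<noteq> 1/2"
      by (rule AE_PiM_component[where P = "\<lambda>x. x \<noteq> 1/2"])
        (rule prob_space_unit_interval, rule kset(1)[OF A], rule AE_unit_interval_neq)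
    have Sf: "AE \<theta> in ?P. ?samp (?f \<theta>) = tour k {..<m} (orient k m (?f \<theta>))"
      by (rule AE_distrD[OF f(1)]) (simp only: f(2) S)
    have orient: "orient k m (?f \<theta>) = flip A (orient k m \<theta>)" if "\<theta> A \<noteq> 1/2" for \<theta>
    proof -
      have s: "(\<lambda>i. ?f \<theta> {i}) = (\<lambda>i. \<theta> {i})" using kset(2)[OF A] by auto
      show ?thesis
      proof (rule set_eqI)
        fix C show "C \<in> orient k m (?f \<theta>) \<longleftrightarrow> C \<in> flip A (orient k m \<theta>)"
          unfolding mem_flip orient_def s using A that by (cases "C = A") auto
      qed
    qed
    have tflip: "tour k {..<m} (flip A V) = tour k {..<m} (flip A W) \<longleftrightarrow> tour k {..<m} V = tour k {..<m} W"
      if V: "V \<subseteq> ksets k {..<m}" for V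
    proof
      assume "tour k {..<m} (flip A V) = tour k {..<m} (flip A W)"
      moreover have "flip A V \<subseteq> ksets k {..<m}" using V A by (auto simp: flip_def)
      ultimately have "flip A V = flip A W" using tour_inj[OF _ _ fW k1] by blast
      then have "flip A (flip A V) = flip A (flip A W)" by (rule arg_cong)
      moreover have "flip A (flip A C) = C" for C by (rule set_eqI) (unfold mem_flip, blast)
      ultimately have "V = W" by (simp only:)
      then show "tour k {..<m} V = tour k {..<m} W" by simp
    next
      assume "tour k {..<m} V = tour k {..<m} W"
      then have "V = W" by (rule tour_inj[OF _ V W k1])
      then show "tour k {..<m} (flip A V) = tour k {..<m} (flip A W)" by simp
    qed
    let ?X = "{\<theta> \<in> space ?P. ?samp \<theta> = tour k {..<m} (flip A W)}"
    have "law m (tour k {..<m} (flip A W)) = measure (distr ?P ?P ?f) ?X"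
      unfolding law_def f(2) ..
    also have "\<dots> = measure ?P (?f -` ?X \<inter> space ?P)" by (rule measure_distr[OF f(1) sets])
    also have "\<dots> = measure ?P {\<theta> \<in> space ?P. ?samp \<theta> = tour k {..<m} W}"
    proof (rule P.finite_measure_eq_AE)
      show "?f -` ?X \<inter> space ?P \<in> sets ?P" by (rule measurable_sets[OF f(1) sets])
      show "AE \<theta> in ?P. \<theta> \<in> ?f -` ?X \<inter> space ?P \<longleftrightarrow> \<theta> \<in> {\<theta> \<in> space ?P. ?samp \<theta> = tour k {..<m} W}"
        using S Sf half AE_space
      proof eventually_elim
        case (elim \<theta>)
        have "?f \<theta> \<in> space ?P" by (rule measurable_space[OF f(1) elim(4)])
        then show ?case
          using elim tflip[OF sub, of \<theta>] orient[of \<theta>, OF elim(3)] by simp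
      qed
    qed (rule sets)
    also have "\<dots> = law m (tour k {..<m} W)" by (simp add: law_def)
    finally show ?thesis .
  qed
  have empty: "law m (tour k {..<m} W) = law m (tour k {..<m} {})" if "W \<subseteq> ksets k {..<m}" for W
  proof -
    have "finite W" using that finite_ksets[of "{..<m}" k] finite_subset by blast
    then show ?thesis using that
    proof (induction W)
      case (insert A W)
      then have "flip A W = insert A W" by (simp add: flip_def)
      then show ?case using flip[of A W] insert by simp
    qed simp
  qed
  have "(\<Sum>W\<in>Pow (ksets k {..<m}). law m (tour k {..<m} W)) =
      measure ?P (\<Union>W\<in>Pow (ksets k {..<m}). {\<theta> \<in> space ?P. ?samp \<theta> = tour k {..<m} W})"
    unfolding law_def
  proof (rule P.finite_measure_finite_Union[symmetric, OF finU])
    show "(\<lambda>W. {\<theta> \<in> space ?P. ?samp \<theta> = tour k {..<m} W}) ` Pow (ksets k {..<m}) \<subseteq> sets ?P" using sets by blast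
    have "W = W'" if "W \<in> Pow (ksets k {..<m})" "W' \<in> Pow (ksets k {..<m})"
      "\<theta> \<in> {\<theta> \<in> space ?P. ?samp \<theta> = tour k {..<m} W} \<inter> {\<theta> \<in> space ?P. ?samp \<theta> = tour k {..<m} W'}" for W W' \<theta>
      using that by (intro tour_inj[of k "{..<m}", OF _ _ _ k1]) auto
    then show "disjoint_family_on (\<lambda>W. {\<theta> \<in> space ?P. ?samp \<theta> = tour k {..<m} W}) (Pow (ksets k {..<m}))"
      unfolding disjoint_family_on_def by blast
  qed
  also have "\<dots> = 1"
  proof (rule P.prob_eq_1[THEN iffD2])
    show "(\<Union>W\<in>Pow (ksets k {..<m}). {\<theta> \<in> space ?P. ?samp \<theta> = tour k {..<m} W}) \<in> P.events"
      using finU sets by (rule sets.finite_UN)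
    show "AE \<theta> in ?P. \<theta> \<in> (\<Union>W\<in>Pow (ksets k {..<m}). {\<theta> \<in> space ?P. ?samp \<theta> = tour k {..<m} W})"
      using S AE_space
    proof eventually_elim
      case (elim \<theta>)
      then show ?case using sub[of \<theta>] by (intro UN_I[of "orient k m \<theta>"]) simp_all
    qed
  qed
  finally have "(\<Sum>W\<in>Pow (ksets k {..<m}). law m (tour k {..<m} W)) = 1" .
  moreover have "(\<Sum>W\<in>Pow (ksets k {..<m}). law m (tour k {..<m} W)) =
      (\<Sum>W\<in>Pow (ksets k {..<m}). law m (tour k {..<m} U))"
  proof (rule sum.cong[OF refl])
    fix W assume "W \<in> Pow (ksets k {..<m})"
    then show "law m (tour k {..<m} W) = law m (tour k {..<m} U)" using empty[of W] empty[OF U] by simp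
  qed
  ultimately have "2 ^ card (ksets k {..<m}) * law m (tour k {..<m} U) = 1"
    by (simp add: card_Pow finite_ksets)
  moreover have "tour k {..<m} U \<in> labs (tournament_theory k) m" using U by (simp add: labs_tournament[OF k1])
  ultimately show ?thesis by (simp add: lab eq_divide_eq mult.commute)
qed

lemma uniform_quasirandom_tournamon: "2 \<le> k \<Longrightarrow> uniform_tournamon k (quasirandom_tournamon k)"
  unfolding uniform_tournamon_def
  by (auto simp: labelled_quasirandom) (simp add: quasirandom_tournamon_def theon_limit_def)

text \<open>A single point \<theta> suffices: almost every \<theta> gives a model, so one exists,
  and at it two tuples with the same vertices that differ by a transposition would be both edges or
  both non-edges.\<close>

lemma not_Independence:
  assumes "1 \<le> l"
  shows "\<not> Independence TYPE('a) l (tournament_theory (l + 1)) \<phi>"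
proof
  let ?k = "l + 1"
  assume "Independence TYPE('a) l (tournament_theory ?k) \<phi>"
  then obtain \<Omega> :: "'a measure" and N where N: "is_theon (tournament_theory ?k) \<Omega> N"
    "peon_independent ?k \<Omega> (N ()) l"
    unfolding Independence_def by auto
  let ?F = "\<Pi>\<^sub>M A\<in>fin_subsets UNIV. \<Omega>"
  have \<Omega>: "prob_space \<Omega>" using N(1) unfolding is_theon_def atomless_complete_prob_def by blast
  interpret \<Omega>: prob_space \<Omega> by (rule \<Omega>)
  interpret F: prob_space ?F by (rule \<Omega>.prob_space_prod)
  have "AE \<theta> in ?F. model (tournament_theory ?k) (theon_struct (tournament_theory ?k) N \<theta>)"
    using N(1) unfolding is_theon_def \<E>_def by (simp add: AE_completion_iff)
  with AE_space have ae: "AE \<theta> in ?F. \<theta> \<in> space ?F \<and> model (tournament_theory ?k) (theon_struct (tournament_theory ?k) N \<theta>)"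
    by eventually_elim blast
  have "\<exists>\<theta>. \<theta> \<in> space ?F \<and> model (tournament_theory ?k) (theon_struct (tournament_theory ?k) N \<theta>)"
  proof (rule ccontr)
    assume "\<not> ?thesis"
    then have "AE \<theta> in ?F. False" using ae by (auto elim: eventually_mono)
    then show False by simp
  qed
  then obtain \<theta> where \<theta>: "\<theta> \<in> space ?F" "model (tournament_theory ?k) (theon_struct (tournament_theory ?k) N \<theta>)"
    by blast
  let ?M = "theon_struct (tournament_theory ?k) N \<theta>"
  let ?\<alpha> = "[0..<?k]"
  \<comment> \<open>An odd permutation of the edge; the assumption on l makes both 0 and 1 vertices
    of it.\<close>
  let ?\<beta> = "permute_list (Transposition.transpose 0 1) ?\<alpha>"
  obtain H where H: "N () = {x \<in> space (\<E> {..<?k} \<Omega>). restrict x {A \<in> fin_subsets {..<?k}. l < card A} \<in> H}"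
    using N(2) unfolding peon_independent_def by blast
  have top: "{A \<in> fin_subsets {..<?k}. l < card A} = {{..<?k}}"
  proof (intro equalityI subsetI)
    fix A assume "A \<in> {A \<in> fin_subsets {..<?k}. l < card A}"
    then have A: "A \<subseteq> {..<?k}" "l < card A" by (simp_all add: fin_subsets_def)
    then have "A = {..<?k}" using card_mono[OF finite_lessThan A(1)] by (intro card_subset_eq) simp_all
    then show "A \<in> {{..<?k}}" by simp
  qed (auto simp: fin_subsets_def lessThan_empty_iff)
  have \<tau>: "Transposition.transpose 0 1 permutes {..<?k}" using assms by (intro permutes_swap_id) simp_all
  have mem: "\<gamma> \<in> rels ?M () \<longleftrightarrow> (\<lambda>A\<in>{{..<?k}}. \<theta> (set \<gamma>)) \<in> H" if \<gamma>: "length \<gamma> = ?k" "distinct \<gamma>" for \<gamma>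
  proof -
    have \<gamma>I: "\<gamma> \<in> injs ?k UNIV" using \<gamma> by (simp add: injs_def)
    have "low ?k UNIV \<subseteq> fin_subsets UNIV" by (auto simp: low_def)
    then have "lpull ?k \<gamma> \<theta> \<in> space (\<Pi>\<^sub>M B\<in>low ?k {..<?k}. \<Omega>)"
      by (rule measurable_space[OF \<Omega>.lpull_measurable[OF \<gamma>I] \<theta>(1)])
    then have "pull \<gamma> \<theta> \<in> space (\<E> {..<?k} \<Omega>)"
      unfolding space_\<E> low_self pull_eq_lpull \<gamma>(1) .
    moreover have "restrict (pull \<gamma> \<theta>) {{..<?k}} = (\<lambda>A\<in>{{..<?k}}. \<theta> (set \<gamma>))"
    proof (rule restrict_ext)
      fix A assume "A \<in> {{..<?k}}"
      then have "A = {..<?k}" by simp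
      moreover have "(!) \<gamma> ` {..<?k} = set \<gamma>" using \<gamma>(1) nth_image[of ?k \<gamma>] by (simp add: lessThan_atLeast0)
      moreover have "{..<?k} \<in> fin_subsets {..<?k}" by (auto simp: fin_subsets_def lessThan_empty_iff)
      ultimately show "pull \<gamma> \<theta> A = \<theta> (set \<gamma>)" using \<gamma>(1) by (simp only: pull_def restrict_apply if_True)
    qed
    ultimately have "pull \<gamma> \<theta> \<in> N () \<longleftrightarrow> (\<lambda>A\<in>{{..<?k}}. \<theta> (set \<gamma>)) \<in> H" unfolding H top by simp
    then show ?thesis using \<gamma> by (simp add: theon_struct_def)
  qed
  have "set ?\<beta> = set ?\<alpha>" "distinct ?\<beta>" "length ?\<beta> = ?k" using \<tau> by (simp_all del: upt_Suc)
  then have "?\<beta> \<in> rels ?M () \<longleftrightarrow> ?\<alpha> \<in> rels ?M ()" using mem[of ?\<alpha>] mem[of ?\<beta>] by (simp del: upt_Suc)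
  moreover have "permute_list (Transposition.transpose 0 1) (map id ?\<alpha>) \<in> rels ?M () \<longleftrightarrow>
      (map id ?\<alpha> \<in> rels ?M () \<longleftrightarrow> sign (Transposition.transpose 0 (1::nat)) = 1)"
  proof -
    have "\<forall>v \<sigma>. range v \<subseteq> verts ?M \<longrightarrow> \<sigma> permutes {..<?k} \<longrightarrow> distinct (map v ?\<alpha>) \<longrightarrow>
        (permute_list \<sigma> (map v ?\<alpha>) \<in> rels ?M () \<longleftrightarrow> (map v ?\<alpha> \<in> rels ?M () \<longleftrightarrow> sign \<sigma> = 1))"
      using \<theta>(2) unfolding model_tournament_iff by blast
    moreover have "range id \<subseteq> verts ?M" by (simp add: theon_struct_def)
    moreover have "distinct (map id ?\<alpha>)" by (simp del: upt_Suc)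
    ultimately show ?thesis using \<tau> by blast
  qed
  ultimately show False by (simp add: sign_swap_id del: upt_Suc)
qed

section \<open>Extracting a theon of bounded rank, and conclusion\<close>

lemma peon_rank_le_mono:
  assumes "peon_rank_le a \<Omega> N r" "r \<le> l"
  shows "peon_rank_le a \<Omega> N l"
proof -
  let ?R = "\<lambda>r. {A \<in> fin_subsets {..<a}. card A \<le> r}"
  obtain H where H: "N = {x \<in> space (\<E> {..<a} \<Omega>). restrict x (?R r) \<in> H}"
    using assms(1) unfolding peon_rank_le_def by blast
  have "restrict (restrict x (?R l)) (?R r) = restrict x (?R r)" for x :: "nat set \<Rightarrow> 'a"
    using assms(2) by (auto simp: restrict_def fun_eq_iff)
  then have "N = {x \<in> space (\<E> {..<a} \<Omega>). restrict x (?R l) \<in> {y. restrict y (?R r) \<in> H}}"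
    unfolding H by simp
  then show ?thesis unfolding peon_rank_le_def by blast
qed

text \<open>Provides an admissible value for the \<open>LEAST\<close> in \<open>peon_rank\<close>,
  so that the rank is attained.\<close>

lemma peon_rank_le_arity:
  assumes "N \<in> sets (\<E> {..<a} \<Omega>)"
  shows "peon_rank_le a \<Omega> N a"
proof -
  have "{A \<in> fin_subsets {..<a}. card A \<le> a} = fin_subsets {..<a}" using low_self[of a] unfolding low_def .
  moreover have "restrict x (fin_subsets {..<a}) = x" if "x \<in> space (\<E> {..<a} \<Omega>)" for x
    using that unfolding space_\<E> space_PiM by (intro extensional_restrict) (simp add: PiE_def)
  moreover have "N \<subseteq> space (\<E> {..<a} \<Omega>)" using assms by (rule sets.sets_into_space)
  ultimately have "N = {x \<in> space (\<E> {..<a} \<Omega>). restrict x {A \<in> fin_subsets {..<a}. card A \<le> a} \<in> N}" by auto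
  then show ?thesis unfolding peon_rank_le_def by blast
qed

text \<open>An infimum over no theons would be \<infinity>, so some theon represents \<psi>. The
  infimum of a nonempty set of \<open>enat\<close> is attained, so one of them realises the
  rank.\<close>

lemma rk_leD:
  assumes "rk TYPE('a) T \<psi> \<le> enat l"
  shows "\<exists>(\<Omega> :: 'a measure) N. is_theon T \<Omega> N \<and> theon_limit T \<Omega> N = \<psi> \<and>
    (\<forall>P\<in>preds T. peon_rank_le (arity T P) \<Omega> (N P) l)"
proof -
  let ?X = "{(\<Omega> :: 'a measure, N). is_theon T \<Omega> N \<and> theon_limit T \<Omega> N = \<psi>}"
  let ?f = "\<lambda>(\<Omega> :: 'a measure, N). SUP P\<in>preds T. enat (peon_rank (arity T P) \<Omega> (N P))"
  have rk: "rk TYPE('a) T \<psi> = Inf (?f ` ?X)" unfolding rk_def by (rule refl)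
  have "?f ` ?X \<noteq> {}"
  proof
    assume "?f ` ?X = {}"
    then have "rk TYPE('a) T \<psi> = \<infinity>" by (simp only: rk Inf_empty top_enat_def)
    then show False using assms by simp
  qed
  then have "\<exists>y. y \<in> ?f ` ?X" unfolding ex_in_conv .
  then have "Inf (?f ` ?X) \<in> ?f ` ?X" by (elim exE) (rule wellorder_InfI)
  then obtain p where p0: "Inf (?f ` ?X) = ?f p" "p \<in> ?X" by (rule imageE)
  have "Inf (?f ` ?X) \<le> enat l" using assms unfolding rk .
  then have p: "?f p \<le> enat l" unfolding p0(1) .
  obtain \<Omega> N where pe: "p = (\<Omega>, N)" by (cases p)
  have th: "is_theon T \<Omega> N" "theon_limit T \<Omega> N = \<psi>"
    using p0(2) unfolding pe mem_Collect_eq prod.case by (rule conjunct1, rule conjunct2)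
  have "peon_rank_le (arity T P) \<Omega> (N P) l" if P: "P \<in> preds T" for P
  proof -
    have "enat (peon_rank (arity T P) \<Omega> (N P)) \<le> (SUP P\<in>preds T. enat (peon_rank (arity T P) \<Omega> (N P)))"
      by (rule SUP_upper[OF P])
    also have "\<dots> \<le> enat l" using p unfolding pe prod.case .
    finally have "peon_rank (arity T P) \<Omega> (N P) \<le> l" by simp
    moreover have "N P \<in> sets (\<E> {..<arity T P} \<Omega>)" using th(1) P unfolding is_theon_def by blast
    then have "peon_rank_le (arity T P) \<Omega> (N P) (peon_rank (arity T P) \<Omega> (N P))"
      unfolding peon_rank_def by (rule LeastI[OF peon_rank_le_arity])
    ultimately show ?thesis by (rule peon_rank_le_mono[rotated])
  qed
  then show ?thesis using th by (intro exI[of _ \<Omega>] exI[of _ N] conjI ballI)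
qed

text \<open>The second theory enters through a theon realising the rank bound, turned into a
  sampler. The coupling enters through its labelled marginals, which are what the locale
  \<open>tournament_coupling\<close> asks for.\<close>

lemma UCouple_uniform_tournamon:
  assumes l: "1 \<le> l" and \<phi>: "uniform_tournamon (l + 1) \<phi>"
  shows "UCouple TYPE('a) l (tournament_theory (l + 1)) \<phi>"
  unfolding UCouple_def
proof (intro allI impI)
  fix T :: "nat univ_theory" and \<psi>
  assume can: "canonical T" and \<psi>: "\<psi> \<in> Hom_plus T" and rk: "rk TYPE('a) T \<psi> \<le> enat l"
  let ?k = "l + 1"
  let ?T = "tournament_theory ?k"
  have T: "universal_theory T" using can by (simp add: canonical_def)
  have k1: "1 \<le> ?k" by simp
  obtain \<Omega> :: "'a measure" and N where N: "is_theon T \<Omega> N" "theon_limit T \<Omega> N = \<psi>"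
    "\<forall>P\<in>preds T. peon_rank_le (arity T P) \<Omega> (N P) l"
    using rk_leD[OF rk] by blast
  obtain H where HS: "sampler \<Omega> T l H" "\<And>m M. M \<in> labs T m \<Longrightarrow> labelled \<psi> M = sampler.law \<Omega> T l H m M"
    using ex_sampler[OF T N(1), of l] N(2,3) by blast
  have \<phi>val: "labelled \<phi> (tour ?k {..<m} U) = 1 / 2 ^ card (ksets ?k {..<m})" if "U \<subseteq> ksets ?k {..<m}" for U m
    using \<phi> that by (simp add: uniform_tournamon_def)
  have \<phi>H: "\<phi> \<in> Hom_plus ?T" by (rule Hom_plus_tournamon[OF k1 \<phi>])
  show "uniquely_coupleable ?T T \<phi> \<psi>"
  proof (rule uniquely_coupleableI[OF universal_tournament[OF k1] T \<phi>H \<psi> Hom_plus_independent_coupling[OF k1 \<phi> T \<psi>]])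
    fix \<xi> m A B assume \<xi>: "\<xi> \<in> couplings ?T T \<phi> \<psi>" and A: "A \<in> labs ?T m" and B: "B \<in> labs T m"
    have \<xi>H: "\<xi> \<in> Hom_plus (union_theory ?T T)" and left: "limit_reduct_left ?T T \<xi> = \<phi>"
      and right: "limit_reduct_right ?T T \<xi> = \<psi>" using \<xi> by (simp_all add: couplings_def)
    interpret sampler \<Omega> T l H by (rule HS(1))
    interpret tournament_coupling \<Omega> T l H ?k \<xi>
    proof
      show "1 \<le> l" by (rule l)
      show "?k = Suc l" by simp
      show "\<xi> \<in> Hom_plus (union_theory ?T T)" by (rule \<xi>H)
    next
      fix U m assume U: "U \<subseteq> ksets ?k {..<m}"
      have "tour ?k {..<m} U \<in> labs ?T m" unfolding labs_tournament[OF k1] using U by blast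
      from labelled_limit_reduct_left[OF universal_tournament[OF k1] T \<xi>H this]
      show "(\<Sum>B\<in>labs T m. labelled \<xi> (join (tour ?k {..<m} U) B)) = 1 / 2 ^ card (ksets ?k {..<m})"
        unfolding left \<phi>val[OF U] by (rule sym)
    next
      fix B m assume B: "B \<in> labs T m"
      from labelled_limit_reduct_right[OF universal_tournament[OF k1] T \<xi>H B]
      show "(\<Sum>A\<in>labs ?T m. labelled \<xi> (join A B)) = law m B"
        unfolding right HS(2)[OF B] by (rule sym)
    qed
    obtain U where U: "U \<subseteq> ksets ?k {..<m}" "A = tour ?k {..<m} U"
      using A unfolding labs_tournament[OF k1] by blast
    show "labelled \<xi> (join A B) = labelled \<phi> A * labelled \<psi> B"
      using joint_eq[OF U(1) B] unfolding U(2) \<phi>val[OF U(1)] HS(2)[OF B] joint_def by simp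
  qed
qed

theorem theorem3p6:
  fixes l :: nat
  assumes "1 \<le> l"
  shows "quasirandom_tournamon (l + 1) \<in> Hom_plus (tournament_theory (l + 1)) \<and>
    UCouple TYPE('a) l (tournament_theory (l + 1)) (quasirandom_tournamon (l + 1)) \<and>
    \<not> Independence TYPE('a) l (tournament_theory (l + 1)) (quasirandom_tournamon (l + 1))"
proof (intro conjI)
  have u: "uniform_tournamon (l + 1) (quasirandom_tournamon (l + 1))"
    using assms by (intro uniform_quasirandom_tournamon) simp
  show "quasirandom_tournamon (l + 1) \<in> Hom_plus (tournament_theory (l + 1))"
    using u by (rule Hom_plus_tournamon[rotated]) simp
  show "UCouple TYPE('a) l (tournament_theory (l + 1)) (quasirandom_tournamon (l + 1))"
    by (rule UCouple_uniform_tournamon[OF assms u])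
  show "\<not> Independence TYPE('a) l (tournament_theory (l + 1)) (quasirandom_tournamon (l + 1))"
    by (rule not_Independence[OF assms])
qed

end
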